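(* Let $0<q<1$, $\mu>0$, $z=q^\mu$, and let $I^{(q,z)}=\int_0^\infty q^{\zeta_s}\,ds$, where $\zeta_t=P^+_t-P^-_t$ and $P^+,P^-$ are independent Poisson processes with intensities $1$ and $z$ respectively. The Mellin transform $s\mapsto \mathbb{E}\left(\left(I^{(q,z)}\right)^s\right)$ is analytic for $\Re(s)<\mu$ and is given there by $$\mathbb{E}\left(\left(I^{(q,z)}\right)^s\right)=\Gamma(1+s)\,\frac{(q^{1+s};q)_\infty}{(q;q)_\infty}\,\frac{(z;q)_\infty}{(zq^{-s};q)_\infty}=(1-q)^{-2s}\,\frac{\Gamma(1+s)}{\Gamma_q(1+s)}\,\frac{\Gamma_q(\mu-s)}{\Gamma_q(\mu)} .$$ Moreover, the random variable $I^{(q,z)}$ has density $$\forall x\ge 0,\quad i_{q,z}(x)=\frac{(z;q)_\infty}{(q;q)_\infty}\sum_{m=0}^\infty\sum_{n=0}^\infty\frac{(qz)^m}{(q;q)_m}\,\frac{(-1)^n q^{\binom{n}{2}}}{(q;q)_n}\,e^{-xq^{m-n}} .$$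
   Context: For $a\in\mathbb{C}$ and $n\in\mathbb{N}\cup\{\infty\}$, the $q$-Pochhammer symbol is $(a;q)_n=\prod_{j=0}^{n-1}(1-aq^j)$ (so $(a;q)_0=1$ and $(a;q)_\infty=\prod_{j\ge0}(1-aq^j)$). The $q$-gamma function is $\Gamma_q(x)=(1-q)^{1-x}\frac{(q;q)_\infty}{(q^x;q)_\infty}$ for $x>0$, and the same formula is used for complex $x$ (meromorphically). Here $q^s=e^{s\log q}$ with real $\log q$. The products $\Gamma(1+s)(q^{1+s};q)_\infty$ and $\Gamma(1+s)/\Gamma_q(1+s)$ have removable singularities at $s=-1,-2,\dots$ and are understood with their holomorphic values there. *)

theory Defs
  imports "HOL-Probability.Probability" "HOL-Complex_Analysis.Complex_Analysis"
begin

definition qpoch :: "'a::real_normed_field \<Rightarrow> 'a \<Rightarrow> nat \<Rightarrow> 'a" where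
  "qpoch a q n = (\<Prod>j<n. 1 - a * q ^ j)"

definition qpoch_inf :: "'a::real_normed_field \<Rightarrow> 'a \<Rightarrow> 'a" where
  "qpoch_inf a q = (\<Prod>j. 1 - a * q ^ j)"

text \<open>At the poles (zeros of the denominator) the value is 0, since division is total;
  only limits and regular points of this function are used below.\<close>
definition q_gamma :: "real \<Rightarrow> complex \<Rightarrow> complex" where
  "q_gamma q x = of_real (1 - q) powr (1 - x) * qpoch_inf (of_real q) (of_real q)
                   / qpoch_inf (of_real q powr x) (of_real q)"

context prob_space
begin

text \<open>Paths are counting functions: \<open>\<nat>\<close>-valued, nondecreasing and right-continuous on
  \<open>[0,\<infinity>)\<close>. Because of monotonicity, the natural-number subtraction in the increments never
  truncates. The values of \<open>P\<close> at negative times are irrelevant.\<close>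
definition poisson_process :: "real \<Rightarrow> (real \<Rightarrow> 'a \<Rightarrow> nat) \<Rightarrow> bool" where
  "poisson_process rate P \<longleftrightarrow>
     rate > 0 \<and>
     (\<forall>t\<ge>0. P t \<in> measurable M (count_space UNIV)) \<and>
     (\<forall>\<omega>\<in>space M. P 0 \<omega> = 0 \<and> mono_on {0..} (\<lambda>t. P t \<omega>) \<and>
        (\<forall>t\<ge>0. continuous (at_right t) (\<lambda>s. P s \<omega>))) \<and>
     (\<forall>(t :: nat \<Rightarrow> real) n. 0 \<le> t 0 \<and> mono t \<longrightarrow>
        indep_vars (\<lambda>_. count_space UNIV) (\<lambda>i \<omega>. P (t (Suc i)) \<omega> - P (t i) \<omega>) {..<n}) \<and>
     (\<forall>s t. 0 \<le> s \<and> s < t \<longrightarrow>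
        distr M (count_space UNIV) (\<lambda>\<omega>. P t \<omega> - P s \<omega>)
          = measure_pmf (poisson_pmf (rate * (t - s))))"

text \<open>Independence of the two processes as a whole, i.e. of their sample paths as random elements
  of the product space over the time set \<open>[0,\<infinity>)\<close>.\<close>
definition indep_processes :: "(real \<Rightarrow> 'a \<Rightarrow> nat) \<Rightarrow> (real \<Rightarrow> 'a \<Rightarrow> nat) \<Rightarrow> bool" where
  "indep_processes P P' \<longleftrightarrow>
     indep_var (Pi\<^sub>M {0..} (\<lambda>_. count_space UNIV)) (\<lambda>\<omega>. \<lambda>t\<in>{0..}. P t \<omega>)
               (Pi\<^sub>M {0..} (\<lambda>_. count_space UNIV)) (\<lambda>\<omega>. \<lambda>t\<in>{0..}. P' t \<omega>)"

end

definition poisson_diff :: "(real \<Rightarrow> 'a \<Rightarrow> nat) \<Rightarrow> (real \<Rightarrow> 'a \<Rightarrow> nat) \<Rightarrow> real \<Rightarrow> 'a \<Rightarrow> int" where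
  "poisson_diff Pp Pm t \<omega> = int (Pp t \<omega>) - int (Pm t \<omega>)"

definition exp_functional_integrand ::
    "real \<Rightarrow> (real \<Rightarrow> 'a \<Rightarrow> nat) \<Rightarrow> (real \<Rightarrow> 'a \<Rightarrow> nat) \<Rightarrow> 'a \<Rightarrow> real \<Rightarrow> real" where
  "exp_functional_integrand q Pp Pm \<omega> s = q powi (poisson_diff Pp Pm s \<omega>)"

definition exp_functional ::
    "real \<Rightarrow> (real \<Rightarrow> 'a \<Rightarrow> nat) \<Rightarrow> (real \<Rightarrow> 'a \<Rightarrow> nat) \<Rightarrow> 'a \<Rightarrow> real" where
  "exp_functional q Pp Pm \<omega> = (LINT s:{0..}|lborel. exp_functional_integrand q Pp Pm \<omega> s)"

definition mellin_transform :: "'a measure \<Rightarrow> ('a \<Rightarrow> real) \<Rightarrow> complex \<Rightarrow> complex" where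
  "mellin_transform M X s = (\<integral>\<omega>. complex_of_real (X \<omega>) powr s \<partial>M)"

text \<open>In the next two definitions \<^const>\<open>remove_sings\<close> replaces the value of a product or quotient
  by its limit, which gives the holomorphic value at the removable singularities
  \<open>s = -1, -2, \<dots>\<close>.\<close>
definition mellin_qpoch_form :: "real \<Rightarrow> real \<Rightarrow> complex \<Rightarrow> complex" where
  "mellin_qpoch_form q z s =
     remove_sings (\<lambda>w. Gamma (1 + w) * qpoch_inf (of_real q powr (1 + w)) (of_real q)) s
       / qpoch_inf (of_real q) (of_real q)
     * (qpoch_inf (of_real z) (of_real q)
       / qpoch_inf (of_real z * of_real q powr (- s)) (of_real q))"

definition mellin_qgamma_form :: "real \<Rightarrow> real \<Rightarrow> complex \<Rightarrow> complex" where
  "mellin_qgamma_form q \<mu> s =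
     of_real (1 - q) powr (- 2 * s)
     * remove_sings (\<lambda>w. Gamma (1 + w) / q_gamma q (1 + w)) s
     * (q_gamma q (of_real \<mu> - s) / q_gamma q (of_real \<mu>))"

definition density_term :: "real \<Rightarrow> real \<Rightarrow> real \<Rightarrow> nat \<Rightarrow> nat \<Rightarrow> real" where
  "density_term q z x m n =
     (q * z) ^ m / qpoch q q m * ((- 1) ^ n * q ^ (n choose 2) / qpoch q q n)
     * exp (- x * q powi (int m - int n))"

definition density_fun :: "real \<Rightarrow> real \<Rightarrow> real \<Rightarrow> real" where
  "density_fun q z x = qpoch_inf z q / qpoch_inf q q * (\<Sum>m. \<Sum>n. density_term q z x m n)"

end

theory Submission
  imports Defs
begin

text \<open>
  The law of the functional \<open>I\<close> is found through its characteristic function \<open>\<phi>\<close>. Over a short time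
  \<open>h\<close> the path \<open>q\<^sup>\<zeta>\<close> stays at its level, or is multiplied by \<open>q\<close> with probability about \<open>h\<close>, or by
  \<open>1/q\<close> with probability about \<open>z h\<close>; afterwards everything starts afresh. In the limit \<open>h \<rightarrow> 0\<close> this
  gives the q-difference equation
    \<open>(1 + z - \<i> t) \<phi>(t) = \<phi>(q t) + z \<phi>(t / q)\<close>.
  A maximum principle shows that a bounded continuous solution is determined by its value at \<open>0\<close>:
  the difference \<open>d\<close> of two solutions vanishes at \<open>0\<close> and at infinity, hence \<open>|d|\<close> attains its
  maximum, and there the equation says \<open>|1 + z - \<i> t| |d(t)| \<le> (1 + z) |d(t)|\<close>, which forces
  \<open>d = 0\<close> (\<open>q_difference_unique\<close>).

  To avoid the strong Markov property, the equation is not derived for \<open>I\<close> itself but for its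
  Riemann sums over the grids of mesh \<open>1 / n\<close>. Such a sum is a functional of a random walk with
  independent increments, the law of the first \<open>N\<close> increments is a discrete law on lists, and
  splitting off the head of the list is the renewal at the first step (\<open>walk_char_Suc\<close>). The
  equation appears as \<open>n\<close> tends to infinity (\<open>q_difference_limit\<close>). The passage from Riemann sums
  to the integral is dominated almost surely by a summable sequence built from the values of the two
  processes at integer times (\<open>AE_summable_block_bound\<close>).

  The density satisfies the same equation. It is a mixture of dilations of a single function
  \<open>profile\<close>, the sum over \<open>n\<close> in the double series. The coefficients of the two sums are those of
  Euler's series for \<open>(x;q)\<^sub>\<infinity>\<close> and \<open>1 / (x;q)\<^sub>\<infinity>\<close>, and their recursions turn into the q-difference
  equation (\<open>char_law_q_difference\<close>). Positivity is not visible in the alternating series, but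
  \<open>profile\<close> is, up to a constant factor, a limit of densities of sums of independent exponential variables
  (\<open>profile_nonneg\<close>). Since \<open>(x;q)\<^sub>\<infinity>\<close> vanishes at \<open>1, 1/q, 1/q\<^sup>2, \<dots>\<close>, the density is flat at
  \<open>0\<close>, so that \<open>I\<close> has negative moments of all orders (\<open>profile_le_power\<close>).

  Once the density is known, the Mellin transform for \<open>-1 < Re s < \<mu>\<close> is computed term by term from
  the Gamma integral and Euler's series (\<open>mellin_law\<close>), and the identity theorem extends the formula
  to the half plane \<open>Re s < \<mu>\<close> (\<open>mellin_continuation\<close>).
\<close>

section \<open>The q-Pochhammer symbol and its two Euler series\<close>

locale q_base =
  fixes q :: real
  assumes q_pos: "0 < q" and q_less_one: "q < 1"
begin

lemma q_power_less_one: "q ^ Suc n < 1"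
  using q_pos q_less_one by (metis power_Suc_less_one)

lemma summable_q_power: "summable (\<lambda>j. q ^ j)"
  using q_pos q_less_one by (simp add: summable_geometric)

lemma convergent_qpoch:
  fixes a :: "'a::{real_normed_field, banach}"
  shows "convergent_prod (\<lambda>j. 1 - a * of_real q ^ j)"
proof -
  have "summable (\<lambda>j. norm ((1 - a * of_real q ^ j) - 1))"
    using summable_q_power q_pos
    by (auto simp: norm_mult norm_power intro!: summable_mult)
  then show ?thesis
    by (intro abs_convergent_prod_imp_convergent_prod summable_imp_abs_convergent_prod)
qed

lemma qpoch_LIMSEQ:
  fixes a :: "'a::{real_normed_field, banach}"
  shows "(\<lambda>n. qpoch a (of_real q) n) \<longlonglongrightarrow> qpoch_inf a (of_real q)"
proof -
  have "(\<lambda>n. \<Prod>j\<le>n. 1 - a * of_real q ^ j) \<longlonglongrightarrow> qpoch_inf a (of_real q)"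
    unfolding qpoch_inf_def by (intro convergent_prod_LIMSEQ convergent_qpoch)
  then have "(\<lambda>n. qpoch a (of_real q) (Suc n)) \<longlonglongrightarrow> qpoch_inf a (of_real q)"
    by (simp add: qpoch_def lessThan_Suc_atMost)
  then show ?thesis by (rule LIMSEQ_imp_Suc)
qed

lemma qpoch_of_real: "qpoch (of_real a) (of_real q) n = (of_real (qpoch a q n) :: 'a::real_normed_field)"
  by (simp add: qpoch_def)

lemma qpoch_inf_of_real:
  "qpoch_inf (of_real a) (of_real q) = (of_real (qpoch_inf a q) :: 'a::{real_normed_field, banach})"
proof (rule LIMSEQ_unique)
  show "(\<lambda>n. qpoch (of_real a :: 'a) (of_real q) n) \<longlonglongrightarrow> qpoch_inf (of_real a) (of_real q)"
    by (rule qpoch_LIMSEQ)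
  show "(\<lambda>n. qpoch (of_real a :: 'a) (of_real q) n) \<longlonglongrightarrow> of_real (qpoch_inf a q)"
    unfolding qpoch_of_real using qpoch_LIMSEQ[of a] by (intro tendsto_of_real) simp
qed

lemma qpoch_Suc: "qpoch q q (Suc n) = qpoch q q n * (1 - q ^ Suc n)"
  by (simp add: qpoch_def)

lemma qpoch_zero [simp]: "qpoch a q 0 = 1"
  by (simp add: qpoch_def)

lemma qpoch_pos: "0 < qpoch q q n"
  unfolding qpoch_def using q_power_less_one by (intro prod_pos) auto

lemma qpoch_ge_qpoch_inf: "qpoch_inf q q \<le> qpoch q q n"
proof -
  have "decseq (\<lambda>n. qpoch q q n)"
  proof (rule decseq_SucI)
    fix n
    have "qpoch q q n * (1 - q ^ Suc n) \<le> qpoch q q n * 1"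
      using qpoch_pos[of n] q_pos by (intro mult_left_mono) auto
    then show "qpoch q q (Suc n) \<le> qpoch q q n"
      unfolding qpoch_Suc by simp
  qed
  then show ?thesis
    using qpoch_LIMSEQ[of q] by (auto intro: decseq_ge)
qed

text \<open>The Taylor coefficients of \<open>1 / (x;q)\<^sub>\<infinity>\<close>.\<close>

definition inv_coeff :: "nat \<Rightarrow> real" where
  "inv_coeff n = 1 / qpoch q q n"

text \<open>The Taylor coefficients of \<open>(x;q)\<^sub>\<infinity>\<close>.\<close>

definition alt_coeff :: "nat \<Rightarrow> real" where
  "alt_coeff n = (-1) ^ n * q ^ (n choose 2) / qpoch q q n"

lemma inv_coeff_0 [simp]: "inv_coeff 0 = 1" and alt_coeff_0 [simp]: "alt_coeff 0 = 1"
  by (simp_all add: inv_coeff_def alt_coeff_def binomial_eq_0)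

lemma inv_coeff_pos: "0 < inv_coeff n"
  using qpoch_pos by (simp add: inv_coeff_def)

lemma inv_coeff_Suc: "inv_coeff (Suc n) * (1 - q ^ Suc n) = inv_coeff n"
  using q_power_less_one[of n] qpoch_pos[of n] by (simp add: inv_coeff_def qpoch_Suc field_simps)

lemma alt_coeff_Suc: "alt_coeff (Suc n) * (1 - q ^ Suc n) = - (q ^ n) * alt_coeff n"
proof -
  have "Suc n choose 2 = n + (n choose 2)"
    by (simp add: numeral_2_eq_2)
  then show ?thesis
    using q_power_less_one[of n] qpoch_pos[of n]
    by (simp add: alt_coeff_def qpoch_Suc field_simps power_add)
qed

lemma tendsto_q_power: "(\<lambda>n. q ^ n) \<longlonglongrightarrow> 0"
  using q_pos q_less_one by (intro LIMSEQ_power_zero) auto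

lemma summable_norm_inv_coeff:
  assumes "norm x < 1"
  shows "summable (\<lambda>n. inv_coeff n * norm x ^ n)"
proof -
  define c where "c = (norm x + 1) / 2"
  have c: "norm x < c" "c < 1" using assms by (auto simp: c_def)
  have "(\<lambda>n. norm x / (1 - q ^ Suc n)) \<longlonglongrightarrow> norm x / (1 - 0)"
    by (intro tendsto_intros LIMSEQ_Suc[OF tendsto_q_power]) auto
  then have "eventually (\<lambda>n. norm x / (1 - q ^ Suc n) < c) sequentially"
    using c by (intro order_tendstoD) auto
  then obtain N where N: "norm x / (1 - q ^ Suc n) < c" if "n \<ge> N" for n
    by (auto simp: eventually_sequentially)
  show ?thesis
  proof (rule summable_ratio_test[OF c(2)])
    fix n assume "n \<ge> N"
    have "inv_coeff (Suc n) = inv_coeff n / (1 - q ^ Suc n)"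
      using inv_coeff_Suc[of n] q_power_less_one[of n] by (simp add: field_simps)
    then have "norm (inv_coeff (Suc n) * norm x ^ Suc n)
        = (norm x / (1 - q ^ Suc n)) * norm (inv_coeff n * norm x ^ n)"
      using inv_coeff_pos[of n] q_power_less_one[of n] by (simp add: abs_mult)
    also have "\<dots> \<le> c * norm (inv_coeff n * norm x ^ n)"
      using N[OF \<open>n \<ge> N\<close>] by (intro mult_right_mono) auto
    finally show "norm (inv_coeff (Suc n) * norm x ^ Suc n) \<le> c * norm (inv_coeff n * norm x ^ n)" .
  qed
qed

lemma summable_norm_alt_coeff: "summable (\<lambda>n. \<bar>alt_coeff n\<bar> * norm x ^ n)"
proof -
  have "(\<lambda>n. q ^ n * norm x / (1 - q ^ Suc n)) \<longlonglongrightarrow> 0 * norm x / (1 - 0)"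
    by (intro tendsto_intros LIMSEQ_Suc[OF tendsto_q_power] tendsto_q_power) auto
  then have "eventually (\<lambda>n. q ^ n * norm x / (1 - q ^ Suc n) < 1 / 2) sequentially"
    by (intro order_tendstoD) auto
  then obtain N where N: "q ^ n * norm x / (1 - q ^ Suc n) < 1 / 2" if "n \<ge> N" for n
    by (auto simp: eventually_sequentially)
  show ?thesis
  proof (rule summable_ratio_test)
    show "(1/2::real) < 1" by simp
    fix n assume "n \<ge> N"
    have *: "alt_coeff (Suc n) = - (q ^ n) * alt_coeff n / (1 - q ^ Suc n)"
      using alt_coeff_Suc[of n] q_power_less_one[of n] by (simp add: field_simps)
    have "norm (\<bar>alt_coeff (Suc n)\<bar> * norm x ^ Suc n)
        = (q ^ n * norm x / (1 - q ^ Suc n)) * norm (\<bar>alt_coeff n\<bar> * norm x ^ n)"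
      unfolding * using q_power_less_one[of n] q_pos by (simp add: abs_mult)
    also have "\<dots> \<le> 1/2 * norm (\<bar>alt_coeff n\<bar> * norm x ^ n)"
      using N[OF \<open>n \<ge> N\<close>] by (intro mult_right_mono) auto
    finally show "norm (\<bar>alt_coeff (Suc n)\<bar> * norm x ^ Suc n) \<le> 1/2 * norm (\<bar>alt_coeff n\<bar> * norm x ^ n)" .
  qed
qed

lemma summable_alt_coeff:
  fixes x :: "'a::{real_normed_field, banach}"
  shows "summable (\<lambda>n. of_real (alt_coeff n) * x ^ n)"
  by (rule summable_norm_cancel) (use summable_norm_alt_coeff[of x] in \<open>simp add: norm_mult norm_power\<close>)

lemma summable_inv_coeff:
  fixes x :: "'a::{real_normed_field, banach}"
  assumes "norm x < 1"
  shows "summable (\<lambda>n. of_real (inv_coeff n) * x ^ n)"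
  by (rule summable_norm_cancel)
    (use summable_norm_inv_coeff[OF assms] inv_coeff_pos in \<open>simp add: norm_mult norm_power abs_of_pos\<close>)

lemma tendsto_at_q_powers:
  fixes f :: "'a::{real_normed_field, banach} \<Rightarrow> 'b::topological_space"
  assumes "isCont f 0"
  shows "(\<lambda>n. f (of_real q ^ n * x)) \<longlonglongrightarrow> f 0"
proof (rule isCont_tendsto_compose[OF assms])
  have "(\<lambda>n. (of_real (q ^ n) :: 'a)) \<longlonglongrightarrow> of_real 0"
    using tendsto_q_power by (rule tendsto_of_real)
  then show "(\<lambda>n. of_real q ^ n * x) \<longlonglongrightarrow> 0"
    using tendsto_mult_left_zero by force
qed

lemma powser_isCont_0:
  fixes c :: "nat \<Rightarrow> 'a::{real_normed_field, banach}"
  assumes "summable (\<lambda>n. c n * K ^ n)" "K \<noteq> 0"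
  shows "isCont (\<lambda>x. \<Sum>n. c n * x ^ n) 0"
  using assms by (intro isCont_powser[of c K]) auto

text \<open>The recursion of the coefficients says that the series \<open>E\<close> satisfies \<open>E(x) = (1 - x) E(q x)\<close>.
  Iteration gives \<open>E(x) = (x;q)\<^sub>n E(q\<^sup>n x)\<close>, and \<open>E\<close> is continuous at \<open>0\<close> with value \<open>1\<close>.\<close>

theorem euler_alt_series:
  fixes x :: "'a::{real_normed_field, banach}"
  shows "(\<Sum>n. of_real (alt_coeff n) * x ^ n) = qpoch_inf x (of_real q)"
proof -
  define E :: "'a \<Rightarrow> 'a" where "E x = (\<Sum>n. of_real (alt_coeff n) * x ^ n)" for x
  have step: "E x = (1 - x) * E (of_real q * x)" for x
  proof -
    note sm = summable_alt_coeff
    have "E x - E (of_real q * x) = (\<Sum>n. of_real (alt_coeff n * (1 - q ^ n)) * x ^ n)"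
      unfolding E_def by (subst suminf_diff[OF sm sm]) (simp add: algebra_simps power_mult_distrib)
    also have "\<dots> = (\<Sum>n. of_real (alt_coeff (Suc n) * (1 - q ^ Suc n)) * x ^ Suc n)"
    proof (subst suminf_split_head)
      show "summable (\<lambda>n. of_real (alt_coeff n * (1 - q ^ n)) * x ^ n)"
        using summable_diff[OF sm[of x] sm[of "of_real q * x"]]
        by (simp add: algebra_simps power_mult_distrib)
    qed simp
    also have "\<dots> = (\<Sum>n. - x * (of_real (alt_coeff n) * (of_real q * x) ^ n))"
      unfolding alt_coeff_Suc by (simp add: power_mult_distrib mult_ac)
    also have "\<dots> = - x * E (of_real q * x)"
      unfolding E_def by (rule suminf_mult[OF sm])
    finally show ?thesis by (simp add: algebra_simps)
  qed
  have iter: "E x = qpoch x (of_real q) n * E (of_real q ^ n * x)" for n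
  proof (induction n)
    case (Suc n)
    then show ?case
      using step[of "of_real q ^ n * x"] by (simp add: qpoch_def mult_ac)
  qed (simp add: qpoch_def)
  have "isCont E 0"
    unfolding E_def by (rule powser_isCont_0[of _ 1]) (use summable_alt_coeff[of 1] in auto)
  then have "(\<lambda>n. qpoch x (of_real q) n * E (of_real q ^ n * x)) \<longlonglongrightarrow> qpoch_inf x (of_real q) * E 0"
    by (intro tendsto_mult qpoch_LIMSEQ tendsto_at_q_powers)
  then have "(\<lambda>n. E x) \<longlonglongrightarrow> qpoch_inf x (of_real q) * E 0"
    by (simp flip: iter)
  then have "E x = qpoch_inf x (of_real q) * E 0"
    using LIMSEQ_unique[OF tendsto_const] by blast
  also have "E 0 = 1"
    unfolding E_def by (simp add: powser_zero)
  finally show ?thesis by (simp add: E_def)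
qed

text \<open>Here the recursion of the coefficients gives \<open>e(q x) = (1 - x) e(x)\<close>, and iteration leads to
  \<open>e(x) (x;q)\<^sub>n = e(q\<^sup>n x)\<close>. The identity is stated as a product because in this form it also proves
  that \<open>(x;q)\<^sub>\<infinity>\<close> has no zero in the unit disc.\<close>

theorem euler_inv_series:
  fixes x :: "'a::{real_normed_field, banach}"
  assumes "norm x < 1"
  shows "(\<Sum>n. of_real (inv_coeff n) * x ^ n) * qpoch_inf x (of_real q) = 1"
proof -
  define e :: "'a \<Rightarrow> 'a" where "e x = (\<Sum>n. of_real (inv_coeff n) * x ^ n)" for x
  have small: "norm (of_real q * x) < 1" if "norm x < 1" for x :: 'a
  proof -
    have "norm (of_real q * x) \<le> 1 * norm x"
      unfolding norm_mult using q_pos q_less_one by (intro mult_right_mono) auto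
    with that show ?thesis by simp
  qed
  have step: "e (of_real q * x) = (1 - x) * e x" if "norm x < 1" for x
  proof -
    note sm = summable_inv_coeff
    note s1 = sm[OF that] and s2 = sm[OF small[OF that]]
    have "e x - e (of_real q * x) = (\<Sum>n. of_real (inv_coeff n * (1 - q ^ n)) * x ^ n)"
      unfolding e_def by (subst suminf_diff[OF s1 s2]) (simp add: algebra_simps power_mult_distrib)
    also have "\<dots> = (\<Sum>n. of_real (inv_coeff (Suc n) * (1 - q ^ Suc n)) * x ^ Suc n)"
    proof (subst suminf_split_head)
      show "summable (\<lambda>n. of_real (inv_coeff n * (1 - q ^ n)) * x ^ n)"
        using summable_diff[OF s1 s2]
        by (simp add: algebra_simps power_mult_distrib)
    qed simp
    also have "\<dots> = (\<Sum>n. x * (of_real (inv_coeff n) * x ^ n))"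
      unfolding inv_coeff_Suc by (simp add: mult_ac)
    also have "\<dots> = x * e x"
      unfolding e_def by (rule suminf_mult[OF s1])
    finally show ?thesis by (simp add: algebra_simps)
  qed
  have iter: "norm (of_real q ^ n * x) < 1 \<and> e x * qpoch x (of_real q) n = e (of_real q ^ n * x)" for n
  proof (induction n)
    case (Suc n)
    then show ?case
      using step[of "of_real q ^ n * x"] small[of "of_real q ^ n * x"]
      by (auto simp add: qpoch_def mult_ac)
  qed (use assms in \<open>simp add: qpoch_def\<close>)
  have "isCont e 0"
    unfolding e_def by (rule powser_isCont_0[of _ "1/2"])
      (use summable_inv_coeff[of "1/2"] in \<open>auto simp: norm_divide\<close>)
  then have "(\<lambda>n. e (of_real q ^ n * x)) \<longlonglongrightarrow> e 0"
    by (rule tendsto_at_q_powers)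
  then have "(\<lambda>n. e x * qpoch x (of_real q) n) \<longlonglongrightarrow> e 0"
    using iter by simp
  moreover have "(\<lambda>n. e x * qpoch x (of_real q) n) \<longlonglongrightarrow> e x * qpoch_inf x (of_real q)"
    by (intro tendsto_intros qpoch_LIMSEQ)
  ultimately have "e x * qpoch_inf x (of_real q) = e 0"
    by (rule LIMSEQ_unique[rotated])
  also have "e 0 = 1"
    unfolding e_def by (simp add: powser_zero)
  finally show ?thesis by (simp add: e_def)
qed

lemma qpoch_inf_nonzero:
  fixes x :: "'a::{real_normed_field, banach}"
  assumes "norm x < 1"
  shows "qpoch_inf x (of_real q) \<noteq> 0"
  using euler_inv_series[OF assms] by auto

lemma qpoch_inf_pos:
  assumes "0 \<le> x" "x < 1"
  shows "0 < qpoch_inf x q"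
proof -
  have "qpoch x q n \<ge> 0" for n
    unfolding qpoch_def
  proof (intro prod_nonneg)
    fix j
    have "x * q ^ j \<le> 1 * 1"
      using assms q_pos q_less_one by (intro mult_mono power_le_one) auto
    then show "0 \<le> 1 - x * q ^ j" by simp
  qed
  then have "qpoch_inf x q \<ge> 0"
    using qpoch_LIMSEQ[of x] by (auto intro: LIMSEQ_le_const)
  moreover have "qpoch_inf x q \<noteq> 0"
    using qpoch_inf_nonzero[of x] assms by simp
  ultimately show ?thesis by simp
qed

lemma qpoch_inf_eq_0:
  fixes x :: "'a::{real_normed_field, banach}"
  assumes "x * of_real q ^ n = 1"
  shows "qpoch_inf x (of_real q) = 0"
proof -
  have "qpoch x (of_real q) m = 0" if "m > n" for m
    unfolding qpoch_def using assms that by (intro prod_zero) auto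
  then have "(\<lambda>m. qpoch x (of_real q) m) \<longlonglongrightarrow> 0"
    by (intro tendsto_eventually eventually_sequentiallyI[of "Suc n"]) auto
  then show ?thesis
    using LIMSEQ_unique[OF qpoch_LIMSEQ] by blast
qed

text \<open>Euler's series at the zeros \<open>1 / q\<^sup>j\<close> of \<open>(x;q)\<^sub>\<infinity>\<close>. These identities are the source of the
  flatness of the density at \<open>0\<close>.\<close>

lemma sum_alt_coeff_q_powers: "(\<Sum>n. alt_coeff n * (1 / q ^ j) ^ n) = 0"
  using euler_alt_series[of "1 / q ^ j"] qpoch_inf_eq_0[of "1 / q ^ j" j] q_pos by simp

lemma holomorphic_qpoch_inf: "(\<lambda>x. qpoch_inf x (of_real q)) holomorphic_on (UNIV :: complex set)"
proof -
  have "(\<lambda>n. of_real (alt_coeff n) * (x - 0) ^ n) sums qpoch_inf x (of_real q)" for x :: complex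
    using summable_alt_coeff[of x] euler_alt_series[of x] by (auto simp: sums_iff)
  then have "(\<lambda>x. qpoch_inf x (of_real q)) holomorphic_on ball (0::complex) r" for r
    by (intro power_series_holomorphic)
  then have "(\<lambda>x. qpoch_inf x (of_real q)) field_differentiable at x" for x :: complex
    by (metis dual_order.strict_trans2 gt_ex holomorphic_on_imp_differentiable_at mem_ball_0 open_ball order_refl)
  then show ?thesis
    by (simp add: holomorphic_on_def)
qed

end

section \<open>Positivity and flatness of the density\<close>

context q_base
begin

text \<open>Up to the factor \<open>1 / (q;q)\<^sub>\<infinity>\<close>, this is the density of \<open>\<Sum>k. q\<^sup>k e\<^sub>k\<close> with independent standard
  exponential variables \<open>e\<^sub>k\<close>, which is the exponential functional of \<open>P\<^sup>+\<close> alone.\<close>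

definition profile :: "real \<Rightarrow> real" where
  "profile y = (\<Sum>n. alt_coeff n * exp (- (y / q ^ n)))"

lemma summable_abs_alt_coeff: "summable (\<lambda>n. \<bar>alt_coeff n\<bar>)"
  using summable_norm_alt_coeff[of "1::real"] by simp

lemma summable_norm_profile:
  assumes "0 \<le> y"
  shows "summable (\<lambda>n. norm (alt_coeff n * exp (- (y / q ^ n))))"
proof (rule summable_comparison_test'[OF summable_abs_alt_coeff])
  fix n
  show "norm (norm (alt_coeff n * exp (- (y / q ^ n)))) \<le> \<bar>alt_coeff n\<bar>"
    using assms q_pos by (auto simp: abs_mult intro!: mult_left_le)
qed

lemma summable_profile:
  assumes "0 \<le> y"
  shows "summable (\<lambda>n. alt_coeff n * exp (- (y / q ^ n)))"
  using summable_norm_profile[OF assms] by (rule summable_norm_cancel)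

lemma alt_coeff_div_Suc: "alt_coeff (Suc n) / q ^ Suc n = alt_coeff (Suc n) - alt_coeff n / q"
  using alt_coeff_Suc[of n] q_pos by (simp add: field_simps)

text \<open>The density of \<open>\<Sum>k\<le>N. q\<^sup>k e\<^sub>k\<close>, from the partial fraction decomposition of its Laplace
  transform.\<close>

definition finite_profile :: "nat \<Rightarrow> real \<Rightarrow> real" where
  "finite_profile N y = (\<Sum>n\<le>N. alt_coeff n * inv_coeff (N - n) * exp (- (y / q ^ n)))"

text \<open>A case of the finite q-binomial theorem. In \<open>1 - q\<^sup>M = (1 - q\<^sup>n) + q\<^sup>n (1 - q\<^sup>M\<^sup>-\<^sup>n)\<close> the first
  summand lowers the index of one coefficient and the second that of the other, so that the sum
  telescopes.\<close>

lemma finite_profile_at_0: "finite_profile (Suc N) 0 = 0"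
proof -
  define M where "M = Suc N"
  define A where "A n = alt_coeff n * (1 - q ^ n) * inv_coeff (M - n)" for n
  define B where "B n = alt_coeff n * q ^ n * (inv_coeff (M - n) * (1 - q ^ (M - n)))" for n
  have "(1 - q ^ M) * finite_profile M 0 = (\<Sum>n\<le>M. A n + B n)"
    unfolding finite_profile_def sum_distrib_left
  proof (rule sum.cong)
    fix n assume "n \<in> {..M}"
    then have "q ^ M = q ^ n * q ^ (M - n)" by (simp flip: power_add)
    then show "(1 - q ^ M) * (alt_coeff n * inv_coeff (M - n) * exp (- (0 / q ^ n))) = A n + B n"
      by (simp add: A_def B_def algebra_simps)
  qed simp
  also have "\<dots> = (\<Sum>n\<le>M. A n) + (\<Sum>n\<le>M. B n)"
    by (rule sum.distrib)
  also have "(\<Sum>n\<le>M. A n) = (\<Sum>n\<le>N. A (Suc n))"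
    unfolding M_def sum.atMost_Suc_shift by (simp add: A_def)
  also have "(\<Sum>n\<le>M. B n) = (\<Sum>n\<le>N. B n)"
    unfolding M_def sum.atMost_Suc by (simp add: B_def M_def)
  also have "(\<Sum>n\<le>N. A (Suc n)) + (\<Sum>n\<le>N. B n) = (\<Sum>n\<le>N. A (Suc n) + B n)"
    by (rule sum.distrib[symmetric])
  also have "\<dots> = 0"
  proof (rule sum.neutral, intro ballI)
    fix n assume "n \<in> {..N}"
    then have "M - n = Suc (N - n)" "M - Suc n = N - n" by (auto simp: M_def)
    then have "B n = alt_coeff n * q ^ n * inv_coeff (N - n)"
      using inv_coeff_Suc[of "N - n"] by (simp add: B_def)
    moreover have "A (Suc n) = - (q ^ n) * alt_coeff n * inv_coeff (N - n)"
      using alt_coeff_Suc[of n] \<open>M - Suc n = N - n\<close> by (simp add: A_def)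
    ultimately show "A (Suc n) + B n = 0" by simp
  qed
  finally show ?thesis
    using q_power_less_one[of N] by (simp add: M_def)
qed

text \<open>This differential equation expresses \<open>\<Sum>k\<le>N+1. q\<^sup>k e\<^sub>k = e\<^sub>0 + q (\<Sum>k\<le>N. q\<^sup>k e\<^sub>k\<^sub>+\<^sub>1)\<close>.\<close>

lemma finite_profile_deriv:
  "(finite_profile (Suc N) has_real_derivative
      finite_profile N (y / q) / q - finite_profile (Suc N) y) (at y)"
proof -
  let ?M = "Suc N"
  have "(finite_profile ?M has_real_derivative
      (\<Sum>n\<le>?M. alt_coeff n * inv_coeff (?M - n) * (exp (- (y / q ^ n)) * (- (1 / q ^ n))))) (at y)"
    unfolding finite_profile_def[abs_def]
    by (intro DERIV_sum) (rule derivative_eq_intros refl | use q_pos in force)+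
  also have "(\<Sum>n\<le>?M. alt_coeff n * inv_coeff (?M - n) * (exp (- (y / q ^ n)) * (- (1 / q ^ n))))
      = - (\<Sum>n\<le>?M. (alt_coeff n / q ^ n) * (inv_coeff (?M - n) * exp (- (y / q ^ n))))"
    unfolding sum_negf[symmetric] by (intro sum.cong) auto
  also have "(\<Sum>n\<le>?M. (alt_coeff n / q ^ n) * (inv_coeff (?M - n) * exp (- (y / q ^ n))))
     = inv_coeff ?M * exp (- y) +
       (\<Sum>n\<le>N. (alt_coeff (Suc n) - alt_coeff n / q) * (inv_coeff (N - n) * exp (- (y / q ^ Suc n))))"
    by (subst sum.atMost_Suc_shift) (simp only: alt_coeff_div_Suc diff_Suc_Suc, simp)
  also have "\<dots> = (inv_coeff ?M * exp (- y) +
       (\<Sum>n\<le>N. alt_coeff (Suc n) * inv_coeff (?M - Suc n) * exp (- (y / q ^ Suc n))))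
      - (\<Sum>n\<le>N. alt_coeff n * inv_coeff (N - n) * exp (- ((y / q) / q ^ n))) / q"
    by (simp add: algebra_simps sum_subtractf sum_divide_distrib)
  also have "inv_coeff ?M * exp (- y) +
       (\<Sum>n\<le>N. alt_coeff (Suc n) * inv_coeff (?M - Suc n) * exp (- (y / q ^ Suc n)))
      = finite_profile ?M y"
    unfolding finite_profile_def by (subst sum.atMost_Suc_shift) simp
  also have "(\<Sum>n\<le>N. alt_coeff n * inv_coeff (N - n) * exp (- ((y / q) / q ^ n)))
      = finite_profile N (y / q)"
    by (simp add: finite_profile_def)
  finally show ?thesis by (simp add: field_simps)
qed

text \<open>With the integrating factor \<open>exp y\<close> the differential equation shows that
  \<open>exp y * finite_profile (Suc N) y\<close> increases from its value \<open>0\<close> at \<open>y = 0\<close>.\<close>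

lemma finite_profile_nonneg: "0 \<le> y \<Longrightarrow> 0 \<le> finite_profile N y"
proof (induction N arbitrary: y)
  case 0
  show ?case by (simp add: finite_profile_def)
next
  case (Suc N)
  have "exp 0 * finite_profile (Suc N) 0 \<le> exp y * finite_profile (Suc N) y"
  proof (rule DERIV_nonneg_imp_nondecreasing[OF Suc.prems])
    fix x :: real assume "0 \<le> x"
    have "((\<lambda>x. exp x * finite_profile (Suc N) x) has_real_derivative
        exp x * (finite_profile N (x / q) / q)) (at x)"
      by (rule derivative_eq_intros finite_profile_deriv refl)+ (simp add: algebra_simps)
    moreover have "0 \<le> exp x * (finite_profile N (x / q) / q)"
      using Suc.IH[of "x / q"] \<open>0 \<le> x\<close> q_pos by simp
    ultimately show "\<exists>d. ((\<lambda>x. exp x * finite_profile (Suc N) x) has_real_derivative d) (at x) \<and> 0 \<le> d"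
      by blast
  qed
  then show ?case
    using finite_profile_at_0[of N] by (simp add: zero_le_mult_iff)
qed

lemma inv_coeff_LIMSEQ: "inv_coeff \<longlonglongrightarrow> 1 / qpoch_inf q q"
  unfolding inv_coeff_def[abs_def]
  using qpoch_LIMSEQ[of q] qpoch_inf_pos[of q] q_pos q_less_one by (intro tendsto_intros) auto

lemma inv_coeff_le: "inv_coeff n \<le> 1 / qpoch_inf q q"
  unfolding inv_coeff_def
  using qpoch_ge_qpoch_inf[of n] qpoch_inf_pos[of q] q_pos q_less_one by (intro divide_left_mono mult_pos_pos qpoch_pos) auto

lemma finite_profile_LIMSEQ:
  assumes "0 \<le> y"
  shows "(\<lambda>N. finite_profile N y) \<longlonglongrightarrow> profile y / qpoch_inf q q"
proof -
  define a where "a n N = (if n \<le> N then alt_coeff n * inv_coeff (N - n) * exp (- (y / q ^ n)) else 0)" for n N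
  have "(\<lambda>N. \<Sum>n. a n N) \<longlonglongrightarrow> (\<Sum>n. alt_coeff n * exp (- (y / q ^ n)) * (1 / qpoch_inf q q))"
  proof (rule tannerys_theorem[THEN conjunct2, THEN conjunct2])
    fix n
    have "(\<lambda>N. alt_coeff n * inv_coeff (N - n) * exp (- (y / q ^ n)))
        \<longlonglongrightarrow> alt_coeff n * (1 / qpoch_inf q q) * exp (- (y / q ^ n))"
      by (intro tendsto_intros filterlim_compose[OF inv_coeff_LIMSEQ] filterlim_minus_const_nat_at_top)
    moreover have "eventually (\<lambda>N. alt_coeff n * inv_coeff (N - n) * exp (- (y / q ^ n)) = a n N) sequentially"
      by (intro eventually_sequentiallyI[of n]) (simp add: a_def)
    ultimately show "a n \<longlonglongrightarrow> alt_coeff n * exp (- (y / q ^ n)) * (1 / qpoch_inf q q)"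
      by (auto simp: mult_ac elim: Lim_transform_eventually)
  next
    show "summable (\<lambda>n. norm (alt_coeff n * exp (- (y / q ^ n))) * (1 / qpoch_inf q q))"
      by (intro summable_mult2 summable_norm_profile assms)
    show "\<forall>\<^sub>F (n, N) in sequentially \<times>\<^sub>F sequentially.
            norm (a n N) \<le> norm (alt_coeff n * exp (- (y / q ^ n))) * (1 / qpoch_inf q q)"
    proof (intro always_eventually allI, clarify)
      fix n N
      have "norm (alt_coeff n * exp (- (y / q ^ n))) * inv_coeff (N - n)
          \<le> norm (alt_coeff n * exp (- (y / q ^ n))) * (1 / qpoch_inf q q)"
        by (intro mult_left_mono inv_coeff_le) auto
      moreover have "0 \<le> 1 / qpoch_inf q q"
        using inv_coeff_le[of 0] inv_coeff_pos[of 0] by linarith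
      ultimately show "norm (a n N) \<le> norm (alt_coeff n * exp (- (y / q ^ n))) * (1 / qpoch_inf q q)"
        using inv_coeff_pos[of "N - n"] by (auto simp: a_def abs_mult mult_ac)
    qed
  qed simp
  also have "(\<Sum>n. alt_coeff n * exp (- (y / q ^ n)) * (1 / qpoch_inf q q)) = profile y / qpoch_inf q q"
    using suminf_mult2[OF summable_profile[OF assms], of "1 / qpoch_inf q q"] by (simp add: profile_def)
  also have "(\<lambda>N. \<Sum>n. a n N) = (\<lambda>N. finite_profile N y)"
  proof
    fix N
    have "(\<Sum>n. a n N) = (\<Sum>n\<le>N. a n N)"
      by (intro suminf_finite) (auto simp: a_def)
    also have "\<dots> = finite_profile N y"
      unfolding finite_profile_def by (intro sum.cong) (auto simp: a_def)
    finally show "(\<Sum>n. a n N) = finite_profile N y" .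
  qed
  finally show ?thesis .
qed

lemma profile_nonneg:
  assumes "0 \<le> y"
  shows "0 \<le> profile y"
proof -
  have "0 \<le> profile y / qpoch_inf q q"
    using finite_profile_LIMSEQ[OF assms] finite_profile_nonneg[OF assms]
    by (intro LIMSEQ_le_const) auto
  then show ?thesis
    using qpoch_inf_pos[of q] q_pos q_less_one by (simp add: zero_le_divide_iff)
qed

lemma exp_minus_taylor_bound:
  fixes t :: real
  assumes "0 \<le> t"
  shows "\<bar>exp (- t) - (\<Sum>j<k. (- t) ^ j / fact j)\<bar> \<le> t ^ k / fact k"
proof (cases "k = 0 \<or> t = 0")
  case True
  then show ?thesis
    using assms by (cases k) (auto simp: power_0_left sum.lessThan_Suc_shift simp del: sum.lessThan_Suc)
next
  case False
  then have "\<exists>u. - t < u \<and> u < 0 \<and> exp (- t) = (\<Sum>m<k. exp 0 / fact m * (- t) ^ m) + exp u / fact k * (- t) ^ k"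
    using assms by (intro Maclaurin_minus[where diff = "\<lambda>_. exp"]) auto
  then obtain u where u: "u < 0" "exp (- t) = (\<Sum>m<k. exp 0 / fact m * (- t) ^ m) + exp u / fact k * (- t) ^ k"
    by blast
  then have "\<bar>exp (- t) - (\<Sum>j<k. (- t) ^ j / fact j)\<bar> = exp u * (t ^ k / fact k)"
    using assms by (simp add: abs_mult power_abs)
  also have "\<dots> \<le> 1 * (t ^ k / fact k)"
    using u assms by (intro mult_right_mono) auto
  finally show ?thesis by simp
qed

text \<open>Since \<open>\<Sum>n. alt_coeff n / q\<^sup>n\<^sup>j = 0\<close>, the Taylor polynomial of degree \<open>k - 1\<close> may be subtracted
  from every exponential without changing the sum; what is left is of order \<open>y\<^sup>k\<close>.\<close>

lemma profile_le_power: "\<exists>c\<ge>0. \<forall>y\<ge>0. profile y \<le> c * y ^ k"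
proof -
  define c where "c = (\<Sum>n. \<bar>alt_coeff n\<bar> * (1 / q ^ k) ^ n / fact k)"
  have smc: "summable (\<lambda>n. \<bar>alt_coeff n\<bar> * (1 / q ^ k) ^ n / fact k)"
    using summable_norm_alt_coeff[of "1 / q ^ k"] q_pos by (intro summable_divide) simp
  have "profile y \<le> c * y ^ k" if "0 \<le> y" for y
  proof -
    have sm: "summable (\<lambda>n. alt_coeff n * ((- (y / q ^ n)) ^ j / fact j))" for j
      using summable_mult[OF summable_alt_coeff[of "1 / q ^ j"], of "(- y) ^ j / fact j"]
      by (simp add: field_simps power_minus' flip: power_mult)
    have zero: "(\<Sum>n. alt_coeff n * ((- (y / q ^ n)) ^ j / fact j)) = 0" for j
    proof -
      have "(\<Sum>n. alt_coeff n * ((- (y / q ^ n)) ^ j / fact j))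
          = (\<Sum>n. (- y) ^ j / fact j * (of_real (alt_coeff n) * (1 / q ^ j) ^ n))"
      proof (rule suminf_cong)
        fix n
        have "(- (y / q ^ n)) ^ j = (- y) ^ j * (1 / q ^ j) ^ n"
          unfolding power_minus[of "y / q ^ n"] power_minus[of y]
          by (simp add: power_divide mult.commute flip: power_mult)
        then show "alt_coeff n * ((- (y / q ^ n)) ^ j / fact j)
            = (- y) ^ j / fact j * (of_real (alt_coeff n) * (1 / q ^ j) ^ n)"
          by simp
      qed
      also have "\<dots> = 0"
        by (subst suminf_mult[OF summable_alt_coeff]) (simp add: sum_alt_coeff_q_powers)
      finally show ?thesis .
    qed
    have sm2: "summable (\<lambda>n. \<Sum>j<k. alt_coeff n * ((- (y / q ^ n)) ^ j / fact j))"
      by (intro summable_sum sm)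
    have "(\<Sum>n. \<Sum>j<k. alt_coeff n * ((- (y / q ^ n)) ^ j / fact j)) = 0"
      by (subst suminf_sum[OF sm]) (simp only: zero sum.neutral_const)
    then have "profile y = (\<Sum>n. alt_coeff n * exp (- (y / q ^ n))
          - (\<Sum>j<k. alt_coeff n * ((- (y / q ^ n)) ^ j / fact j)))"
      unfolding profile_def by (subst suminf_diff[symmetric, OF summable_profile[OF that] sm2]) simp
    also have "\<dots> \<le> (\<Sum>n. y ^ k * (\<bar>alt_coeff n\<bar> * (1 / q ^ k) ^ n / fact k))"
    proof (rule suminf_le)
      fix n
      have "alt_coeff n * exp (- (y / q ^ n)) - (\<Sum>j<k. alt_coeff n * ((- (y / q ^ n)) ^ j / fact j))
          = alt_coeff n * (exp (- (y / q ^ n)) - (\<Sum>j<k. (- (y / q ^ n)) ^ j / fact j))"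
        by (simp add: sum_distrib_left right_diff_distrib)
      also have "\<dots> \<le> \<bar>alt_coeff n\<bar> * \<bar>exp (- (y / q ^ n)) - (\<Sum>j<k. (- (y / q ^ n)) ^ j / fact j)\<bar>"
        unfolding abs_mult[symmetric] by (rule abs_ge_self)
      also have "\<dots> \<le> \<bar>alt_coeff n\<bar> * ((y / q ^ n) ^ k / fact k)"
        using that q_pos by (intro mult_left_mono exp_minus_taylor_bound) auto
      also have "(y / q ^ n) ^ k = y ^ k * (1 / q ^ k) ^ n"
        by (simp add: power_divide mult.commute flip: power_mult)
      finally show "alt_coeff n * exp (- (y / q ^ n)) - (\<Sum>j<k. alt_coeff n * ((- (y / q ^ n)) ^ j / fact j))
          \<le> y ^ k * (\<bar>alt_coeff n\<bar> * (1 / q ^ k) ^ n / fact k)"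
        by (simp add: mult_ac)
    qed (intro summable_diff summable_profile sm2 that summable_mult smc)+
    also have "\<dots> = c * y ^ k"
      unfolding c_def by (subst suminf_mult[OF smc]) simp
    finally show ?thesis .
  qed
  moreover have "c \<ge> 0"
    unfolding c_def using q_pos by (intro suminf_nonneg smc) auto
  ultimately show ?thesis by blast
qed

lemma density_term_eq:
  "density_term q z x m n = ((q * z) ^ m * inv_coeff m) * (alt_coeff n * exp (- (q ^ m * x / q ^ n)))"
proof -
  have "q powi (int m - int n) = q ^ m / q ^ n"
    using q_pos by (simp add: power_int_diff)
  then show ?thesis
    by (simp add: density_term_def inv_coeff_def alt_coeff_def mult_ac)
qed

lemma
  assumes "0 \<le> x"
  shows summable_density_term: "summable (\<lambda>n. density_term q z x m n)"
    and suminf_density_term: "(\<Sum>n. density_term q z x m n) = (q * z) ^ m * inv_coeff m * profile (q ^ m * x)"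
proof -
  have sm: "summable (\<lambda>n. alt_coeff n * exp (- (q ^ m * x / q ^ n)))"
    using assms q_pos by (intro summable_profile) auto
  show "summable (\<lambda>n. density_term q z x m n)"
    unfolding density_term_eq by (intro summable_mult sm)
  show "(\<Sum>n. density_term q z x m n) = (q * z) ^ m * inv_coeff m * profile (q ^ m * x)"
    unfolding density_term_eq profile_def by (rule suminf_mult[OF sm])
qed

lemma density_fun_eq:
  assumes "0 \<le> x"
  shows "density_fun q z x = qpoch_inf z q / qpoch_inf q q *
           (\<Sum>m. (q * z) ^ m * inv_coeff m * profile (q ^ m * x))"
  unfolding density_fun_def suminf_density_term[OF assms] ..

end

locale q_density = q_base +
  fixes z :: real
  assumes z_pos: "0 < z" and z_less_one: "z < 1"
begin

text \<open>The function \<open>profile (q\<^sup>m x)\<close> has an integral proportional to \<open>q\<^sup>-\<^sup>m\<close>, so the density is the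
  mixture that gives the dilation of \<open>profile\<close> by \<open>q\<^sup>-\<^sup>m\<close> a probability proportional to
  \<open>z\<^sup>m / (q;q)\<^sub>m\<close>.\<close>

definition weight :: "nat \<Rightarrow> real" where
  "weight m = (q * z) ^ m * inv_coeff m"

lemma weight_pos: "0 < weight m"
  using q_pos z_pos inv_coeff_pos by (simp add: weight_def)

lemma weight_Suc: "weight (Suc m) * (1 - q ^ Suc m) = q * z * weight m"
  using inv_coeff_Suc[of m] by (simp add: weight_def mult_ac)

lemma summable_weight_powr:
  assumes "z < q powr \<sigma>"
  shows "summable (\<lambda>m. weight m * (q ^ m) powr (- (1 + \<sigma>)))"
proof -
  have "norm (z / q powr \<sigma>) < 1"
    using assms z_pos q_pos by simp
  then have "summable (\<lambda>m. inv_coeff m * norm (z / q powr \<sigma>) ^ m)"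
    by (rule summable_norm_inv_coeff)
  moreover have "weight m * (q ^ m) powr (- (1 + \<sigma>)) = inv_coeff m * norm (z / q powr \<sigma>) ^ m" for m
  proof -
    have "(q ^ m) powr (- (1 + \<sigma>)) = (q powr (- (1 + \<sigma>))) ^ m"
      using q_pos by (simp add: powr_powr mult.commute flip: powr_realpow)
    also have "q powr (- (1 + \<sigma>)) = 1 / (q * q powr \<sigma>)"
      using q_pos unfolding powr_minus by (simp add: powr_add divide_inverse)
    finally show ?thesis
      using q_pos z_pos by (simp add: weight_def power_divide power_mult_distrib)
  qed
  ultimately show ?thesis by simp
qed

lemma summable_weight: "summable weight"
proof -
  have "norm (q * z) < 1"
    using q_pos z_pos q_less_one z_less_one mult_strict_mono[of q 1 z 1] by simp
  from summable_norm_inv_coeff[OF this] show ?thesis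
    using q_pos z_pos by (simp add: weight_def[abs_def] mult_ac)
qed

lemma density_fun_weight:
  assumes "0 \<le> x"
  shows "density_fun q z x = qpoch_inf z q / qpoch_inf q q * (\<Sum>m. weight m * profile (q ^ m * x))"
  unfolding density_fun_eq[OF assms] weight_def ..

lemma profile_bounded: "\<exists>c. \<forall>y\<ge>0. profile y \<le> c"
  using profile_le_power[of 0] by auto

lemma summable_weight_profile:
  assumes "0 \<le> x"
  shows "summable (\<lambda>m. weight m * profile (q ^ m * x))"
proof -
  obtain c where c: "profile y \<le> c" if "0 \<le> y" for y
    using profile_bounded by blast
  show ?thesis
  proof (rule summable_comparison_test'[OF summable_mult2[OF summable_weight, of c]])
    fix m
    have "0 \<le> q ^ m * x" using assms q_pos by simp
    then show "norm (weight m * profile (q ^ m * x)) \<le> weight m * c"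
      using c[of "q ^ m * x"] profile_nonneg[of "q ^ m * x"] weight_pos[of m]
      by (auto simp: abs_mult)
  qed
qed

lemma normalisation_pos: "0 < qpoch_inf z q / qpoch_inf q q"
  using qpoch_inf_pos q_pos z_pos q_less_one z_less_one by simp

lemma density_fun_nonneg:
  assumes "0 \<le> x"
  shows "0 \<le> density_fun q z x"
proof -
  have "0 \<le> weight m * profile (q ^ m * x)" for m
    using assms q_pos weight_pos[of m] by (intro mult_nonneg_nonneg profile_nonneg) auto
  then have "0 \<le> (\<Sum>m. weight m * profile (q ^ m * x))"
    by (intro suminf_nonneg summable_weight_profile assms) 
  then show ?thesis
    unfolding density_fun_weight[OF assms] using normalisation_pos by (intro mult_nonneg_nonneg) auto
qed

text \<open>The dilations \<open>profile (q\<^sup>m x)\<close> only improve the bound, and the weights are summable.\<close>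

lemma density_fun_le_power: "\<exists>c\<ge>0. \<forall>x\<ge>0. density_fun q z x \<le> c * x ^ k"
proof -
  obtain c where c0: "c \<ge> 0" and c: "\<And>y. 0 \<le> y \<Longrightarrow> profile y \<le> c * y ^ k"
    using profile_le_power[of k] by blast
  define C where "C = qpoch_inf z q / qpoch_inf q q"
  have "density_fun q z x \<le> (C * (\<Sum>m. weight m) * c) * x ^ k" if "0 \<le> x" for x
  proof -
    have "(\<Sum>m. weight m * profile (q ^ m * x)) \<le> (\<Sum>m. weight m * (c * x ^ k))"
    proof (rule suminf_le)
      fix m
      have "profile (q ^ m * x) \<le> c * (q ^ m * x) ^ k"
        using that q_pos by (intro c) auto
      also have "\<dots> \<le> c * (1 * x) ^ k"
        using that q_pos q_less_one c0 by (intro mult_left_mono power_mono mult_right_mono power_le_one) auto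
      finally show "weight m * profile (q ^ m * x) \<le> weight m * (c * x ^ k)"
        using weight_pos[of m] by simp
    qed (intro summable_weight_profile summable_mult2 summable_weight that)+
    also have "\<dots> = (\<Sum>m. weight m) * (c * x ^ k)"
      by (rule suminf_mult2[OF summable_weight, symmetric])
    finally show ?thesis
      using normalisation_pos unfolding density_fun_weight[OF that] C_def[symmetric]
      by (simp add: mult.assoc)
  qed
  moreover have "0 \<le> C * (\<Sum>m. weight m) * c"
    using normalisation_pos c0 weight_pos[THEN less_imp_le]
    by (intro mult_nonneg_nonneg suminf_nonneg summable_weight) (auto simp: C_def)
  ultimately show ?thesis by blast
qed

end

section \<open>Integral transforms of the density\<close>

definition laplace_kernel :: "(real \<Rightarrow> 'b::real_vector) \<Rightarrow> real \<Rightarrow> real \<Rightarrow> 'b" where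
  "laplace_kernel w l x = (indicator {0..} x * exp (- (l * x))) *\<^sub>R w x"

text \<open>The hypothesis under which a weight \<open>w\<close> can be integrated against the density term by term. The
  rate is that of \<open>w x = x\<^sup>\<sigma>\<close>, whose transform is \<open>\<Gamma>(1 + \<sigma>) l\<^sup>-\<^sup>1\<^sup>-\<^sup>\<sigma>\<close>.\<close>

definition laplace_growth :: "real \<Rightarrow> real \<Rightarrow> (real \<Rightarrow> 'b::{banach, second_countable_topology}) \<Rightarrow> bool" where
  "laplace_growth c \<sigma> w \<longleftrightarrow>
     (\<forall>l>0. integrable lborel (laplace_kernel w l) \<and>
       (\<integral>x. norm (laplace_kernel w l x) \<partial>lborel) \<le> c * l powr (- (1 + \<sigma>)))"

lemma laplace_growth_norm:
  assumes "laplace_growth c \<sigma> w"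
  shows "laplace_growth c \<sigma> (\<lambda>x. norm (w x))"
proof -
  have "laplace_kernel (\<lambda>x. norm (w x)) l = (\<lambda>x. norm (laplace_kernel w l x))" for l
    by (auto simp: laplace_kernel_def fun_eq_iff)
  then show ?thesis
    using assms by (simp add: laplace_growth_def)
qed

context q_density
begin

text \<open>Fubini for the sum over \<open>n\<close>: the majorant is \<open>\<bar>alt_coeff n\<bar> (q\<^sup>1\<^sup>+\<^sup>\<sigma>)\<^sup>n\<close>, which is always
  summable. The norm bound keeps the rate in \<open>l\<close>, as needed for the sum over \<open>m\<close>.\<close>

lemma
  fixes w :: "real \<Rightarrow> 'b::{banach, second_countable_topology}"
  assumes growth: "laplace_growth c \<sigma> w" and l: "0 < l"
  shows profile_transform_integrable:
      "integrable lborel (\<lambda>x. (indicator {0..} x * profile (l * x)) *\<^sub>R w x)" (is ?A)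
    and profile_transform:
      "(\<integral>x. (indicator {0..} x * profile (l * x)) *\<^sub>R w x \<partial>lborel)
         = (\<Sum>n. alt_coeff n *\<^sub>R integral\<^sup>L lborel (laplace_kernel w (l / q ^ n)))" (is ?B)
    and profile_transform_norm:
      "(\<integral>x. norm ((indicator {0..} x * profile (l * x)) *\<^sub>R w x) \<partial>lborel)
         \<le> c * (\<Sum>n. \<bar>alt_coeff n\<bar> * (q powr (1 + \<sigma>)) ^ n) * l powr (- (1 + \<sigma>))" (is ?C)
proof -
  have pos: "0 < l / q ^ n" for n using l q_pos by simp
  have rate: "(l / q ^ n) powr (- (1 + \<sigma>)) = l powr (- (1 + \<sigma>)) * (q powr (1 + \<sigma>)) ^ n" for n
  proof -
    have "(l / q ^ n) powr (- (1 + \<sigma>)) = l powr (- (1 + \<sigma>)) / (q ^ n) powr (- (1 + \<sigma>))"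
      using l q_pos by (simp add: powr_divide)
    also have "(q ^ n) powr (- (1 + \<sigma>)) = 1 / (q powr (1 + \<sigma>)) ^ n"
      using q_pos unfolding powr_minus by (simp add: powr_powr mult.commute divide_inverse flip: powr_realpow)
    finally show ?thesis by simp
  qed
  have smA: "summable (\<lambda>n. \<bar>alt_coeff n\<bar> * (q powr (1 + \<sigma>)) ^ n)"
    using summable_norm_alt_coeff[of "q powr (1 + \<sigma>)"] by simp
  have main: "integrable lborel (\<lambda>x. (indicator {0..} x * profile (l * x)) *\<^sub>R v x) \<and>
    (\<lambda>n. alt_coeff n *\<^sub>R integral\<^sup>L lborel (laplace_kernel v (l / q ^ n)))
      sums (\<integral>x. (indicator {0..} x * profile (l * x)) *\<^sub>R v x \<partial>lborel)"
    if v: "laplace_growth c \<sigma> v" for v :: "real \<Rightarrow> 'c::{banach, second_countable_topology}"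
  proof -
    define f where "f n x = alt_coeff n *\<^sub>R laplace_kernel v (l / q ^ n) x" for n x
    have int: "integrable lborel (f n)" for n
      using v pos[of n] by (auto simp: f_def[abs_def] laplace_growth_def)
    have f_eq: "f n x = (alt_coeff n * exp (- (l * x / q ^ n))) *\<^sub>R (indicator {0..} x *\<^sub>R v x)" for n x
      by (simp add: f_def laplace_kernel_def mult_ac)
    have sm_x: "summable (\<lambda>n. norm (f n x))" for x
    proof (cases "0 \<le> x")
      case True
      have "summable (\<lambda>n. norm (alt_coeff n * exp (- (l * x / q ^ n))) * norm (indicator {0..} x *\<^sub>R v x))"
        using True l by (intro summable_mult2 summable_norm_profile) auto
      then show ?thesis by (simp add: f_eq abs_mult mult_ac)
    qed (simp add: f_eq)
    have sum_x: "(\<Sum>n. f n x) = (indicator {0..} x * profile (l * x)) *\<^sub>R v x" for x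
    proof (cases "0 \<le> x")
      case True
      have "(\<Sum>n. f n x) = profile (l * x) *\<^sub>R (indicator {0..} x *\<^sub>R v x)"
        unfolding f_eq profile_def using True l
        by (intro suminf_scaleR_left[symmetric] summable_profile) auto
      then show ?thesis by (simp add: mult_ac)
    qed (simp add: f_eq)
    have sm_int: "summable (\<lambda>n. \<integral>x. norm (f n x) \<partial>lborel)"
    proof (rule summable_comparison_test'[OF summable_mult[OF smA, of "c * l powr (- (1 + \<sigma>))"]])
      fix n
      have "(\<integral>x. norm (f n x) \<partial>lborel) = \<bar>alt_coeff n\<bar> * (\<integral>x. norm (laplace_kernel v (l / q ^ n) x) \<partial>lborel)"
        by (simp add: f_def)
      also have "\<dots> \<le> \<bar>alt_coeff n\<bar> * (c * (l / q ^ n) powr (- (1 + \<sigma>)))"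
        using v pos[of n] by (intro mult_left_mono) (auto simp: laplace_growth_def)
      finally show "norm (\<integral>x. norm (f n x) \<partial>lborel)
          \<le> c * l powr (- (1 + \<sigma>)) * (\<bar>alt_coeff n\<bar> * (q powr (1 + \<sigma>)) ^ n)"
        unfolding rate by (simp add: mult_ac)
    qed
    note fubini = integrable_suminf[OF int AE_I2[OF sm_x] sm_int] sums_integral[OF int AE_I2[OF sm_x] sm_int]
    have "integral\<^sup>L lborel (f n) = alt_coeff n *\<^sub>R integral\<^sup>L lborel (laplace_kernel v (l / q ^ n))" for n
      by (simp add: f_def[abs_def])
    then show ?thesis
      using fubini by (simp add: sum_x)
  qed
  show ?A ?B
    using main[OF growth] by (auto simp: sums_iff)
  have "(\<integral>x. norm ((indicator {0..} x * profile (l * x)) *\<^sub>R w x) \<partial>lborel)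
      = (\<integral>x. (indicator {0..} x * profile (l * x)) *\<^sub>R norm (w x) \<partial>lborel)"
    using l by (intro Bochner_Integration.integral_cong) (auto simp: profile_nonneg indicator_def)
  also have "\<dots> = (\<Sum>n. alt_coeff n *\<^sub>R integral\<^sup>L lborel (laplace_kernel (\<lambda>x. norm (w x)) (l / q ^ n)))"
    using main[OF laplace_growth_norm[OF growth]] by (simp add: sums_iff)
  also have "\<dots> \<le> (\<Sum>n. c * l powr (- (1 + \<sigma>)) * (\<bar>alt_coeff n\<bar> * (q powr (1 + \<sigma>)) ^ n))"
  proof (rule suminf_le)
    fix n
    have nn: "0 \<le> integral\<^sup>L lborel (laplace_kernel (\<lambda>x. norm (w x)) (l / q ^ n))"
      by (intro Bochner_Integration.integral_nonneg) (auto simp: laplace_kernel_def)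
    have "integral\<^sup>L lborel (laplace_kernel (\<lambda>x. norm (w x)) (l / q ^ n))
        = (\<integral>x. norm (laplace_kernel w (l / q ^ n) x) \<partial>lborel)"
      by (intro Bochner_Integration.integral_cong) (auto simp: laplace_kernel_def)
    also have "\<dots> \<le> c * (l / q ^ n) powr (- (1 + \<sigma>))"
      using growth pos[of n] by (auto simp: laplace_growth_def)
    finally have "alt_coeff n *\<^sub>R integral\<^sup>L lborel (laplace_kernel (\<lambda>x. norm (w x)) (l / q ^ n))
        \<le> \<bar>alt_coeff n\<bar> * (c * (l / q ^ n) powr (- (1 + \<sigma>)))"
      using nn by (auto intro!: mult_mono)
    then show "alt_coeff n *\<^sub>R integral\<^sup>L lborel (laplace_kernel (\<lambda>x. norm (w x)) (l / q ^ n))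
        \<le> c * l powr (- (1 + \<sigma>)) * (\<bar>alt_coeff n\<bar> * (q powr (1 + \<sigma>)) ^ n)"
      unfolding rate by (simp add: mult_ac)
  next
    show "summable (\<lambda>n. alt_coeff n *\<^sub>R integral\<^sup>L lborel (laplace_kernel (\<lambda>x. norm (w x)) (l / q ^ n)))"
      using main[OF laplace_growth_norm[OF growth]] by (simp add: sums_iff)
  qed (intro summable_mult smA)
  also have "\<dots> = c * l powr (- (1 + \<sigma>)) * (\<Sum>n. \<bar>alt_coeff n\<bar> * (q powr (1 + \<sigma>)) ^ n)"
    by (rule suminf_mult[OF smA])
  finally show ?C by (simp add: mult_ac)
qed

text \<open>Fubini for the sum over \<open>m\<close>: the majorant is \<open>(z q\<^sup>-\<^sup>\<sigma>)\<^sup>m / (q;q)\<^sub>m\<close>, which is where the condition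
  \<open>z < q\<^sup>\<sigma>\<close> comes from.\<close>

lemma
  fixes w :: "real \<Rightarrow> 'b::{banach, second_countable_topology}"
  assumes growth: "laplace_growth c \<sigma> w" and \<sigma>: "z < q powr \<sigma>"
  shows density_transform_integrable:
      "integrable lborel (\<lambda>x. (indicator {0..} x * density_fun q z x) *\<^sub>R w x)" (is ?A)
    and density_transform_sums:
      "(\<lambda>m. weight m *\<^sub>R (\<Sum>n. alt_coeff n *\<^sub>R integral\<^sup>L lborel (laplace_kernel w (q ^ m / q ^ n))))
         sums ((qpoch_inf q q / qpoch_inf z q) *\<^sub>R
           (\<integral>x. (indicator {0..} x * density_fun q z x) *\<^sub>R w x \<partial>lborel))" (is ?B)
proof -
  define C where "C = qpoch_inf z q / qpoch_inf q q"
  have C: "C > 0" using normalisation_pos by (simp add: C_def)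
  define A where "A = (\<Sum>n. \<bar>alt_coeff n\<bar> * (q powr (1 + \<sigma>)) ^ n)"
  have qm: "0 < q ^ m" for m using q_pos by simp
  define f where "f m x = weight m *\<^sub>R ((indicator {0..} x * profile (q ^ m * x)) *\<^sub>R w x)" for m x
  have int: "integrable lborel (f m)" for m
    unfolding f_def by (intro integrable_scaleR_right profile_transform_integrable[OF growth qm])
  have f_eq: "f m x = (weight m * profile (q ^ m * x)) *\<^sub>R (indicator {0..} x *\<^sub>R w x)" for m x
    by (simp add: f_def mult_ac)
  have sm_x: "summable (\<lambda>m. norm (f m x))" for x
  proof (cases "0 \<le> x")
    case True
    have "summable (\<lambda>m. (weight m * profile (q ^ m * x)) * norm (indicator {0..} x *\<^sub>R w x))"
      using True by (intro summable_mult2 summable_weight_profile)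
    moreover have "norm (f m x) = (weight m * profile (q ^ m * x)) * norm (indicator {0..} x *\<^sub>R w x)" for m
      using weight_pos[of m] profile_nonneg[of "q ^ m * x"] qm[of m] True
      by (simp add: f_eq abs_mult)
    ultimately show ?thesis by simp
  qed (simp add: f_eq)
  have sum_x: "(\<Sum>m. f m x) = (1 / C) *\<^sub>R ((indicator {0..} x * density_fun q z x) *\<^sub>R w x)" for x
  proof (cases "0 \<le> x")
    case True
    have "(\<Sum>m. f m x) = (\<Sum>m. weight m * profile (q ^ m * x)) *\<^sub>R (indicator {0..} x *\<^sub>R w x)"
      unfolding f_eq by (intro suminf_scaleR_left[symmetric] summable_weight_profile True)
    also have "(\<Sum>m. weight m * profile (q ^ m * x)) = density_fun q z x / C"
      using C unfolding density_fun_weight[OF True] C_def[symmetric] by simp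
    finally show ?thesis by (simp add: mult_ac)
  qed (simp add: f_eq)
  have sm_int: "summable (\<lambda>m. \<integral>x. norm (f m x) \<partial>lborel)"
  proof (rule summable_comparison_test'[OF summable_mult[OF summable_weight_powr[OF \<sigma>], of "c * A"]])
    fix m
    have "(\<integral>x. norm (f m x) \<partial>lborel)
        = weight m * (\<integral>x. norm ((indicator {0..} x * profile (q ^ m * x)) *\<^sub>R w x) \<partial>lborel)"
      unfolding f_def norm_scaleR[of "weight m"] using weight_pos[of m] by simp
    also have "\<dots> \<le> weight m * (c * A * (q ^ m) powr (- (1 + \<sigma>)))"
      using profile_transform_norm[OF growth qm] weight_pos[of m] unfolding A_def
      by (intro mult_left_mono) auto
    finally show "norm (\<integral>x. norm (f m x) \<partial>lborel) \<le> c * A * (weight m * (q ^ m) powr (- (1 + \<sigma>)))"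
      by (simp add: mult_ac)
  qed
  note fubini = integrable_suminf[OF int AE_I2[OF sm_x] sm_int] sums_integral[OF int AE_I2[OF sm_x] sm_int]
  have int_f: "integral\<^sup>L lborel (f m) = weight m *\<^sub>R (\<Sum>n. alt_coeff n *\<^sub>R integral\<^sup>L lborel (laplace_kernel w (q ^ m / q ^ n)))" for m
    unfolding f_def by (simp only: integral_scaleR_right profile_transform[OF growth qm])
  show ?A
    using integrable_scaleR_right[OF fubini(1), of C] C unfolding sum_x by simp
  have "1 / C = qpoch_inf q q / qpoch_inf z q"
    by (simp add: C_def)
  then show ?B
    using fubini(2) by (simp only: sum_x int_f integral_scaleR_right)
qed

end

lemma laplace_kernel_exp:
  assumes l: "0 < l"
  shows "has_bochner_integral lborel (laplace_kernel (\<lambda>x. 1 :: real) l) (1 / l)"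
proof (rule has_bochner_integral_nn_integral)
  have "(\<integral>\<^sup>+x. ennreal (exp (- (l * x))) * indicator {0..} x \<partial>lborel) = 0 - (- exp (- (l * 0)) / l)"
  proof (rule nn_integral_FTC_atLeast)
    show "((\<lambda>x. - exp (- (l * x)) / l) has_real_derivative exp (- (l * x))) (at x)" for x
      using l by (auto intro!: derivative_eq_intros)
    show "((\<lambda>x. - exp (- (l * x)) / l) \<longlongrightarrow> 0) at_top"
      using l by real_asymp
  qed auto
  also have "(\<integral>\<^sup>+x. ennreal (exp (- (l * x))) * indicator {0..} x \<partial>lborel)
      = (\<integral>\<^sup>+x. ennreal (laplace_kernel (\<lambda>x. 1 :: real) l x) \<partial>lborel)"
    by (intro nn_integral_cong) (auto simp: laplace_kernel_def indicator_def)
  finally show "(\<integral>\<^sup>+x. ennreal (laplace_kernel (\<lambda>x. 1 :: real) l x) \<partial>lborel) = ennreal (1 / l)"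
    by simp
qed (use l in \<open>auto simp: laplace_kernel_def[abs_def]\<close>)

lemma measurable_laplace_kernel [measurable]:
  fixes w :: "real \<Rightarrow> 'b::{banach, second_countable_topology}"
  assumes [measurable]: "w \<in> borel_measurable borel"
  shows "laplace_kernel w l \<in> borel_measurable borel"
  unfolding laplace_kernel_def[abs_def] by measurable

lemma
  assumes l: "0 < l"
  shows integrable_laplace_kernel_iexp: "integrable lborel (laplace_kernel (\<lambda>x. iexp (t * x)) l)"
    and integral_norm_laplace_kernel_iexp:
      "(\<integral>x. norm (laplace_kernel (\<lambda>x. iexp (t * x)) l x) \<partial>lborel) = 1 / l"
    and integral_laplace_kernel_iexp:
      "integral\<^sup>L lborel (laplace_kernel (\<lambda>x. iexp (t * x)) l) = 1 / (of_real l - \<i> * of_real t)"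
proof -
  define a where "a = \<i> * of_real t - of_real l"
  have a: "a \<noteq> 0" "Re a = - l" using l by (auto simp: a_def complex_eq_iff)
  have norm_eq: "norm (laplace_kernel (\<lambda>x. iexp (t * x)) l x) = laplace_kernel (\<lambda>x. 1 :: real) l x" for x
    by (simp add: laplace_kernel_def)
  show int: "integrable lborel (laplace_kernel (\<lambda>x. iexp (t * x)) l)"
  proof (rule Bochner_Integration.integrable_bound)
    show "integrable lborel (laplace_kernel (\<lambda>x. 1 :: real) l)"
      using laplace_kernel_exp[OF l] by (rule integrable.intros)
    show "AE x in lborel. norm (laplace_kernel (\<lambda>x. iexp (t * x)) l x) \<le> norm (laplace_kernel (\<lambda>x. 1 :: real) l x)"
      unfolding norm_eq by simp
  qed simp
  show "(\<integral>x. norm (laplace_kernel (\<lambda>x. iexp (t * x)) l x) \<partial>lborel) = 1 / l"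
    unfolding norm_eq using laplace_kernel_exp[OF l] by (rule has_bochner_integral_integral_eq)
  have "((\<lambda>T. \<integral>x. indicator {..T} x *\<^sub>R laplace_kernel (\<lambda>x. iexp (t * x)) l x \<partial>lborel)
      \<longlongrightarrow> integral\<^sup>L lborel (laplace_kernel (\<lambda>x. iexp (t * x)) l)) at_top"
    by (rule tendsto_integral_at_top[OF _ int]) simp
  moreover have "((\<lambda>T. \<integral>x. indicator {..T} x *\<^sub>R laplace_kernel (\<lambda>x. iexp (t * x)) l x \<partial>lborel)
      \<longlongrightarrow> 0 / a - 1 / a) at_top"
  proof (rule Lim_transform_eventually)
    have "((\<lambda>T. norm (exp (a * of_real T))) \<longlongrightarrow> 0) at_top"
      unfolding norm_exp_eq_Re using l by (simp add: a) real_asymp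
    then have "((\<lambda>T. exp (a * of_real T)) \<longlongrightarrow> 0) at_top"
      by (rule tendsto_norm_zero_cancel)
    then show "((\<lambda>T. exp (a * of_real T) / a - 1 / a) \<longlongrightarrow> 0 / a - 1 / a) at_top"
      using a by (intro tendsto_intros)
    show "\<forall>\<^sub>F T in at_top. exp (a * of_real T) / a - 1 / a
        = (\<integral>x. indicator {..T} x *\<^sub>R laplace_kernel (\<lambda>x. iexp (t * x)) l x \<partial>lborel)"
      using eventually_ge_at_top[of "0::real"]
    proof eventually_elim
      case (elim T)
      have "(\<integral>x. indicator {0..T} x *\<^sub>R exp (a * of_real x) \<partial>lborel)
          = exp (a * of_real T) / a - exp (a * of_real 0) / a"
      proof (rule integral_FTC_Icc[OF elim])
        show "((\<lambda>x. exp (a * of_real x) / a) has_vector_derivative exp (a * of_real x)) (at x within {0..T})" for x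
          using a by (intro has_vector_derivative_real_field) (auto intro!: derivative_eq_intros)
      qed (intro continuous_intros)
      moreover have "indicator {..T} x *\<^sub>R laplace_kernel (\<lambda>x. iexp (t * x)) l x
          = indicator {0..T} x *\<^sub>R exp (a * of_real x)" for x
        by (auto simp: laplace_kernel_def indicator_def a_def scaleR_conv_of_real exp_of_real[symmetric]
            algebra_simps simp flip: exp_add)
      ultimately show ?case by simp
    qed
  qed
  ultimately have "integral\<^sup>L lborel (laplace_kernel (\<lambda>x. iexp (t * x)) l) = 0 / a - 1 / a"
    by (rule tendsto_unique[OF trivial_limit_at_top_linorder])
  also have "0 / a - 1 / a = 1 / (- a)"
    by simp
  also have "- a = of_real l - \<i> * of_real t"
    by (simp add: a_def)
  finally show "integral\<^sup>L lborel (laplace_kernel (\<lambda>x. iexp (t * x)) l) = 1 / (of_real l - \<i> * of_real t)" .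
qed

lemma laplace_growth_iexp: "laplace_growth 1 0 (\<lambda>x. iexp (t * x))"
  unfolding laplace_growth_def
proof (intro allI impI conjI)
  fix l :: real assume l: "0 < l"
  show "integrable lborel (laplace_kernel (\<lambda>x. iexp (t * x)) l)"
    by (rule integrable_laplace_kernel_iexp[OF l])
  show "(\<integral>x. norm (laplace_kernel (\<lambda>x. iexp (t * x)) l x) \<partial>lborel) \<le> 1 * l powr (- (1 + 0))"
    unfolding integral_norm_laplace_kernel_iexp[OF l] using l by (simp add: powr_minus_divide)
qed

lemma norm_of_real_powr: "0 \<le> x \<Longrightarrow> norm (complex_of_real x powr s) = x powr Re s"
  by (cases "x = 0") (auto simp: norm_powr_real_powr)

lemma
  assumes l: "0 < l" and s: "-1 < Re s"
  shows integrable_laplace_kernel_powr: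
      "integrable lborel (laplace_kernel (\<lambda>x. complex_of_real x powr s) l)"
    and integral_laplace_kernel_powr:
      "integral\<^sup>L lborel (laplace_kernel (\<lambda>x. complex_of_real x powr s) l)
         = Gamma (1 + s) * of_real l powr (- (1 + s))"
proof -
  have s1: "0 < Re (s + 1)" using s by simp
  have kernel_eq: "laplace_kernel (\<lambda>x. complex_of_real x powr s) k x
      = indicator {0<..} x *\<^sub>R (complex_of_real x powr (s + 1 - 1) / of_real (exp (k * x)))" for k x
    by (auto simp: laplace_kernel_def indicator_def scaleR_conv_of_real exp_minus divide_inverse of_real_inverse
        powr_def[of 0])
  then have kernel_fun: "laplace_kernel (\<lambda>x. complex_of_real x powr s) k
      = (\<lambda>x. indicator {0<..} x *\<^sub>R (complex_of_real x powr (s + 1 - 1) / of_real (exp (k * x))))" for k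
    by blast
  have int: "integrable lebesgue (laplace_kernel (\<lambda>x. complex_of_real x powr s) k)" if "0 < k" for k
    using absolutely_integrable_Gamma_integral[OF s1 that]
    unfolding set_integrable_def kernel_fun .
  have meas: "laplace_kernel (\<lambda>x. complex_of_real x powr s) k \<in> borel_measurable lborel" for k
    by measurable
  show "integrable lborel (laplace_kernel (\<lambda>x. complex_of_real x powr s) l)"
    using int[OF l] integrable_completion[OF meas] by simp
  have "integral\<^sup>L lborel (laplace_kernel (\<lambda>x. complex_of_real x powr s) 1)
      = (LINT x:{0<..} | lebesgue. complex_of_real x powr (s + 1 - 1) / of_real (exp (1 * x)))"
    unfolding set_lebesgue_integral_def kernel_fun[symmetric]
    by (rule integral_completion[OF meas, symmetric])
  also have "\<dots> = Gamma (s + 1)"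
    using set_lebesgue_integral_eq_integral(2)[OF absolutely_integrable_Gamma_integral[OF s1, of 1]]
      integral_unique[OF Gamma_integral_complex'[OF s1]] by simp
  finally have one: "integral\<^sup>L lborel (laplace_kernel (\<lambda>x. complex_of_real x powr s) 1) = Gamma (1 + s)"
    by (simp add: add.commute)
  have "integral\<^sup>L lborel (laplace_kernel (\<lambda>x. complex_of_real x powr s) l)
      = \<bar>1 / l\<bar> *\<^sub>R (\<integral>x. laplace_kernel (\<lambda>x. complex_of_real x powr s) l (0 + 1 / l * x) \<partial>lborel)"
    using l by (intro lborel_integral_real_affine) auto
  also have "(\<lambda>x. laplace_kernel (\<lambda>x. complex_of_real x powr s) l (0 + 1 / l * x))
      = (\<lambda>x. of_real l powr (- s) * laplace_kernel (\<lambda>x. complex_of_real x powr s) 1 x)"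
  proof
    fix x
    have "complex_of_real (x / l) powr s = of_real l powr (- s) * complex_of_real x powr s" if "0 \<le> x"
    proof (cases "x = 0")
      case False
      with that l have "complex_of_real (x / l) powr s = exp (s * (of_real (ln x) - of_real (ln l)))"
        by (simp add: powr_def ln_div Ln_of_real flip: of_real_divide of_real_diff)
      then show ?thesis
        using False that l by (simp add: powr_def Ln_of_real algebra_simps flip: exp_add)
    qed (use l in simp)
    then show "laplace_kernel (\<lambda>x. complex_of_real x powr s) l (0 + 1 / l * x)
        = of_real l powr (- s) * laplace_kernel (\<lambda>x. complex_of_real x powr s) 1 x"
      using l by (auto simp: laplace_kernel_def indicator_def zero_le_divide_iff)
  qed
  also have "\<bar>1 / l\<bar> *\<^sub>R (\<integral>x. of_real l powr (- s) * laplace_kernel (\<lambda>x. complex_of_real x powr s) 1 x \<partial>lborel)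
      = Gamma (1 + s) * (of_real l powr (- s) / of_real l)"
    using l by (simp add: one scaleR_conv_of_real)
  also have "of_real l powr (- s) / of_real l = complex_of_real l powr (- s - 1)"
    using l unfolding powr_diff by simp
  also have "- s - 1 = - (1 + s)"
    by simp
  finally show "integral\<^sup>L lborel (laplace_kernel (\<lambda>x. complex_of_real x powr s) l)
      = Gamma (1 + s) * of_real l powr (- (1 + s))" .
qed

lemma laplace_growth_powr:
  assumes s: "-1 < Re s"
  shows "laplace_growth (Gamma (1 + Re s)) (Re s) (\<lambda>x. complex_of_real x powr s)"
  unfolding laplace_growth_def
proof (intro allI impI conjI)
  fix l :: real assume l: "0 < l"
  show "integrable lborel (laplace_kernel (\<lambda>x. complex_of_real x powr s) l)"
    using integrable_laplace_kernel_powr[OF l s] .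
  have "complex_of_real (\<integral>x. norm (laplace_kernel (\<lambda>x. complex_of_real x powr s) l x) \<partial>lborel)
      = (\<integral>x. complex_of_real (norm (laplace_kernel (\<lambda>x. complex_of_real x powr s) l x)) \<partial>lborel)"
    by (rule integral_complex_of_real[symmetric])
  also have "\<dots> = integral\<^sup>L lborel (laplace_kernel (\<lambda>x. complex_of_real x powr of_real (Re s)) l)"
    by (intro Bochner_Integration.integral_cong)
      (auto simp: laplace_kernel_def indicator_def norm_of_real_powr powr_of_real scaleR_conv_of_real norm_mult)
  also have "\<dots> = Gamma (1 + of_real (Re s)) * of_real l powr (- (1 + of_real (Re s)))"
    using s by (intro integral_laplace_kernel_powr l) simp
  also have "\<dots> = complex_of_real (Gamma (1 + Re s) * l powr (- (1 + Re s)))"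
    using l by (simp add: powr_of_real[symmetric] Gamma_complex_of_real[symmetric])
  finally show "(\<integral>x. norm (laplace_kernel (\<lambda>x. complex_of_real x powr s) l x) \<partial>lborel)
      \<le> Gamma (1 + Re s) * l powr (- (1 + Re s))"
    unfolding of_real_eq_iff by simp
qed

section \<open>The characteristic function of the density\<close>

text \<open>The maximum principle. At infinity \<open>d\<close> is small because the coefficient on the left is at least
  \<open>\<bar>t\<bar>\<close> while the right hand side is bounded; so \<open>\<bar>d\<bar>\<close> has a maximum \<open>S\<close>, attained at some \<open>u\<close>. If
  \<open>S > 0\<close>, then \<open>u \<noteq> 0\<close>, and \<open>\<bar>1 + z - \<i> u\<bar> S \<le> (1 + z) S\<close> is impossible.\<close>

lemma q_difference_unique:
  fixes d :: "real \<Rightarrow> complex"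
  assumes "0 < q" "0 < z" and cont: "\<And>t. isCont d t" and zero: "d 0 = 0"
    and bounded: "\<And>t. norm (d t) \<le> B"
    and eq: "\<And>t. (1 + of_real z - \<i> * of_real t) * d t = d (q * t) + of_real z * d (t / q)"
  shows "d t = 0"
proof (rule ccontr)
  assume "d t \<noteq> 0"
  define e where "e = norm (d t)"
  have e: "0 < e" using \<open>d t \<noteq> 0\<close> by (simp add: e_def)
  have bound: "norm (1 + of_real z - \<i> * of_real t :: complex) * norm (d t) \<le> S + z * S"
    if "\<And>u. norm (d u) \<le> S" for t S
  proof -
    have "norm (1 + of_real z - \<i> * of_real t :: complex) * norm (d t)
        = norm (d (q * t) + of_real z * d (t / q))"
      by (simp flip: eq add: norm_mult)
    also have "\<dots> \<le> norm (d (q * t)) + z * norm (d (t / q))"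
      using norm_triangle_ineq[of "d (q * t)" "of_real z * d (t / q)"] assms(2) by (simp add: norm_mult)
    also have "\<dots> \<le> S + z * S"
      using that assms(2) by (intro add_mono mult_left_mono) auto
    finally show ?thesis .
  qed
  have norm_coeff: "1 + z \<le> norm (1 + of_real z - \<i> * of_real u :: complex)"
    "\<bar>u\<bar> \<le> norm (1 + of_real z - \<i> * of_real u :: complex)"
    "u \<noteq> 0 \<Longrightarrow> 1 + z < norm (1 + of_real z - \<i> * of_real u :: complex)" for u
  proof -
    show "1 + z \<le> norm (1 + of_real z - \<i> * of_real u :: complex)"
      using complex_Re_le_cmod[of "1 + of_real z - \<i> * of_real u"] by simp
    show "\<bar>u\<bar> \<le> norm (1 + of_real z - \<i> * of_real u :: complex)"
      using abs_Im_le_cmod[of "1 + of_real z - \<i> * of_real u"] by simp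
    assume "u \<noteq> 0"
    then have "(1 + z)\<^sup>2 < (1 + z)\<^sup>2 + u\<^sup>2" by simp
    then have "sqrt ((1 + z)\<^sup>2) < sqrt ((1 + z)\<^sup>2 + u\<^sup>2)" by (rule real_sqrt_less_mono)
    then show "1 + z < norm (1 + of_real z - \<i> * of_real u :: complex)"
      using assms(2) by (simp add: cmod_def)
  qed
  \<comment> \<open>outside \<open>[-R, R]\<close> the values of \<open>d\<close> stay below \<open>e\<close>, and \<open>t\<close> lies inside\<close>
  define R where "R = max \<bar>t\<bar> ((B + z * B) / e)"
  have "continuous_on {- R..R} (\<lambda>u. norm (d u))"
    using cont by (intro continuous_on_norm continuous_at_imp_continuous_on) auto
  then obtain u where u: "u \<in> {- R..R}" "\<And>v. v \<in> {- R..R} \<Longrightarrow> norm (d v) \<le> norm (d u)"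
    using continuous_attains_sup[of "{- R..R}" "\<lambda>u. norm (d u)"] by (force simp: R_def)
  have "t \<in> {- R..R}"
    unfolding R_def by (simp add: max_def) linarith
  then have "e \<le> norm (d u)"
    using u(2) by (simp add: e_def)
  have max: "norm (d v) \<le> norm (d u)" for v
  proof (cases "v \<in> {- R..R}")
    case False
    then have "(B + z * B) / e < \<bar>v\<bar>" by (auto simp: R_def)
    then have "B + z * B < \<bar>v\<bar> * e" using e by (simp add: field_simps)
    moreover have "\<bar>v\<bar> * norm (d v) \<le> B + z * B"
      using norm_coeff(2)[of v] bound[OF bounded, of v]
      by (meson mult_right_mono norm_ge_zero order_trans)
    ultimately have "\<bar>v\<bar> * norm (d v) < \<bar>v\<bar> * e" by linarith
    then have "norm (d v) < e" by (simp add: mult_less_cancel_left_disj)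
    then show ?thesis using \<open>e \<le> norm (d u)\<close> by simp
  qed (use u in auto)
  have pos: "0 < norm (d u)" using e \<open>e \<le> norm (d u)\<close> by linarith
  then have "u \<noteq> 0" using zero by auto
  then have "(1 + z) * norm (d u) < norm (1 + of_real z - \<i> * of_real u :: complex) * norm (d u)"
    using pos norm_coeff(3) by (intro mult_strict_right_mono) auto
  also have "\<dots> \<le> norm (d u) + z * norm (d u)"
    by (rule bound[OF max])
  finally show False by (simp add: algebra_simps)
qed

context q_density
begin

definition law :: "real measure" where
  "law = density lborel (\<lambda>x. ennreal (indicator {0..} x * density_fun q z x))"

lemma measurable_density_fun [measurable]: "density_fun q z \<in> borel_measurable borel"
  unfolding density_fun_def[abs_def] density_term_def[abs_def] by measurable

lemma sets_law [simp, measurable_cong]: "sets law = sets borel"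
  by (simp add: law_def)

lemma space_law [simp]: "space law = UNIV"
  by (simp add: law_def)

lemma weighted_density_nonneg: "0 \<le> indicator {0..} x * density_fun q z x"
  using density_fun_nonneg by (auto simp: indicator_def)

lemma
  fixes w :: "real \<Rightarrow> 'b::{banach, second_countable_topology}"
  assumes "w \<in> borel_measurable borel"
  shows integral_law: "integral\<^sup>L law w = (\<integral>x. (indicator {0..} x * density_fun q z x) *\<^sub>R w x \<partial>lborel)"
    and integrable_law: "integrable law w \<longleftrightarrow> integrable lborel (\<lambda>x. (indicator {0..} x * density_fun q z x) *\<^sub>R w x)"
proof -
  have "w \<in> borel_measurable lborel" using assms by simp
  then show "integral\<^sup>L law w = (\<integral>x. (indicator {0..} x * density_fun q z x) *\<^sub>R w x \<partial>lborel)"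
    "integrable law w \<longleftrightarrow> integrable lborel (\<lambda>x. (indicator {0..} x * density_fun q z x) *\<^sub>R w x)"
    unfolding law_def by (simp_all add: integral_density integrable_density weighted_density_nonneg)
qed

lemma laplace_growth_one: "laplace_growth 1 0 (\<lambda>_. 1 :: real)"
  unfolding laplace_growth_def
proof (intro allI impI conjI)
  fix l :: real assume "0 < l"
  note h = laplace_kernel_exp[OF this]
  show "integrable lborel (laplace_kernel (\<lambda>_. 1 :: real) l)"
    using h by (rule integrable.intros)
  have "(\<integral>x. norm (laplace_kernel (\<lambda>_. 1 :: real) l x) \<partial>lborel) = integral\<^sup>L lborel (laplace_kernel (\<lambda>_. 1 :: real) l)"
    by (intro Bochner_Integration.integral_cong) (auto simp: laplace_kernel_def)
  then show "(\<integral>x. norm (laplace_kernel (\<lambda>_. 1 :: real) l x) \<partial>lborel) \<le> 1 * l powr (- (1 + 0))"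
    using h \<open>0 < l\<close> by (simp add: has_bochner_integral_iff powr_minus_divide)
qed

lemma z_less_q_powr_0: "z < q powr 0"
  using z_less_one q_pos by simp

text \<open>Both Euler series enter: the sum over \<open>n\<close> gives \<open>(q;q)\<^sub>\<infinity>\<close> and the sum over \<open>m\<close> gives
  \<open>1 / (z;q)\<^sub>\<infinity>\<close>.\<close>

lemma law_total_mass: "(\<integral>x. indicator {0..} x * density_fun q z x \<partial>lborel) = 1"
proof -
  have "(\<lambda>m. weight m *\<^sub>R (\<Sum>n. alt_coeff n *\<^sub>R integral\<^sup>L lborel (laplace_kernel (\<lambda>_. 1 :: real) (q ^ m / q ^ n))))
      sums ((qpoch_inf q q / qpoch_inf z q) *\<^sub>R
        (\<integral>x. (indicator {0..} x * density_fun q z x) *\<^sub>R (1::real) \<partial>lborel))"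
    by (rule density_transform_sums[OF laplace_growth_one z_less_q_powr_0])
  moreover have "weight m *\<^sub>R (\<Sum>n. alt_coeff n *\<^sub>R integral\<^sup>L lborel (laplace_kernel (\<lambda>_. 1 :: real) (q ^ m / q ^ n)))
      = inv_coeff m * z ^ m * qpoch_inf q q" for m
  proof -
    have "integral\<^sup>L lborel (laplace_kernel (\<lambda>_. 1 :: real) (q ^ m / q ^ n)) = q ^ n / q ^ m" for n
      using laplace_kernel_exp[of "q ^ m / q ^ n"] q_pos by (simp add: has_bochner_integral_iff)
    then have "(\<Sum>n. alt_coeff n *\<^sub>R integral\<^sup>L lborel (laplace_kernel (\<lambda>_. 1 :: real) (q ^ m / q ^ n)))
        = (\<Sum>n. of_real (alt_coeff n) * q ^ n / q ^ m)"
      by simp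
    also have "\<dots> = qpoch_inf q q / q ^ m"
      using suminf_divide[OF summable_alt_coeff[of q], of "q ^ m"] euler_alt_series[of q] by simp
    finally show ?thesis
      using q_pos by (simp add: weight_def power_mult_distrib)
  qed
  ultimately have "(\<lambda>m. inv_coeff m * z ^ m * qpoch_inf q q)
      sums ((qpoch_inf q q / qpoch_inf z q) * (\<integral>x. indicator {0..} x * density_fun q z x \<partial>lborel))"
    by simp
  moreover have "(\<lambda>m. inv_coeff m * z ^ m * qpoch_inf q q) sums (1 / qpoch_inf z q * qpoch_inf q q)"
  proof (intro sums_mult2)
    have "norm z < 1" using z_pos z_less_one by simp
    then show "(\<lambda>m. inv_coeff m * z ^ m) sums (1 / qpoch_inf z q)"
      using summable_inv_coeff[of z] euler_inv_series[of z] qpoch_inf_nonzero[of z]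
      by (simp add: sums_iff field_simps)
  qed
  ultimately have "(qpoch_inf q q / qpoch_inf z q) * (\<integral>x. indicator {0..} x * density_fun q z x \<partial>lborel)
      = (qpoch_inf q q / qpoch_inf z q) * 1"
    using sums_unique2 by fastforce
  then show ?thesis
    unfolding mult_cancel_left using normalisation_pos by auto
qed

lemma integrable_density_fun: "integrable lborel (\<lambda>x. indicator {0..} x * density_fun q z x)"
  using density_transform_integrable[OF laplace_growth_one z_less_q_powr_0] by simp

lemma prob_space_law: "prob_space law"
proof
  have "emeasure law (space law) = (\<integral>\<^sup>+x. ennreal (indicator {0..} x * density_fun q z x) \<partial>lborel)"
    unfolding law_def by (subst emeasure_density) auto
  also have "\<dots> = ennreal (\<integral>x. indicator {0..} x * density_fun q z x \<partial>lborel)"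
    by (intro nn_integral_eq_integral integrable_density_fun) (simp add: weighted_density_nonneg)
  finally show "emeasure law (space law) = 1"
    by (simp add: law_total_mass)
qed

lemma real_distribution_law: "real_distribution law"
  using prob_space_law by (simp add: real_distribution_def real_distribution_axioms_def)

text \<open>The Fourier transform of \<open>profile (q\<^sup>m x)\<close> on the half line.\<close>

definition profile_char :: "real \<Rightarrow> nat \<Rightarrow> complex" where
  "profile_char t m = (\<Sum>n. of_real (alt_coeff n) / (of_real (q ^ m / q ^ n) - \<i> * of_real t))"

lemma char_law_sums:
  "(\<lambda>m. of_real (weight m) * profile_char t m) sums (of_real (qpoch_inf q q / qpoch_inf z q) * char law t)"
proof -
  have pos: "0 < q ^ m / q ^ n" for m n using q_pos by simp
  have "char law t = (\<integral>x. (indicator {0..} x * density_fun q z x) *\<^sub>R iexp (t * x) \<partial>lborel)"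
    unfolding char_def by (rule integral_law) simp
  moreover have "(\<Sum>n. alt_coeff n *\<^sub>R integral\<^sup>L lborel (laplace_kernel (\<lambda>x. iexp (t * x)) (q ^ m / q ^ n)))
      = profile_char t m" for m
    unfolding profile_char_def integral_laplace_kernel_iexp[OF pos] by (simp add: scaleR_conv_of_real)
  ultimately show ?thesis
    using density_transform_sums[OF laplace_growth_iexp[of t] z_less_q_powr_0] by (simp add: scaleR_conv_of_real)
qed

lemma denom_nonzero: "0 < l \<Longrightarrow> of_real l - \<i> * of_real t \<noteq> (0::complex)"
  by (auto simp: complex_eq_iff)

lemma summable_profile_char:
  assumes "0 < l"
  shows "summable (\<lambda>n. of_real (alt_coeff n) / (of_real (l / q ^ n) - \<i> * of_real t) :: complex)"
proof (rule summable_norm_cancel, rule summable_comparison_test')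
  show "summable (\<lambda>n. \<bar>alt_coeff n\<bar> * q ^ n * (1 / l))"
    using summable_norm_alt_coeff[of q] q_pos by (intro summable_mult2) simp
  fix n
  have "l / q ^ n \<le> norm (of_real (l / q ^ n) - \<i> * of_real t :: complex)"
    using complex_Re_le_cmod[of "of_real (l / q ^ n) - \<i> * of_real t"] by simp
  then have "\<bar>alt_coeff n\<bar> / norm (of_real (l / q ^ n) - \<i> * of_real t :: complex) \<le> \<bar>alt_coeff n\<bar> / (l / q ^ n)"
    using assms q_pos by (intro divide_left_mono mult_pos_pos) (auto intro: order.strict_trans2)
  then show "norm (norm (of_real (alt_coeff n) / (of_real (l / q ^ n) - \<i> * of_real t) :: complex))
      \<le> \<bar>alt_coeff n\<bar> * q ^ n * (1 / l)"
    by (simp add: norm_divide)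
qed

text \<open>Dilation by \<open>q\<close> of the function is dilation by \<open>1 / q\<close> of its transform.\<close>

lemma profile_char_shift: "profile_char (t / q) m = of_real q * profile_char t (Suc m)"
proof -
  have "profile_char (t / q) m
      = (\<Sum>n. of_real q * (of_real (alt_coeff n) / (of_real (q ^ Suc m / q ^ n) - \<i> * of_real t)))"
    unfolding profile_char_def
  proof (rule suminf_cong)
    fix n
    have "of_real (q ^ m / q ^ n) - \<i> * of_real (t / q)
        = (of_real (q ^ Suc m / q ^ n) - \<i> * of_real t :: complex) / of_real q"
      using q_pos by (simp add: field_simps)
    then show "of_real (alt_coeff n) / (of_real (q ^ m / q ^ n) - \<i> * of_real (t / q))
      = of_real q * (of_real (alt_coeff n) / (of_real (q ^ Suc m / q ^ n) - \<i> * of_real t) :: complex)"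
      by simp
  qed
  also have "\<dots> = of_real q * profile_char t (Suc m)"
    unfolding profile_char_def using q_pos by (intro suminf_mult summable_profile_char) simp
  finally show ?thesis .
qed

text \<open>The recursion of \<open>alt_coeff\<close> gives \<open>f'(y) = - f(y) + f(y / q) / q\<close> for \<open>f = profile\<close>; this is the
  transformed equation. The value \<open>f(0) = \<Sum>n. alt_coeff n = 0\<close> removes the boundary term.\<close>

lemma profile_char_eq:
  "(1 - \<i> * of_real t / of_real (q ^ m)) * profile_char t m = profile_char (q * t) m"
proof -
  define l where "l = q ^ m"
  have l: "0 < l" using q_pos by (simp add: l_def)
  define X :: "nat \<Rightarrow> complex" where "X n = 1 / (of_real (l / q ^ n) - \<i> * of_real t)" for n
  define b :: "nat \<Rightarrow> complex" where "b n = of_real (alt_coeff n)" for n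
  have nz: "of_real (l / q ^ n) - \<i> * of_real t \<noteq> (0::complex)" for n
    using l q_pos by (intro denom_nonzero) simp
  have smX: "summable (\<lambda>n. b n * X n)"
    using summable_profile_char[OF l, of t] by (simp add: b_def X_def)
  have F: "profile_char t m = (\<Sum>n. b n * X n)"
    by (simp add: profile_char_def b_def X_def l_def)
  have Y: "of_real (alt_coeff n) / (of_real (l / q ^ n) - \<i> * of_real (q * t)) = b n * X (Suc n) / of_real q" for n
  proof -
    have "of_real (l / q ^ n) - \<i> * of_real (q * t) = of_real q * (of_real (l / q ^ Suc n) - \<i> * of_real t :: complex)"
      using q_pos by (simp add: field_simps)
    then show ?thesis by (simp add: b_def X_def)
  qed
  have F': "profile_char (q * t) m = (\<Sum>n. b n * X (Suc n) / of_real q)"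
    unfolding profile_char_def l_def[symmetric] Y ..
  have smY: "summable (\<lambda>n. b n * X (Suc n) / of_real q)"
    using summable_profile_char[OF l, of "q * t"] unfolding Y .
  have smb: "summable b" and sumb: "suminf b = 0"
    using summable_alt_coeff[of "1::complex"] euler_alt_series[of "1::complex"] qpoch_inf_eq_0[of "1::complex" 0]
    by (simp_all add: b_def[abs_def])
  have nX: "\<i> * of_real t * X n = of_real l / of_real (q ^ n) * X n - 1" for n
    using nz[of n] by (simp add: X_def field_simps)
  \<comment> \<open>\<open>c 0 = 0\<close>, and \<open>c (Suc n)\<close> is the \<open>n\<close>-th term of the transform at \<open>q t\<close>\<close>
  define c where "c n = (b n - b n / of_real (q ^ n)) * X n" for n
  have c_Suc: "c (Suc n) = b n * X (Suc n) / of_real q" for n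
  proof -
    have "b (Suc n) - b (Suc n) / of_real (q ^ Suc n) = of_real (alt_coeff (Suc n) - alt_coeff (Suc n) / q ^ Suc n)"
      by (simp add: b_def)
    also have "\<dots> = b n / of_real q"
      unfolding alt_coeff_div_Suc by (simp add: b_def)
    finally show ?thesis by (simp add: c_def)
  qed
  have "c sums (\<Sum>n. b n * X (Suc n) / of_real q)"
    using summable_sums[OF smY] unfolding c_Suc[symmetric] by (subst (asm) sums_Suc_iff) (simp add: c_def b_def)
  then have "(\<lambda>n. of_real l * c n + b n) sums (of_real l * profile_char (q * t) m + 0)"
    unfolding F' using smb sumb by (intro sums_add sums_mult) (auto simp: sums_iff)
  moreover have "of_real l * c n + b n = (of_real l - \<i> * of_real t) * (b n * X n)" for n
  proof -
    have "(of_real l - \<i> * of_real t) * (b n * X n) = of_real l * b n * X n - b n * (\<i> * of_real t * X n)"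
      by (simp add: algebra_simps)
    also have "\<dots> = of_real l * c n + b n"
      unfolding nX c_def by (simp add: algebra_simps)
    finally show ?thesis ..
  qed
  ultimately have "(\<lambda>n. (of_real l - \<i> * of_real t) * (b n * X n)) sums (of_real l * profile_char (q * t) m)"
    by simp
  moreover have "(\<lambda>n. (of_real l - \<i> * of_real t) * (b n * X n)) sums ((of_real l - \<i> * of_real t) * profile_char t m)"
    unfolding F by (intro sums_mult summable_sums smX)
  ultimately have "(of_real l - \<i> * of_real t) * profile_char t m = of_real l * profile_char (q * t) m"
    using sums_unique2 by blast
  then show ?thesis
    using l by (simp add: l_def[symmetric] field_simps)
qed

text \<open>The equation of \<open>profile_char\<close> and the recursion of \<open>weight\<close> express \<open>\<phi>(q t)\<close>, \<open>z \<phi>(t / q)\<close> and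
  \<open>z \<phi>(t)\<close> as sums over \<open>m\<close> of \<open>weight m * profile_char t m\<close> with the factors
  \<open>1 - \<i> t / q\<^sup>m\<close>, \<open>1 - q\<^sup>m\<close> and their product. The claim then holds term by term.\<close>

lemma char_law_q_difference:
  "(1 + of_real z - \<i> * of_real t) * char law t = char law (q * t) + of_real z * char law (t / q)"
proof -
  define K :: complex where "K = of_real (qpoch_inf q q / qpoch_inf z q)"
  have K: "K \<noteq> 0"
    using normalisation_pos by (auto simp: K_def)
  define a :: "nat \<Rightarrow> complex" where "a m = of_real (weight m)" for m
  define F where "F m = profile_char t m" for m
  define r :: "nat \<Rightarrow> complex" where "r m = of_real (q ^ m)" for m
  have r: "r m \<noteq> 0" for m using q_pos by (simp add: r_def)
  have a_Suc: "a (Suc m) * (1 - r (Suc m)) = of_real q * of_real z * a m" for m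
    using arg_cong[OF weight_Suc[of m], of of_real] by (simp add: a_def r_def)
  have sums: "(\<lambda>m. a m * profile_char u m) sums (K * char law u)" for u
    unfolding a_def K_def by (rule char_law_sums)
  have s1: "(\<lambda>m. a m * ((1 - \<i> * of_real t / r m) * F m)) sums (K * char law (q * t))"
    unfolding F_def r_def profile_char_eq by (rule sums)
  have shift: "(\<lambda>m. a m * ((1 - r m) * profile_char u m)) sums (K * (of_real z * char law (u / q)))" for u
  proof -
    have "(\<lambda>m. of_real z * (a m * profile_char (u / q) m)) sums (of_real z * (K * char law (u / q)))"
      by (intro sums_mult sums)
    moreover have "of_real z * (a m * profile_char (u / q) m) = a (Suc m) * ((1 - r (Suc m)) * profile_char u (Suc m))" for m
      using a_Suc[of m] unfolding profile_char_shift by (simp add: mult_ac)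
    ultimately have "(\<lambda>m. a (Suc m) * ((1 - r (Suc m)) * profile_char u (Suc m))) sums (K * (of_real z * char law (u / q)))"
      by (simp add: mult_ac)
    then show ?thesis
      by (subst (asm) sums_Suc_iff) (simp add: r_def)
  qed
  have s2: "(\<lambda>m. a m * ((1 - r m) * F m)) sums (K * (of_real z * char law (t / q)))"
    unfolding F_def by (rule shift)
  have s3: "(\<lambda>m. a m * ((1 - r m) * ((1 - \<i> * of_real t / r m) * F m))) sums (K * (of_real z * char law t))"
    using shift[of "q * t"] q_pos unfolding F_def r_def profile_char_eq by simp
  have s4: "(\<lambda>m. (1 - \<i> * of_real t) * (a m * F m)) sums ((1 - \<i> * of_real t) * (K * char law t))"
    unfolding F_def by (intro sums_mult sums)
  have "(1 - \<i> * of_real t) * (a m * F m) + a m * ((1 - r m) * ((1 - \<i> * of_real t / r m) * F m))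
      = a m * ((1 - \<i> * of_real t / r m) * F m) + a m * ((1 - r m) * F m)" for m
    using r[of m] by (simp add: field_simps)
  with sums_add[OF s4 s3] sums_add[OF s1 s2]
  have "(1 - \<i> * of_real t) * (K * char law t) + K * (of_real z * char law t)
      = K * char law (q * t) + K * (of_real z * char law (t / q))"
    using sums_unique2 by fastforce
  then have "K * ((1 + of_real z - \<i> * of_real t) * char law t)
      = K * (char law (q * t) + of_real z * char law (t / q))"
    by (simp add: algebra_simps)
  then show ?thesis using K by simp
qed

theorem law_unique:
  assumes "real_distribution N"
    and "\<And>t. (1 + of_real z - \<i> * of_real t) * char N t = char N (q * t) + of_real z * char N (t / q)"
  shows "N = law"
proof (rule Levy_uniqueness[OF assms(1) real_distribution_law], rule ext)
  fix t
  interpret N: real_distribution N by fact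
  interpret L: real_distribution law by (rule real_distribution_law)
  have "char N t - char law t = 0"
  proof (rule q_difference_unique[OF q_pos z_pos])
    show "isCont (\<lambda>t. char N t - char law t) t" for t
      by (intro continuous_intros N.isCont_char L.isCont_char)
    show "char N 0 - char law 0 = 0"
      by (simp add: N.char_zero L.char_zero)
    show "norm (char N t - char law t) \<le> 2" for t
      using norm_triangle_ineq4[of "char N t" "char law t"] N.cmod_char_le_1[of t] L.cmod_char_le_1[of t] by linarith
    show "(1 + of_real z - \<i> * of_real t) * (char N t - char law t)
        = char N (q * t) - char law (q * t) + of_real z * (char N (t / q) - char law (t / q))" for t
      unfolding right_diff_distrib assms(2) char_law_q_difference by simp
  qed
  then show "char N t = char law t" by simp
qed

text \<open>By the Gamma integral each exponential of rate \<open>q\<^sup>m\<^sup>-\<^sup>n\<close> contributes \<open>\<Gamma>(1 + s) Q\<^sup>n / Q\<^sup>m\<close> with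
  \<open>Q = q\<^sup>1\<^sup>+\<^sup>s\<close>. Euler's series sum the powers of \<open>Q\<close> over \<open>n\<close> and those of \<open>q z / Q = z q\<^sup>-\<^sup>s\<close> over
  \<open>m\<close>.\<close>

lemma mellin_law:
  assumes s: "-1 < Re s" "z < q powr Re s"
  shows "(\<integral>x. complex_of_real x powr s \<partial>law)
    = of_real (qpoch_inf z q / qpoch_inf q q) * Gamma (1 + s) * qpoch_inf (of_real q powr (1 + s)) (of_real q)
        / qpoch_inf (of_real z * of_real q powr (- s)) (of_real q)"
proof -
  define Q where "Q = complex_of_real q powr (1 + s)"
  have Q: "Q \<noteq> 0" using q_pos by (simp add: Q_def)
  define u where "u = complex_of_real z * of_real q powr (- s)"
  have u: "norm u < 1"
    using s q_pos z_pos by (simp add: u_def norm_mult norm_divide norm_of_real_powr powr_minus field_simps)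
  have qzQ: "of_real (q * z) / Q = u"
    using q_pos unfolding Q_def u_def by (simp add: powr_add powr_minus field_simps)
  have pos: "0 < q ^ m / q ^ n" for m n using q_pos by simp
  have pow: "of_real (q ^ m / q ^ n) powr (- (1 + s)) = Q ^ n / Q ^ m" for m n
  proof -
    have "ln (q ^ m / q ^ n) = (real m - real n) * ln q"
      using q_pos by (simp add: ln_div ln_realpow algebra_simps)
    then have "of_real (q ^ m / q ^ n) powr (- (1 + s)) = exp (- (1 + s) * of_real ((real m - real n) * ln q))"
      using pos[of m n] q_pos by (simp add: powr_def Ln_of_real del: of_real_mult of_real_divide of_real_power)
    also have "\<dots> = exp (of_nat n * ((1 + s) * of_real (ln q)) - of_nat m * ((1 + s) * of_real (ln q)))"
      by (simp add: algebra_simps)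
    also have "\<dots> = Q ^ n / Q ^ m"
      using q_pos by (simp only: exp_diff exp_of_nat_mult) (simp add: Q_def powr_def Ln_of_real)
    finally show ?thesis .
  qed
  define G where "G = Gamma (1 + s) * qpoch_inf Q (of_real q)"
  have "(\<Sum>n. alt_coeff n *\<^sub>R integral\<^sup>L lborel (laplace_kernel (\<lambda>x. complex_of_real x powr s) (q ^ m / q ^ n)))
      = G / Q ^ m" for m
  proof -
    have "(\<Sum>n. alt_coeff n *\<^sub>R integral\<^sup>L lborel (laplace_kernel (\<lambda>x. complex_of_real x powr s) (q ^ m / q ^ n)))
        = (\<Sum>n. (Gamma (1 + s) / Q ^ m) * (of_real (alt_coeff n) * Q ^ n))"
      unfolding integral_laplace_kernel_powr[OF pos s(1)] pow by (simp add: scaleR_conv_of_real mult_ac)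
    also have "\<dots> = G / Q ^ m"
      by (subst suminf_mult[OF summable_alt_coeff]) (simp add: euler_alt_series G_def)
    finally show ?thesis .
  qed
  then have "(\<lambda>m. weight m *\<^sub>R (G / Q ^ m)) sums ((qpoch_inf q q / qpoch_inf z q) *\<^sub>R
      (\<integral>x. (indicator {0..} x * density_fun q z x) *\<^sub>R complex_of_real x powr s \<partial>lborel))"
    using density_transform_sums[OF laplace_growth_powr[OF s(1)] s(2)] by simp
  moreover have "weight m *\<^sub>R (G / Q ^ m) = G * (of_real (inv_coeff m) * u ^ m)" for m
    unfolding qzQ[symmetric] by (simp add: weight_def scaleR_conv_of_real power_divide)
  moreover have "(\<lambda>m. G * (of_real (inv_coeff m) * u ^ m)) sums (G * (1 / qpoch_inf u (of_real q)))"
    using summable_inv_coeff[OF u] euler_inv_series[OF u] qpoch_inf_nonzero[OF u]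
    by (intro sums_mult) (simp add: sums_iff field_simps)
  ultimately have "(qpoch_inf q q / qpoch_inf z q) *\<^sub>R
      (\<integral>x. (indicator {0..} x * density_fun q z x) *\<^sub>R complex_of_real x powr s \<partial>lborel)
      = G * (1 / qpoch_inf u (of_real q))"
    using sums_unique2 by simp
  also have "(\<integral>x. (indicator {0..} x * density_fun q z x) *\<^sub>R complex_of_real x powr s \<partial>lborel)
      = (\<integral>x. complex_of_real x powr s \<partial>law)"
    by (rule integral_law[symmetric]) simp
  finally have "of_real (qpoch_inf z q / qpoch_inf q q) * (of_real (qpoch_inf q q / qpoch_inf z q) *
      (\<integral>x. complex_of_real x powr s \<partial>law))
      = of_real (qpoch_inf z q / qpoch_inf q q) * (G * (1 / qpoch_inf u (of_real q)))"
    by (simp only: scaleR_conv_of_real)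
  moreover have "of_real (qpoch_inf z q / qpoch_inf q q) * of_real (qpoch_inf q q / qpoch_inf z q) = (1 :: complex)"
    using qpoch_inf_pos[of z] qpoch_inf_pos[of q] q_pos z_pos q_less_one z_less_one by simp
  ultimately have "(\<integral>x. complex_of_real x powr s \<partial>law)
      = of_real (qpoch_inf z q / qpoch_inf q q) * (G * (1 / qpoch_inf u (of_real q)))"
    by (simp only: mult.assoc[symmetric] mult_1_left)
  then show ?thesis
    by (simp add: G_def u_def Q_def)
qed

text \<open>For \<open>\<sigma> > -1\<close> this is the absolute convergence behind the Mellin transform. For \<open>\<sigma> \<le> -1\<close> the power
  is at most \<open>1\<close> beyond \<open>1\<close>, and near \<open>0\<close> the flatness of the density compensates its growth.\<close>

lemma integrable_law_powr:
  assumes "z < q powr \<sigma>"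
  shows "integrable law (\<lambda>x. x powr \<sigma>)"
proof (cases "-1 < \<sigma>")
  case True
  then have "integrable lborel (\<lambda>x. (indicator {0..} x * density_fun q z x) *\<^sub>R norm (complex_of_real x powr of_real \<sigma>))"
    using assms by (intro density_transform_integrable[OF laplace_growth_norm[OF laplace_growth_powr]]) auto
  also have "(\<lambda>x. (indicator {0..} x * density_fun q z x) *\<^sub>R norm (complex_of_real x powr of_real \<sigma>))
      = (\<lambda>x. (indicator {0..} x * density_fun q z x) *\<^sub>R (x powr \<sigma>))"
    by (auto simp: indicator_def norm_of_real_powr)
  finally show ?thesis
    by (subst integrable_law) auto
next
  case False
  define k where "k = nat \<lceil>- \<sigma>\<rceil>"
  have k: "0 \<le> \<sigma> + real k" using False unfolding k_def by linarith
  obtain c where c: "0 \<le> c" "\<And>x. 0 \<le> x \<Longrightarrow> density_fun q z x \<le> c * x ^ k"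
    using density_fun_le_power[of k] by blast
  show ?thesis
  proof (subst integrable_law, simp, rule Bochner_Integration.integrable_bound)
    show "integrable lborel (\<lambda>x. c * indicator {0..1} x + indicator {0..} x * density_fun q z x)"
      by (intro Bochner_Integration.integrable_add integrable_density_fun integrable_mult_right) simp
    show "AE x in lborel. norm ((indicator {0..} x * density_fun q z x) *\<^sub>R x powr \<sigma>)
        \<le> norm (c * indicator {0..1} x + indicator {0..} x * density_fun q z x)"
    proof (rule AE_I2)
      fix x :: real
      consider "x \<le> 0" | "0 < x" "x \<le> 1" | "1 < x" by linarith
      then show "norm ((indicator {0..} x * density_fun q z x) *\<^sub>R x powr \<sigma>)
        \<le> norm (c * indicator {0..1} x + indicator {0..} x * density_fun q z x)"
      proof cases
        case 1
        then show ?thesis by (cases "x = 0") auto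
      next
        case 2
        have "density_fun q z x * x powr \<sigma> \<le> (c * x ^ k) * x powr \<sigma>"
          using 2 by (intro mult_right_mono c) auto
        also have "\<dots> = c * x powr (\<sigma> + real k)"
          using 2 by (simp add: powr_add powr_realpow)
        also have "\<dots> \<le> c * 1"
          using c(1) 2 k by (intro mult_left_mono powr_le1) auto
        finally have "density_fun q z x * x powr \<sigma> \<le> c" by simp
        then show ?thesis
          using 2 c(1) density_fun_nonneg[of x] by (simp add: abs_mult)
      next
        case 3
        have "density_fun q z x * x powr \<sigma> \<le> density_fun q z x * 1"
          using 3 False powr_mono[of \<sigma> 0 x] density_fun_nonneg[of x] by (intro mult_left_mono) auto
        then show ?thesis
          using 3 density_fun_nonneg[of x] by (simp add: abs_mult)
      qed
    qed
  qed simp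
qed

end

section \<open>The Mellin transform of the density\<close>

text \<open>Differentiation under the integral sign. With \<open>L = ln X\<close> and \<open>\<bar>w - s\<bar> < e\<close> the difference quotient
  of \<open>X\<^sup>s\<close> is at most \<open>X\<^sup>\<sigma> \<bar>L\<bar> exp (e \<bar>L\<bar>) \<le> X\<^sup>\<sigma> exp (2 e \<bar>L\<bar>) / e\<close> for \<open>\<sigma> = Re s\<close>, and
  \<open>exp (2 e \<bar>L\<bar>) \<le> X\<^sup>2\<^sup>e + X\<^sup>-\<^sup>2\<^sup>e\<close>.\<close>

lemma has_field_derivative_mellin:
  fixes X :: "'a \<Rightarrow> real"
  assumes [measurable]: "X \<in> borel_measurable M" and pos: "AE \<omega> in M. 0 < X \<omega>"
    and e: "0 < e"
    and int: "integrable M (\<lambda>\<omega>. X \<omega> powr (Re s + 2 * e))" "integrable M (\<lambda>\<omega>. X \<omega> powr (Re s - 2 * e))"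
    and int_all: "\<And>w. \<bar>Re w - Re s\<bar> < e \<Longrightarrow> integrable M (\<lambda>\<omega>. complex_of_real (X \<omega>) powr w)"
  shows "((\<lambda>s. \<integral>\<omega>. complex_of_real (X \<omega>) powr s \<partial>M) has_field_derivative
           (\<integral>\<omega>. of_real (ln (X \<omega>)) * complex_of_real (X \<omega>) powr s \<partial>M)) (at s)"
  unfolding has_field_derivative_iff tendsto_at_iff_sequentially
proof (intro allI impI)
  fix w :: "nat \<Rightarrow> complex" assume w: "\<forall>i. w i \<in> UNIV - {s}" "w \<longlonglongrightarrow> s"
  let ?f = "\<lambda>s. \<integral>\<omega>. complex_of_real (X \<omega>) powr s \<partial>M"
  let ?B = "\<lambda>\<omega>. (X \<omega> powr (Re s + 2 * e) + X \<omega> powr (Re s - 2 * e)) / e"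
  obtain N where N: "dist (w n) s < e" if "n \<ge> N" for n
    using w(2) e unfolding lim_sequentially by blast
  define v where "v i = w (i + N)" for i
  have v: "v i \<noteq> s" "dist (v i) s < e" "v \<longlonglongrightarrow> s" for i
    using w N unfolding v_def by (auto intro: LIMSEQ_ignore_initial_segment)
  have Re_v: "\<bar>Re (v i) - Re s\<bar> < e" for i
    using v(2)[of i] abs_Re_le_cmod[of "v i - s"] by (simp add: dist_norm)
  have "(\<lambda>i. \<integral>\<omega>. (complex_of_real (X \<omega>) powr v i - complex_of_real (X \<omega>) powr s) / (v i - s) \<partial>M)
      \<longlonglongrightarrow> (\<integral>\<omega>. of_real (ln (X \<omega>)) * complex_of_real (X \<omega>) powr s \<partial>M)"
  proof (rule integral_dominated_convergence)
    show "integrable M ?B"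
      using int by auto
    show "AE \<omega> in M. (\<lambda>i. (complex_of_real (X \<omega>) powr v i - complex_of_real (X \<omega>) powr s) / (v i - s))
        \<longlonglongrightarrow> of_real (ln (X \<omega>)) * complex_of_real (X \<omega>) powr s"
      using pos
    proof eventually_elim
      case (elim \<omega>)
      have "((\<lambda>u. complex_of_real (X \<omega>) powr u) has_field_derivative
          of_real (ln (X \<omega>)) * complex_of_real (X \<omega>) powr s) (at s)"
        using elim by (auto intro!: derivative_eq_intros simp: Ln_of_real)
      then have "((\<lambda>u. (complex_of_real (X \<omega>) powr u - complex_of_real (X \<omega>) powr s) / (u - s)) \<circ> v)
          \<longlonglongrightarrow> of_real (ln (X \<omega>)) * complex_of_real (X \<omega>) powr s"
        using v unfolding has_field_derivative_iff tendsto_at_iff_sequentially by blast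
      then show ?case by (simp add: o_def)
    qed
    show "AE \<omega> in M. norm ((complex_of_real (X \<omega>) powr v i - complex_of_real (X \<omega>) powr s) / (v i - s)) \<le> ?B \<omega>" for i
      using pos
    proof eventually_elim
      case (elim \<omega>)
      define L where "L = ln (X \<omega>)"
      define h where "h = v i - s"
      have h: "h \<noteq> 0" "norm h < e" using v by (auto simp: h_def dist_norm)
      have pw: "complex_of_real (X \<omega>) powr u = exp (u * of_real L)" for u
        using elim by (simp add: powr_def Ln_of_real L_def)
      have "complex_of_real (X \<omega>) powr v i - complex_of_real (X \<omega>) powr s
          = complex_of_real (X \<omega>) powr s * (exp (h * of_real L) - 1)"
        unfolding pw by (simp add: h_def algebra_simps flip: exp_add)
      then have "norm ((complex_of_real (X \<omega>) powr v i - complex_of_real (X \<omega>) powr s) / (v i - s))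
          = X \<omega> powr Re s * norm (exp (h * of_real L) - 1) / norm h"
        using elim by (simp add: norm_mult norm_divide norm_of_real_powr flip: h_def)
      also have "\<dots> \<le> X \<omega> powr Re s * (exp (e * \<bar>L\<bar>) * (norm h * \<bar>L\<bar>)) / norm h"
      proof (intro divide_right_mono mult_left_mono)
        have "norm (exp (h * of_real L) - 1) \<le> exp \<bar>Re (h * of_real L)\<bar> * norm (h * of_real L)"
          using Taylor_exp[of "h * of_real L" 0] by simp
        also have "\<dots> \<le> exp (e * \<bar>L\<bar>) * (norm h * \<bar>L\<bar>)"
        proof (intro mult_mono)
          have "\<bar>Re (h * of_real L)\<bar> \<le> norm h * \<bar>L\<bar>"
            using abs_Re_le_cmod[of "h * of_real L"] by (simp add: norm_mult)
          also have "\<dots> \<le> e * \<bar>L\<bar>"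
            using h by (intro mult_right_mono) auto
          finally show "exp \<bar>Re (h * of_real L)\<bar> \<le> exp (e * \<bar>L\<bar>)" by simp
        qed (auto simp: norm_mult)
        finally show "norm (exp (h * of_real L) - 1) \<le> exp (e * \<bar>L\<bar>) * (norm h * \<bar>L\<bar>)" .
      qed auto
      also have "\<dots> = X \<omega> powr Re s * exp (e * \<bar>L\<bar>) * (e * \<bar>L\<bar>) / e"
        using h e by simp
      also have "\<dots> \<le> X \<omega> powr Re s * exp (e * \<bar>L\<bar>) * exp (e * \<bar>L\<bar>) / e"
        using exp_ge_add_one_self[of "e * \<bar>L\<bar>"] e
        by (intro divide_right_mono mult_left_mono) (auto simp del: exp_ge_add_one_self)
      also have "\<dots> = X \<omega> powr Re s * exp (2 * e * \<bar>L\<bar>) / e"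
        by (simp add: mult.assoc flip: exp_add)
      also have "\<dots> \<le> ?B \<omega>"
      proof (intro divide_right_mono)
        have "X \<omega> powr Re s * exp (2 * e * \<bar>L\<bar>) = exp (Re s * L + 2 * e * \<bar>L\<bar>)"
          using elim by (simp add: powr_def L_def exp_add)
        also have "\<dots> \<le> exp ((Re s + 2 * e) * L) + exp ((Re s - 2 * e) * L)"
          by (cases "0 \<le> L") (auto simp: algebra_simps add_increasing add_increasing2)
        finally show "X \<omega> powr Re s * exp (2 * e * \<bar>L\<bar>) \<le> X \<omega> powr (Re s + 2 * e) + X \<omega> powr (Re s - 2 * e)"
          using elim by (simp add: powr_def L_def)
      qed (use e in auto)
      finally show ?case .
    qed
  qed measurable
  moreover have "(\<integral>\<omega>. (complex_of_real (X \<omega>) powr v i - complex_of_real (X \<omega>) powr s) / (v i - s) \<partial>M)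
      = (?f (v i) - ?f s) / (v i - s)" for i
    using int_all[OF Re_v[of i]] int_all[of s] e by simp
  ultimately have "(\<lambda>i. (?f (v i) - ?f s) / (v i - s))
      \<longlonglongrightarrow> (\<integral>\<omega>. of_real (ln (X \<omega>)) * complex_of_real (X \<omega>) powr s \<partial>M)"
    by (simp only:)
  then show "((\<lambda>y. (?f y - ?f s) / (y - s)) \<circ> w)
      \<longlonglongrightarrow> (\<integral>\<omega>. of_real (ln (X \<omega>)) * complex_of_real (X \<omega>) powr s \<partial>M)"
    unfolding v_def comp_def by (rule LIMSEQ_offset)
qed

lemma eventually_at_shift_not_nonpos_Int: "\<forall>\<^sub>F w in at (s::complex). 1 + w \<notin> \<int>\<^sub>\<le>\<^sub>0"
proof -
  have "closed (\<int>\<^sub>\<le>\<^sub>0 - {1 + s})"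
    by (rule closed_subset_Ints) (auto elim: nonpos_Ints_cases)
  then have "open (- (\<int>\<^sub>\<le>\<^sub>0 - {1 + s}))"
    by (rule open_Compl)
  then have "open ((\<lambda>w. 1 + w) -` (- (\<int>\<^sub>\<le>\<^sub>0 - {1 + s})))"
    by (rule open_vimage) (intro continuous_intros)
  then have "\<forall>\<^sub>F w in at s. w \<in> (\<lambda>w. 1 + w) -` (- (\<int>\<^sub>\<le>\<^sub>0 - {1 + s})) - {s}"
    by (rule eventually_at_in_open) auto
  then show ?thesis
    by eventually_elim auto
qed

context q_density
begin

definition mellin :: "complex \<Rightarrow> complex" where
  "mellin s = (\<integral>x. complex_of_real x powr s \<partial>law)"

lemma AE_law_pos: "AE x in law. 0 < x"
proof -
  have "AE x in lborel. x \<noteq> (0::real)"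
    by (rule AE_lborel_singleton)
  then show ?thesis
    unfolding law_def by (subst AE_density) (auto simp: indicator_def elim!: eventually_mono split: if_splits)
qed

lemma integrable_law_cpowr:
  assumes "z < q powr Re s"
  shows "integrable law (\<lambda>x. complex_of_real x powr s)"
proof (rule Bochner_Integration.integrable_bound[OF integrable_law_powr[OF assms]])
  show "AE x in law. norm (complex_of_real x powr s) \<le> norm (x powr Re s)"
    using AE_law_pos by eventually_elim (simp add: norm_of_real_powr)
qed simp

context
  fixes \<mu> :: real
  assumes \<mu>: "z = q powr \<mu>"
begin

lemma less_powr_iff: "z < q powr \<sigma> \<longleftrightarrow> \<sigma> < \<mu>"
  unfolding \<mu> using q_pos q_less_one by (simp add: powr_def mult_less_cancel_right)

lemma holomorphic_mellin: "mellin holomorphic_on {s. Re s < \<mu>}"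
proof (rule holomorphic_onI)
  fix s assume "s \<in> {s. Re s < \<mu>}"
  \<comment> \<open>small enough that \<open>Re s + 2 * e < \<mu>\<close>\<close>
  define e where "e = (\<mu> - Re s) / 4"
  have e: "0 < e" using \<open>s \<in> _\<close> by (simp add: e_def)
  have less: "Re s + 2 * e < \<mu>" "Re s - 2 * e < \<mu>" "Re s + e < \<mu>"
    using \<open>s \<in> _\<close> by (auto simp: e_def field_simps)
  have "(mellin has_field_derivative (\<integral>x. of_real (ln x) * complex_of_real x powr s \<partial>law)) (at s)"
    unfolding mellin_def[abs_def]
    by (rule has_field_derivative_mellin[where X = "\<lambda>x. x" and e = e])
      (use e less AE_law_pos in \<open>auto intro!: integrable_law_powr integrable_law_cpowr simp: less_powr_iff\<close>)
  then show "mellin field_differentiable at s within {s. Re s < \<mu>}"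
    using field_differentiable_at_within field_differentiable_def by blast
qed

lemma qpoch_inf_zq_nonzero:
  assumes "Re s < \<mu>"
  shows "qpoch_inf (of_real z * of_real q powr (- s)) (of_real q) \<noteq> (0::complex)"
proof (rule qpoch_inf_nonzero)
  have "z < q powr Re s" using assms by (simp add: less_powr_iff)
  then show "norm (complex_of_real z * of_real q powr (- s)) < 1"
    using z_pos q_pos by (simp add: norm_mult norm_divide norm_of_real_powr powr_minus field_simps)
qed

lemma holomorphic_qpoch_inf_comp:
  assumes "f holomorphic_on A"
  shows "(\<lambda>s. qpoch_inf (f s) (of_real q)) holomorphic_on A"
  using holomorphic_on_compose_gen[OF assms holomorphic_qpoch_inf] by (simp add: o_def)

text \<open>The identity theorem on the half plane. Multiplying by the entire function \<open>1 / \<Gamma>(1 + s)\<close> instead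
  of dividing makes both sides holomorphic without exceptional points.\<close>

lemma mellin_continuation:
  assumes "Re s < \<mu>"
  shows "rGamma (1 + s) * (mellin s * qpoch_inf (of_real z * of_real q powr (- s)) (of_real q))
    = of_real (qpoch_inf z q / qpoch_inf q q) * qpoch_inf (of_real q powr (1 + s)) (of_real q)"
proof (rule analytic_continuation_open[where
      f = "\<lambda>s. rGamma (1 + s) * (mellin s * qpoch_inf (of_real z * of_real q powr (- s)) (of_real q))"
      and g = "\<lambda>s. of_real (qpoch_inf z q / qpoch_inf q q) * qpoch_inf (of_real q powr (1 + s)) (of_real q)"
      and s = "{s. -1 < Re s \<and> Re s < \<mu>}" and s' = "{s. Re s < \<mu>}"])
  have "\<mu> > 0"
    using z_less_one less_powr_iff[of 0] q_pos by simp
  show "open {s. -1 < Re s \<and> Re s < \<mu>}"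
    by (intro open_Collect_conj open_Collect_less continuous_intros)
  show "{s. -1 < Re s \<and> Re s < \<mu>} \<noteq> {}"
    using \<open>\<mu> > 0\<close> by (auto intro!: exI[of _ 0])
  show "open {s. Re s < \<mu>}"
    by (intro open_Collect_less continuous_intros)
  show "connected {s. Re s < \<mu>}"
    by (intro convex_connected convex_halfspace_Re_lt)
  show "{s. -1 < Re s \<and> Re s < \<mu>} \<subseteq> {s. Re s < \<mu>}" by auto
  show "s \<in> {s. Re s < \<mu>}" using assms by simp
  show "(\<lambda>s. rGamma (1 + s) * (mellin s * qpoch_inf (of_real z * of_real q powr (- s)) (of_real q)))
      holomorphic_on {s. Re s < \<mu>}"
    by (intro holomorphic_intros holomorphic_mellin holomorphic_qpoch_inf_comp)
  show "(\<lambda>s. of_real (qpoch_inf z q / qpoch_inf q q) * qpoch_inf (of_real q powr (1 + s)) (of_real q))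
      holomorphic_on {s. Re s < \<mu>}"
    by (intro holomorphic_intros holomorphic_qpoch_inf_comp)
next
  fix w assume "w \<in> {s. -1 < Re s \<and> Re s < \<mu>}"
  then have w: "-1 < Re w" "Re w < \<mu>" by auto
  have "1 + w \<notin> \<int>\<^sub>\<le>\<^sub>0"
    using w(1) by (auto elim!: nonpos_Ints_cases simp: complex_eq_iff)
  then have "rGamma (1 + w) * Gamma (1 + w) = 1"
    by (simp add: rGamma_inverse_Gamma Gamma_eq_zero_iff)
  then show "rGamma (1 + w) * (mellin w * qpoch_inf (of_real z * of_real q powr (- w)) (of_real q))
      = of_real (qpoch_inf z q / qpoch_inf q q) * qpoch_inf (of_real q powr (1 + w)) (of_real q)"
    using mellin_law[of w] w qpoch_inf_zq_nonzero[OF w(2)]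
    by (simp add: mellin_def less_powr_iff)
qed

text \<open>At a pole of the Gamma function the product is still defined by the Mellin transform, which is
  continuous there; this evaluates the removable singularities.\<close>

lemma Gamma_qpoch_LIM:
  assumes "Re s < \<mu>"
  shows "(\<lambda>w. Gamma (1 + w) * qpoch_inf (of_real q powr (1 + w)) (of_real q)) \<midarrow>s\<rightarrow>
    of_real (qpoch_inf q q / qpoch_inf z q) * (mellin s * qpoch_inf (of_real z * of_real q powr (- s)) (of_real q))"
proof (rule Lim_transform_eventually)
  have half: "open {s. Re s < \<mu>}"
    by (intro open_Collect_less continuous_intros)
  have "(\<lambda>s. of_real (qpoch_inf q q / qpoch_inf z q) *
      (mellin s * qpoch_inf (of_real z * of_real q powr (- s)) (of_real q))) holomorphic_on {s. Re s < \<mu>}"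
    by (intro holomorphic_intros holomorphic_mellin holomorphic_qpoch_inf_comp)
  then have "isCont (\<lambda>s. of_real (qpoch_inf q q / qpoch_inf z q) *
      (mellin s * qpoch_inf (of_real z * of_real q powr (- s)) (of_real q))) s"
    using assms half by (intro continuous_on_interior[OF holomorphic_on_imp_continuous_on]) (auto simp: interior_open)
  then show "(\<lambda>s. of_real (qpoch_inf q q / qpoch_inf z q) *
      (mellin s * qpoch_inf (of_real z * of_real q powr (- s)) (of_real q))) \<midarrow>s\<rightarrow>
      of_real (qpoch_inf q q / qpoch_inf z q) *
      (mellin s * qpoch_inf (of_real z * of_real q powr (- s)) (of_real q))"
    by (simp add: isCont_def)
  have "\<forall>\<^sub>F w in at s. w \<in> {s. Re s < \<mu>}"
    using half assms by (intro eventually_at_in_open') auto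
  then show "\<forall>\<^sub>F w in at s. of_real (qpoch_inf q q / qpoch_inf z q) *
      (mellin w * qpoch_inf (of_real z * of_real q powr (- w)) (of_real q))
      = Gamma (1 + w) * qpoch_inf (of_real q powr (1 + w)) (of_real q)"
    using eventually_at_shift_not_nonpos_Int[of s]
  proof eventually_elim
    case (elim w)
    then have G: "Gamma (1 + w) * rGamma (1 + w) = 1"
      by (simp add: rGamma_inverse_Gamma Gamma_eq_zero_iff)
    have "of_real (qpoch_inf q q / qpoch_inf z q) * (Gamma (1 + w) * (rGamma (1 + w) *
        (mellin w * qpoch_inf (of_real z * of_real q powr (- w)) (of_real q))))
      = (of_real (qpoch_inf q q / qpoch_inf z q) * of_real (qpoch_inf z q / qpoch_inf q q)) *
        (Gamma (1 + w) * qpoch_inf (of_real q powr (1 + w)) (of_real q))"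
      using elim by (subst mellin_continuation) (auto simp: mult_ac)
    also have "of_real (qpoch_inf q q / qpoch_inf z q) * of_real (qpoch_inf z q / qpoch_inf q q) = (1 :: complex)"
      using qpoch_inf_pos[of z] qpoch_inf_pos[of q] q_pos z_pos q_less_one z_less_one by simp
    finally show ?case
      using G by (simp flip: mult.assoc)
  qed
qed

theorem mellin_eq_qpoch_form:
  assumes "Re s < \<mu>"
  shows "mellin s = mellin_qpoch_form q z s"
  unfolding mellin_qpoch_form_def remove_sings_eqI[OF Gamma_qpoch_LIM[OF assms]]
  using qpoch_inf_zq_nonzero[OF assms] qpoch_inf_pos[of z] qpoch_inf_pos[of q] q_pos z_pos q_less_one z_less_one
  by (simp add: qpoch_inf_of_real)

theorem qpoch_form_eq_qgamma_form:
  assumes "Re s < \<mu>"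
  shows "mellin_qpoch_form q z s = mellin_qgamma_form q \<mu> s"
proof -
  define P where "P = (complex_of_real (qpoch_inf q q))"
  have P: "qpoch_inf (of_real q) (of_real q) = P" "P \<noteq> 0"
    using qpoch_inf_pos[of q] q_pos q_less_one by (auto simp: P_def qpoch_inf_of_real)
  define c where "c = complex_of_real (1 - q)"
  have c: "c \<noteq> 0" "c \<notin> \<real>\<^sub>\<le>\<^sub>0"
    using q_less_one by (simp_all add: c_def complex_nonpos_Reals_iff)
  define K where "K = (\<lambda>w. Gamma (1 + w) * qpoch_inf (complex_of_real q powr (1 + w)) (of_real q))"
  obtain l where l: "K \<midarrow>s\<rightarrow> l"
    unfolding K_def using Gamma_qpoch_LIM[OF assms] by blast
  have K_eq: "(\<lambda>w. Gamma (1 + w) / q_gamma q (1 + w)) = (\<lambda>w. K w * c powr w / P)"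
  proof
    fix w
    have "c powr (1 - (1 + w)) = 1 / c powr w"
      by (simp add: powr_minus_divide)
    then show "Gamma (1 + w) / q_gamma q (1 + w) = K w * c powr w / P"
      unfolding q_gamma_def c_def[symmetric] P(1) K_def by simp
  qed
  have "(\<lambda>w. K w * c powr w / P) \<midarrow>s\<rightarrow> l * c powr s / P"
    using c P by (intro tendsto_intros l) auto
  then have lim: "remove_sings (\<lambda>w. Gamma (1 + w) / q_gamma q (1 + w)) s = l * c powr s / P"
    unfolding K_eq by (rule remove_sings_eqI)
  have zq: "of_real q powr (of_real \<mu> - s) = of_real z * of_real q powr (- s)"
    using q_pos unfolding \<mu> by (simp add: powr_diff powr_minus powr_of_real field_simps)
  have z: "of_real q powr of_real \<mu> = complex_of_real z"
    using q_pos unfolding \<mu> by (simp add: powr_of_real)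
  have "c powr (1 - (of_real \<mu> - s)) = c powr (1 - of_real \<mu>) * c powr s"
    unfolding powr_add[symmetric] by (simp add: algebra_simps)
  then have ratio: "q_gamma q (of_real \<mu> - s) / q_gamma q (of_real \<mu>)
      = c powr s * (qpoch_inf (of_real z) (of_real q) / qpoch_inf (of_real z * of_real q powr (- s)) (of_real q))"
    unfolding q_gamma_def zq z c_def[symmetric] P(1) using c P by simp
  have "c powr (- 2 * s) * (c powr s * c powr s) = 1"
    using c unfolding powr_add[symmetric] by simp
  then show ?thesis
    unfolding mellin_qpoch_form_def mellin_qgamma_form_def lim ratio K_def[symmetric] remove_sings_eqI[OF l] P(1) c_def[symmetric]
    by (simp add: mult_ac)
qed

end

end

section \<open>Discrete walks and Riemann sums\<close>

text \<open>On countable types the product measure is discrete, so Fubini's theorem for product measures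
  applies to vector-valued integrands.\<close>

lemma integral_pair_pmf:
  fixes f :: "'a::countable \<times> 'b::countable \<Rightarrow> 'c::{banach, second_countable_topology}"
  assumes "integrable (measure_pmf (pair_pmf A B)) f"
  shows "(\<integral>x. f x \<partial>measure_pmf (pair_pmf A B)) = (\<integral>a. \<integral>b. f (a, b) \<partial>measure_pmf B \<partial>measure_pmf A)"
proof -
  interpret pair_sigma_finite "measure_pmf A" "measure_pmf B" ..
  have "measure_pmf (pair_pmf A B) = measure_pmf A \<Otimes>\<^sub>M measure_pmf B"
  proof (rule measure_eqI_countable)
    show "sets (measure_pmf A \<Otimes>\<^sub>M measure_pmf B) = Pow UNIV"
    proof -
      have "sets (measure_pmf A \<Otimes>\<^sub>M measure_pmf B) = sets (count_space UNIV \<Otimes>\<^sub>M count_space UNIV)"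
        by (intro sets_pair_measure_cong) auto
      also have "count_space UNIV \<Otimes>\<^sub>M count_space UNIV = count_space (UNIV \<times> UNIV :: ('a \<times> 'b) set)"
        by (intro pair_measure_countable) auto
      finally show ?thesis by simp
    qed
    fix x :: "'a \<times> 'b"
    obtain a b where x: "x = (a, b)" by (cases x)
    have "emeasure (measure_pmf A \<Otimes>\<^sub>M measure_pmf B) ({a} \<times> {b}) = emeasure (measure_pmf A) {a} * emeasure (measure_pmf B) {b}"
      by (intro measure_pmf.emeasure_pair_measure_Times) auto
    then show "emeasure (measure_pmf (pair_pmf A B)) {x} = emeasure (measure_pmf A \<Otimes>\<^sub>M measure_pmf B) {x}"
      by (simp add: x emeasure_pmf_single pmf_pair ennreal_mult)
  qed auto
  then show ?thesis
    using assms integral_fst'[of f] by simp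
qed

lemma replicate_pmf_Suc_pair: "replicate_pmf (Suc n) p = map_pmf (\<lambda>(x, xs). x # xs) (pair_pmf p (replicate_pmf n p))"
  by (simp add: map_pmf_def pair_pmf_def bind_assoc_pmf bind_return_pmf)

lemma pmf_replicate_pmf: "pmf (replicate_pmf (length xs) p) xs = (\<Prod>k<length xs. pmf p (xs ! k))"
proof (induction xs)
  case (Cons x xs)
  have "inj (\<lambda>(x :: 'a, xs). x # xs)"
    by (auto simp: inj_def)
  then have "pmf (replicate_pmf (length (x # xs)) p) (x # xs) = pmf (pair_pmf p (replicate_pmf (length xs) p)) (x, xs)"
    using pmf_map_inj'[of "\<lambda>(x, xs). x # xs" "pair_pmf p (replicate_pmf (length xs) p)" "(x, xs)"]
    unfolding list.size add_Suc_right add_0_right replicate_pmf_Suc_pair by simp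
  then show ?case
    unfolding pmf_pair Cons.IH by (simp add: prod.lessThan_Suc_shift del: prod.lessThan_Suc)
qed simp

text \<open>For steps \<open>\<xi>\<^sub>i\<close> the value is \<open>\<Sum>k. q\<^sup>\<xi>\<^sup>1\<^sup>+\<^sup>\<dots>\<^sup>+\<^sup>\<xi>\<^sup>k\<close>. The nested form exhibits the renewal at the first
  step, and it matches the recursion of \<open>replicate_pmf\<close>.\<close>

fun walk_sum :: "real \<Rightarrow> (nat \<times> nat) list \<Rightarrow> real" where
  "walk_sum q [] = 0"
| "walk_sum q (x # xs) = q powi (int (fst x) - int (snd x)) * (1 + walk_sum q xs)"

definition walk_char :: "real \<Rightarrow> real \<Rightarrow> (nat \<times> nat) pmf \<Rightarrow> nat \<Rightarrow> real \<Rightarrow> complex" where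
  "walk_char q h D N t = (\<integral>xs. iexp (t * (h * walk_sum q xs)) \<partial>measure_pmf (replicate_pmf N D))"

lemma integrable_measure_pmf_bounded:
  fixes f :: "'a \<Rightarrow> 'b::{banach, second_countable_topology}"
  assumes "\<And>x. norm (f x) \<le> B"
  shows "integrable (measure_pmf p) f"
  by (rule measure_pmf.integrable_const_bound[where B = B]) (use assms in auto)

lemma walk_char_Suc:
  "walk_char q h D (Suc N) t
    = (\<integral>x. iexp (t * (h * q powi (int (fst x) - int (snd x)))) *
            walk_char q h D N (q powi (int (fst x) - int (snd x)) * t) \<partial>measure_pmf D)"
proof -
  let ?j = "\<lambda>x :: nat \<times> nat. q powi (int (fst x) - int (snd x))"
  have "walk_char q h D (Suc N) t
      = (\<integral>p. iexp (t * (h * (?j (fst p) * (1 + walk_sum q (snd p))))) \<partial>measure_pmf (pair_pmf D (replicate_pmf N D)))"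
    unfolding walk_char_def replicate_pmf_Suc_pair integral_map_pmf
    by (intro Bochner_Integration.integral_cong) auto
  also have "\<dots> = (\<integral>x. \<integral>xs. iexp (t * (h * (?j x * (1 + walk_sum q xs)))) \<partial>measure_pmf (replicate_pmf N D) \<partial>measure_pmf D)"
  proof (subst integral_pair_pmf)
    show "integrable (measure_pmf (pair_pmf D (replicate_pmf N D)))
        (\<lambda>p. iexp (t * (h * (?j (fst p) * (1 + walk_sum q (snd p))))))"
      by (rule integrable_measure_pmf_bounded[where B = 1]) (simp only: norm_exp_i_times order_refl)
  qed simp
  also have "\<dots> = (\<integral>x. iexp (t * (h * ?j x)) * walk_char q h D N (?j x * t) \<partial>measure_pmf D)"
  proof (rule Bochner_Integration.integral_cong)
    fix x
    have "iexp (t * (h * (?j x * (1 + walk_sum q xs))))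
        = iexp (t * (h * ?j x)) * iexp (?j x * t * (h * walk_sum q xs))" for xs
      by (simp add: algebra_simps flip: exp_add)
    then show "(\<integral>xs. iexp (t * (h * (?j x * (1 + walk_sum q xs)))) \<partial>measure_pmf (replicate_pmf N D))
        = iexp (t * (h * ?j x)) * walk_char q h D N (?j x * t)"
      unfolding walk_char_def by simp
  qed simp
  finally show ?thesis .
qed

lemma norm_integral_pmf_le:
  fixes f :: "'a \<Rightarrow> 'b::{banach, second_countable_topology}"
  assumes "\<And>x. norm (f x) \<le> B * indicator A x"
  shows "norm (\<integral>x. f x \<partial>measure_pmf p) \<le> B * measure (measure_pmf p) A"
proof -
  have "norm (\<integral>x. f x \<partial>measure_pmf p) \<le> (\<integral>x. B * indicator A x \<partial>measure_pmf p)"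
  proof -
    have int: "integrable (measure_pmf p) f"
    proof (rule integrable_measure_pmf_bounded)
      show "norm (f x) \<le> \<bar>B\<bar>" for x
        using assms[of x] by (cases "x \<in> A") (auto intro: order_trans[OF _ abs_ge_self])
    qed
    have "norm (\<integral>x. f x \<partial>measure_pmf p) \<le> (\<integral>x. norm (f x) \<partial>measure_pmf p)"
      by (rule integral_norm_bound)
    also have "\<dots> \<le> (\<integral>x. B * indicator A x \<partial>measure_pmf p)"
    proof (rule integral_mono)
      show "integrable (measure_pmf p) (\<lambda>x. B * indicator A x)"
        by (rule integrable_measure_pmf_bounded[where B = "\<bar>B\<bar>"]) (auto simp: indicator_def)
    qed (use int assms in auto)
    finally show ?thesis .
  qed
  then show ?thesis by simp
qed

lemma LIMSEQ_exp_difference: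
  fixes w :: complex
  shows "(\<lambda>n. of_nat (Suc n) * (1 - exp (w / of_nat (Suc n)))) \<longlonglongrightarrow> - w"
proof -
  have "((\<lambda>x. exp (w * x)) has_field_derivative w) (at 0)"
    by (auto intro!: derivative_eq_intros)
  then have "((\<lambda>x. (exp (w * x) - 1) / x) \<longlongrightarrow> w) (at 0)"
    by (simp add: has_field_derivative_iff)
  moreover have "filterlim (\<lambda>n. 1 / of_nat (Suc n) :: complex) (at 0) sequentially"
    unfolding filterlim_at using LIMSEQ_Suc[OF lim_1_over_n] by (auto simp del: of_nat_Suc)
  ultimately have "(\<lambda>n. (exp (w * (1 / of_nat (Suc n))) - 1) / (1 / of_nat (Suc n))) \<longlonglongrightarrow> w"
    by (rule filterlim_compose)
  then have "(\<lambda>n. - ((exp (w * (1 / of_nat (Suc n))) - 1) / (1 / of_nat (Suc n)))) \<longlonglongrightarrow> - w"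
    by (rule tendsto_minus)
  then show ?thesis by (simp add: algebra_simps)
qed

text \<open>With probability \<open>1 - O(1/n\<^sup>2)\<close> at most one of the two processes jumps in a step of length \<open>1/n\<close>,
  and then at most once. Those three outcomes have the probabilities \<open>e\<^sub>n\<close>, \<open>e\<^sub>n / n\<close> and \<open>e\<^sub>n z / n\<close>
  with \<open>e\<^sub>n = exp (- (1 + z) / n)\<close>. Moving the first outcome to the left of the fixed point equation
  leaves the factor \<open>1 - exp ((- (1 + z) + \<i> t) / n)\<close>; multiplication by \<open>n\<close> gives the equation in
  the limit.\<close>

lemma q_difference_limit:
  fixes u :: "nat \<Rightarrow> real \<Rightarrow> complex" and \<phi> :: "real \<Rightarrow> complex"
  assumes z: "0 < z"
    and lim: "\<And>t. (\<lambda>n. u n t) \<longlonglongrightarrow> \<phi> t" and bounded: "\<And>n t. norm (u n t) \<le> 1"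
    and fixpoint: "\<And>n t. u n t = (\<integral>x. iexp (t * (1 / Suc n * q powi (int (fst x) - int (snd x)))) *
        u n (q powi (int (fst x) - int (snd x)) * t)
        \<partial>measure_pmf (pair_pmf (poisson_pmf (1 / Suc n)) (poisson_pmf (z / Suc n))))"
  shows "(1 + of_real z - \<i> * of_real t) * \<phi> t = \<phi> (q * t) + of_real z * \<phi> (t / q)"
proof -
  define D where "D n = pair_pmf (poisson_pmf (1 / Suc n)) (poisson_pmf (z / Suc n))" for n
  define G where "G n x = iexp (t * (1 / Suc n * q powi (int (fst x) - int (snd x)))) *
        u n (q powi (int (fst x) - int (snd x)) * t)" for n and x :: "nat \<times> nat"
  \<comment> \<open>no jump, one jump of the first process, one jump of the second process\<close>
  define A :: "(nat \<times> nat) set" where "A = {(0, 0), (1, 0), (0, 1)}"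
  define e where "e n = exp (- (1 + z) / Suc n)" for n
  have pmfs: "pmf (D n) (0, 0) = e n" "pmf (D n) (1, 0) = e n * (1 / Suc n)"
    "pmf (D n) (0, 1) = e n * (z / Suc n)" for n
    using z by (simp_all add: D_def pmf_pair e_def exp_add[symmetric] add_divide_distrib diff_divide_distrib)
  have normG: "norm (G n x) \<le> 1" for n x
    unfolding G_def norm_mult norm_exp_i_times by (simp add: bounded)
  define r where "r n = (\<integral>x. indicator (- A) x *\<^sub>R G n x \<partial>measure_pmf (D n))" for n
  have split: "u n t = (e n *\<^sub>R G n (0, 0) + (e n * (1 / Suc n)) *\<^sub>R G n (1, 0) + (e n * (z / Suc n)) *\<^sub>R G n (0, 1)) + r n" for n
  proof -
    have "u n t = (\<integral>x. G n x \<partial>measure_pmf (D n))"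
      unfolding G_def D_def by (rule fixpoint)
    also have "\<dots> = (\<integral>x. indicator A x *\<^sub>R G n x + indicator (- A) x *\<^sub>R G n x \<partial>measure_pmf (D n))"
      by (intro Bochner_Integration.integral_cong) (auto simp: indicator_def)
    also have "\<dots> = (\<integral>x. indicator A x *\<^sub>R G n x \<partial>measure_pmf (D n)) + r n"
      unfolding r_def
      by (intro Bochner_Integration.integral_add integrable_measure_pmf_bounded[where B = 1])
        (auto simp: indicator_def normG)
    also have "(\<integral>x. indicator A x *\<^sub>R G n x \<partial>measure_pmf (D n)) = (\<Sum>a\<in>A. pmf (D n) a *\<^sub>R indicator A a *\<^sub>R G n a)"
      by (rule integral_measure_pmf) (auto simp: A_def indicator_def split: if_splits)
    also have "\<dots> = e n *\<^sub>R G n (0, 0) + (e n * (1 / Suc n)) *\<^sub>R G n (1, 0) + (e n * (z / Suc n)) *\<^sub>R G n (0, 1)"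
      by (simp add: A_def pmfs[unfolded One_nat_def])
    finally show ?thesis .
  qed
  have r_bound: "norm (of_nat (Suc n) * r n) \<le> Suc n * (1 - e n * (1 + (1 + z) / Suc n))" for n
  proof -
    have "norm (r n) \<le> 1 * measure (measure_pmf (D n)) (- A)"
      unfolding r_def by (rule norm_integral_pmf_le) (auto simp: indicator_def normG)
    also have "measure (measure_pmf (D n)) (- A) = 1 - measure (measure_pmf (D n)) A"
      using measure_pmf.prob_compl[of A "D n"] by (simp add: Compl_eq_Diff_UNIV)
    also have "measure (measure_pmf (D n)) A = e n * (1 + (1 + z) / Suc n)"
      by (subst measure_measure_pmf_finite)
        (simp_all add: A_def pmfs[unfolded One_nat_def] algebra_simps add_divide_distrib)
    finally show ?thesis
      unfolding norm_mult norm_of_nat by (intro mult_left_mono) auto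
  qed
  have r_lim: "(\<lambda>n. of_nat (Suc n) * r n) \<longlonglongrightarrow> 0"
  proof (rule Lim_null_comparison)
    show "\<forall>\<^sub>F n in sequentially. norm (of_nat (Suc n) * r n) \<le> Suc n * (1 - e n * (1 + (1 + z) / Suc n))"
      using r_bound by simp
    have "(\<lambda>n. real (Suc n) * (1 - exp (- c / real (Suc n)) * (1 + c / real (Suc n)))) \<longlonglongrightarrow> 0" for c
      by real_asymp
    from this[of "1 + z"] show "(\<lambda>n. Suc n * (1 - e n * (1 + (1 + z) / Suc n))) \<longlonglongrightarrow> 0"
      by (simp add: e_def)
  qed
  define w where "w = - (1 + of_real z) + \<i> * of_real t"
  have G00: "G n (0, 0) = iexp (t / Suc n) * u n t" for n
    by (simp add: G_def)
  have e_exp: "e n *\<^sub>R iexp (t / Suc n) = exp (w / of_nat (Suc n))" for n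
    unfolding scaleR_conv_of_real e_def w_def exp_of_real[symmetric] exp_add[symmetric]
    by (simp add: add_divide_distrib diff_divide_distrib)
  have eq: "of_nat (Suc n) * (1 - exp (w / of_nat (Suc n))) * u n t
      = of_real (e n) * G n (1, 0) + of_real (e n) * of_real z * G n (0, 1) + of_nat (Suc n) * r n" for n
  proof -
    have "e n *\<^sub>R G n (0, 0) = exp (w / of_nat (Suc n)) * u n t"
      unfolding G00 e_exp[symmetric] by simp
    then have "(1 - exp (w / of_nat (Suc n))) * u n t = u n t - e n *\<^sub>R G n (0, 0)"
      by (simp only: left_diff_distrib mult_1_left)
    also have "\<dots> = (e n * (1 / Suc n)) *\<^sub>R G n (1, 0) + (e n * (z / Suc n)) *\<^sub>R G n (0, 1) + r n"
      by (subst split) simp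
    finally have "of_nat (Suc n) * (1 - exp (w / of_nat (Suc n))) * u n t
        = of_nat (Suc n) * ((e n * (1 / Suc n)) *\<^sub>R G n (1, 0) + (e n * (z / Suc n)) *\<^sub>R G n (0, 1) + r n)"
      by (simp only: mult.assoc)
    also have "\<dots> = of_real (e n) * G n (1, 0) + of_real (e n) * of_real z * G n (0, 1) + of_nat (Suc n) * r n"
      by (simp add: scaleR_conv_of_real distrib_left del: of_nat_Suc)
    finally show ?thesis .
  qed
  have e_lim: "(\<lambda>n. complex_of_real (e n)) \<longlonglongrightarrow> of_real 1"
  proof (rule tendsto_of_real)
    have "(\<lambda>n. exp (- c / real (Suc n))) \<longlonglongrightarrow> 1" for c :: real
      by real_asymp
    from this[of "1 + z"] show "e \<longlonglongrightarrow> 1"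
      by (simp add: e_def[abs_def])
  qed
  have iexp_lim: "(\<lambda>n. iexp (t * (1 / Suc n * c))) \<longlonglongrightarrow> 1" for c
  proof -
    have "(\<lambda>n. t * (1 / real (Suc n) * c)) \<longlonglongrightarrow> 0"
      by real_asymp
    then have "(\<lambda>n. iexp (t * (1 / Suc n * c))) \<longlonglongrightarrow> iexp 0"
      by (intro tendsto_intros) simp
    then show ?thesis by simp
  qed
  have "G n (1, 0) = iexp (t * (1 / Suc n * q)) * u n (q * t)" for n
    by (simp add: G_def)
  then have G10: "(\<lambda>n. G n (1, 0)) \<longlonglongrightarrow> 1 * \<phi> (q * t)"
    by (simp only:) (intro tendsto_mult iexp_lim lim)
  have "G n (0, 1) = iexp (t * (1 / Suc n * (1 / q))) * u n (t / q)" for n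
    by (simp add: G_def power_int_minus divide_inverse mult.commute)
  then have G01: "(\<lambda>n. G n (0, 1)) \<longlonglongrightarrow> 1 * \<phi> (t / q)"
    by (simp only:) (intro tendsto_mult iexp_lim lim)
  have "(\<lambda>n. of_nat (Suc n) * (1 - exp (w / of_nat (Suc n))) * u n t)
      \<longlonglongrightarrow> of_real 1 * (1 * \<phi> (q * t)) + of_real 1 * of_real z * (1 * \<phi> (t / q)) + 0"
    unfolding eq by (intro tendsto_intros e_lim G10 G01 r_lim)
  moreover have "(\<lambda>n. of_nat (Suc n) * (1 - exp (w / of_nat (Suc n))) * u n t) \<longlonglongrightarrow> (- w) * \<phi> t"
    by (intro tendsto_mult LIMSEQ_exp_difference lim)
  ultimately have "(- w) * \<phi> t = \<phi> (q * t) + of_real z * \<phi> (t / q)"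
    using LIMSEQ_unique by fastforce
  moreover have "- w = 1 + of_real z - \<i> * of_real t"
    by (simp add: w_def algebra_simps)
  ultimately show ?thesis by simp
qed

lemma nn_integral_step_function:
  fixes c :: "nat \<Rightarrow> real"
  assumes c: "\<And>k. 0 \<le> c k" and h: "0 < h"
  shows "(\<integral>\<^sup>+s. ennreal (indicator {0..} s * c (nat \<lfloor>s / h\<rfloor>)) \<partial>lborel) = (\<Sum>k. ennreal (h * c k))"
proof -
  define I where "I k = {real k * h..<(real k + 1) * h}" for k
  have mem: "s \<in> I k \<longleftrightarrow> 0 \<le> s \<and> nat \<lfloor>s / h\<rfloor> = k" for s k
  proof -
    have "s \<in> I k \<longleftrightarrow> real k \<le> s / h \<and> s / h < real k + 1"
      using h by (auto simp: I_def field_simps)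
    also have "\<dots> \<longleftrightarrow> \<lfloor>s / h\<rfloor> = int k"
      by (auto simp: floor_eq_iff)
    also have "\<dots> \<longleftrightarrow> 0 \<le> s \<and> nat \<lfloor>s / h\<rfloor> = k"
      using h by (auto simp: zero_le_divide_iff intro: order.strict_implies_order) (metis floor_less_zero h linorder_not_less nat_int of_nat_0_le_iff zero_le_divide_iff zero_le_floor)+
    finally show ?thesis .
  qed
  have "ennreal (indicator {0..} s * c (nat \<lfloor>s / h\<rfloor>)) = (\<Sum>k. ennreal (c k) * indicator (I k) s)" for s
  proof -
    have "(\<Sum>k. ennreal (c k) * indicator (I k) s) = (\<Sum>k\<in>{nat \<lfloor>s / h\<rfloor>}. ennreal (c k) * indicator (I k) s)"
      by (rule suminf_finite) (auto simp: indicator_def mem)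
    then show ?thesis
      by (auto simp: indicator_def mem)
  qed
  then have "(\<integral>\<^sup>+s. ennreal (indicator {0..} s * c (nat \<lfloor>s / h\<rfloor>)) \<partial>lborel)
      = (\<integral>\<^sup>+s. (\<Sum>k. ennreal (c k) * indicator (I k) s) \<partial>lborel)"
    by simp
  also have "\<dots> = (\<Sum>k. \<integral>\<^sup>+s. ennreal (c k) * indicator (I k) s \<partial>lborel)"
    by (rule nn_integral_suminf) (simp add: I_def)
  also have "\<dots> = (\<Sum>k. ennreal (h * c k))"
  proof (rule suminf_cong)
    fix k
    have "emeasure lborel (I k) = ennreal h"
      using h by (simp add: I_def algebra_simps)
    then show "(\<integral>\<^sup>+s. ennreal (c k) * indicator (I k) s \<partial>lborel) = ennreal (h * c k)"
      using c h by (subst nn_integral_cmult_indicator) (auto simp: I_def ennreal_mult mult.commute)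
  qed
  finally show ?thesis .
qed

lemma has_bochner_integral_step_function:
  fixes c :: "nat \<Rightarrow> real"
  assumes "\<And>k. 0 \<le> c k" "0 < h" "summable c"
  shows "has_bochner_integral lborel (\<lambda>s. indicator {0..} s * c (nat \<lfloor>s / h\<rfloor>)) (h * suminf c)"
proof (rule has_bochner_integral_nn_integral)
  have "(\<Sum>k. ennreal (h * c k)) = ennreal (\<Sum>k. h * c k)"
    using assms by (intro suminf_ennreal2 summable_mult) auto
  then show "(\<integral>\<^sup>+s. ennreal (indicator {0..} s * c (nat \<lfloor>s / h\<rfloor>)) \<partial>lborel) = ennreal (h * suminf c)"
    using assms by (subst nn_integral_step_function) (auto simp: suminf_mult)
qed (use assms suminf_nonneg[of c] in auto)

text \<open>The first grid point strictly to the right of \<open>s\<close>: approaching \<open>s\<close> from the right, it suits paths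
  that are only right-continuous.\<close>

lemma grid_point_bounds:
  fixes s :: real
  assumes "0 \<le> s"
  shows "s < real (Suc (nat \<lfloor>s / (1 / real (Suc n))\<rfloor>)) / real (Suc n)"
    and "real (Suc (nat \<lfloor>s / (1 / real (Suc n))\<rfloor>)) / real (Suc n) \<le> s + 1 / real (Suc n)"
proof -
  define y where "y = s * real (Suc n)"
  have y: "0 \<le> y" "s = y / real (Suc n)" using assms by (simp_all add: y_def)
  have k: "real (Suc (nat \<lfloor>y\<rfloor>)) = of_int \<lfloor>y\<rfloor> + 1"
    using y by (simp add: of_nat_nat)
  have "s / (1 / real (Suc n)) = y" by (simp add: y_def)
  moreover have "y / real (Suc n) < (of_int \<lfloor>y\<rfloor> + 1) / real (Suc n)"
    by (intro divide_strict_right_mono) linarith+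
  moreover have "(of_int \<lfloor>y\<rfloor> + 1) / real (Suc n) \<le> (y + 1) / real (Suc n)"
    by (intro divide_right_mono) linarith+
  ultimately show "s < real (Suc (nat \<lfloor>s / (1 / real (Suc n))\<rfloor>)) / real (Suc n)"
    "real (Suc (nat \<lfloor>s / (1 / real (Suc n))\<rfloor>)) / real (Suc n) \<le> s + 1 / real (Suc n)"
    unfolding y(2) by (simp_all add: k add_divide_distrib del: of_nat_Suc)
qed

lemma right_limit_along_grid:
  fixes s :: real
  assumes "0 \<le> s" and "(g \<longlongrightarrow> l) (at_right s)"
  shows "(\<lambda>n. g (real (Suc (nat \<lfloor>s / (1 / real (Suc n))\<rfloor>)) / real (Suc n))) \<longlonglongrightarrow> l"
proof (rule filterlim_compose[OF assms(2)])
  show "filterlim (\<lambda>n. real (Suc (nat \<lfloor>s / (1 / real (Suc n))\<rfloor>)) / real (Suc n)) (at_right s) sequentially"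
    unfolding filterlim_at
  proof
    show "\<forall>\<^sub>F n in sequentially. real (Suc (nat \<lfloor>s / (1 / real (Suc n))\<rfloor>)) / real (Suc n) \<in> {s<..} \<and>
        real (Suc (nat \<lfloor>s / (1 / real (Suc n))\<rfloor>)) / real (Suc n) \<noteq> s"
      using grid_point_bounds(1)[OF assms(1)] by (intro always_eventually) (metis greaterThan_iff less_irrefl)
    show "(\<lambda>n. real (Suc (nat \<lfloor>s / (1 / real (Suc n))\<rfloor>)) / real (Suc n)) \<longlonglongrightarrow> s"
    proof (rule tendsto_sandwich)
      show "(\<lambda>n. s) \<longlonglongrightarrow> s" by simp
      show "(\<lambda>n. s + 1 / real (Suc n)) \<longlonglongrightarrow> s" by real_asymp
    qed (use grid_point_bounds[OF assms(1)] in \<open>auto intro!: always_eventually less_imp_le simp del: of_nat_Suc\<close>)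
  qed
qed

text \<open>The Riemann sum is the integral of a step function that equals at \<open>s\<close> the value of \<open>g\<close> at the next
  grid point. It converges pointwise by right-continuity and is dominated by the step function with
  the values \<open>c k\<close>, since the grid point is at distance at most \<open>1\<close>.\<close>

lemma right_continuous_riemann_sums:
  fixes g :: "real \<Rightarrow> real" and c :: "nat \<Rightarrow> real"
  assumes nonneg: "\<And>s. 0 \<le> s \<Longrightarrow> 0 \<le> g s"
    and bound: "\<And>s u. 0 \<le> s \<Longrightarrow> s \<le> u \<Longrightarrow> u \<le> s + 1 \<Longrightarrow> g u \<le> c (nat \<lfloor>s\<rfloor>)"
    and cont: "\<And>s. 0 \<le> s \<Longrightarrow> (g \<longlongrightarrow> g s) (at_right s)"
    and c: "summable c"
  shows "set_integrable lborel {0..} g"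
    and "summable (\<lambda>k. g (real (Suc k) / real (Suc n)))"
    and "(\<lambda>n. 1 / real (Suc n) * (\<Sum>k. g (real (Suc k) / real (Suc n)))) \<longlonglongrightarrow> (LINT s:{0..}|lborel. g s)"
proof -
  have c_nonneg: "0 \<le> c k" for k
    using bound[of "real k" "real k"] nonneg[of "real k"] by simp
  define d where "d n k = g (real (Suc k) / real (Suc n))" for n k
  define f where "f n s = indicator {0..} s * d n (nat \<lfloor>s / (1 / real (Suc n))\<rfloor>)" for n and s :: real
  have d_nonneg: "0 \<le> d n k" for n k
    by (simp add: d_def nonneg)
  have meas [measurable]: "f n \<in> borel_measurable borel" for n
    unfolding f_def by measurable
  have lim: "(\<lambda>n. f n s) \<longlonglongrightarrow> indicator {0..} s * g s" for s
  proof (cases "0 \<le> s")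
    case True
    from right_limit_along_grid[OF True cont[OF True]] show ?thesis
      using True by (simp add: f_def d_def)
  qed (simp add: f_def)
  have f_bound: "norm (f n s) \<le> indicator {0..} s * c (nat \<lfloor>s / 1\<rfloor>)" for n s
  proof (cases "0 \<le> s")
    case True
    have "1 / real (Suc n) \<le> 1" by simp
    then have "real (Suc (nat \<lfloor>s / (1 / real (Suc n))\<rfloor>)) / real (Suc n) \<le> s + 1"
      using grid_point_bounds(2)[OF True, of n] by linarith
    then have "d n (nat \<lfloor>s / (1 / real (Suc n))\<rfloor>) \<le> c (nat \<lfloor>s\<rfloor>)"
      unfolding d_def using grid_point_bounds(1)[OF True, of n] True by (intro bound) auto
    then have "f n s \<le> c (nat \<lfloor>s\<rfloor>)"
      using True by (simp add: f_def)
    moreover have "0 \<le> f n s"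
      using True d_nonneg by (simp add: f_def)
    ultimately show ?thesis using True by simp
  qed (simp add: f_def)
  have int_c: "integrable lborel (\<lambda>s::real. indicator {0..} s * c (nat \<lfloor>s / 1\<rfloor>))"
    using has_bochner_integral_step_function[OF c_nonneg zero_less_one c] by (rule integrable.intros)
  have meas_lim: "(\<lambda>s. indicator {0..} s * g s) \<in> borel_measurable lborel"
    by (rule borel_measurable_LIMSEQ_metric[OF _ lim]) (use meas in simp)
  have meas': "f n \<in> borel_measurable lborel" for n using meas by simp
  have int_f: "integrable lborel (f n)" for n
    by (rule Bochner_Integration.integrable_bound[OF int_c meas'])
      (use f_bound c_nonneg in \<open>auto intro!: AE_I2 order_trans[OF f_bound]\<close>)
  have int_g: "integrable lborel (\<lambda>s. indicator {0..} s * g s)"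
    by (rule integrable_dominated_convergence[where s = f, OF meas_lim meas' int_c]) (use lim f_bound in auto)
  show "set_integrable lborel {0..} g"
    using int_g by (simp add: set_integrable_def)
  have sm: "summable (d n)" for n
  proof -
    have "(\<Sum>k. ennreal (1 / real (Suc n) * d n k)) = (\<integral>\<^sup>+s. ennreal (f n s) \<partial>lborel)"
      unfolding f_def by (rule nn_integral_step_function[symmetric]) (auto simp: d_nonneg)
    also have "\<dots> < \<infinity>"
      using int_f[of n] d_nonneg by (subst nn_integral_eq_integral) (auto simp: f_def)
    finally have "summable (\<lambda>k. 1 / real (Suc n) * d n k)"
      using d_nonneg by (intro summable_suminf_not_top) auto
    from summable_mult[OF this, of "real (Suc n)"] show ?thesis by (simp del: of_nat_Suc)
  qed
  then show "summable (\<lambda>k. g (real (Suc k) / real (Suc n)))"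
    unfolding d_def .
  have "(\<lambda>n. integral\<^sup>L lborel (f n)) \<longlonglongrightarrow> (\<integral>s. indicator {0..} s * g s \<partial>lborel)"
    by (rule integral_dominated_convergence[where s = f, OF meas_lim meas' int_c]) (use lim f_bound in auto)
  moreover have "integral\<^sup>L lborel (f n) = 1 / real (Suc n) * suminf (d n)" for n
    using has_bochner_integral_step_function[of "d n" "1 / real (Suc n)"] d_nonneg sm
    unfolding f_def by (simp add: has_bochner_integral_iff)
  ultimately show "(\<lambda>n. 1 / real (Suc n) * (\<Sum>k. g (real (Suc k) / real (Suc n)))) \<longlonglongrightarrow> (LINT s:{0..}|lborel. g s)"
    by (simp add: d_def[abs_def] set_lebesgue_integral_def)
qed

lemma nn_integral_poisson_power:
  assumes l: "0 < l" and r: "0 \<le> r"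
  shows "(\<integral>\<^sup>+n. ennreal (r ^ n) \<partial>measure_pmf (poisson_pmf l)) = ennreal (exp (l * (r - 1)))"
proof -
  have "(\<integral>\<^sup>+n. ennreal (r ^ n) \<partial>measure_pmf (poisson_pmf l))
      = (\<Sum>n. ennreal (pmf (poisson_pmf l) n) * ennreal (r ^ n))"
    by (simp add: nn_integral_measure_pmf nn_integral_count_space_nat)
  also have "\<dots> = (\<Sum>n. ennreal (exp (- l) * ((l * r) ^ n /\<^sub>R fact n)))"
    using l r by (intro suminf_cong) (simp add: ennreal_mult[symmetric] power_mult_distrib divide_inverse mult_ac)
  also have "\<dots> = ennreal (exp (- l) * exp (l * r))"
  proof -
    have "exp (l * r) = (\<Sum>n. (l * r) ^ n /\<^sub>R fact n)"
      by (simp add: exp_def)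
    then show ?thesis
      using l r summable_exp_generic[of "l * r"]
      by (subst suminf_ennreal2) (auto simp: suminf_mult)
  qed
  finally show ?thesis
    by (simp add: algebra_simps flip: exp_add)
qed

section \<open>The Poisson processes along a grid\<close>

lemma measurable_count_space_binop:
  fixes f :: "'a \<Rightarrow> 'b::countable" and g :: "'a \<Rightarrow> 'c::countable"
  assumes "f \<in> measurable M (count_space UNIV)" "g \<in> measurable M (count_space UNIV)"
  shows "(\<lambda>x. F (f x) (g x)) \<in> measurable M (count_space UNIV)"
proof -
  have "(\<lambda>x. (f x, g x)) \<in> measurable M (count_space UNIV \<Otimes>\<^sub>M count_space UNIV)"
    using assms by (rule measurable_Pair)
  also have "count_space UNIV \<Otimes>\<^sub>M count_space UNIV = count_space (UNIV \<times> UNIV :: ('b \<times> 'c) set)"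
    by (intro pair_measure_countable) auto
  finally have "(\<lambda>x. (f x, g x)) \<in> measurable M (count_space UNIV)" by simp
  from measurable_compose[OF this, of "\<lambda>(a, b). F a b" "count_space UNIV"] show ?thesis
    by simp
qed

context prob_space
begin

lemma
  assumes "poisson_process rate P"
  shows poisson_process_measurable: "0 \<le> t \<Longrightarrow> P t \<in> measurable M (count_space UNIV)"
    and poisson_process_0: "\<omega> \<in> space M \<Longrightarrow> P 0 \<omega> = 0"
    and poisson_process_mono: "\<omega> \<in> space M \<Longrightarrow> 0 \<le> s \<Longrightarrow> s \<le> t \<Longrightarrow> P s \<omega> \<le> P t \<omega>"
    and poisson_process_right: "\<omega> \<in> space M \<Longrightarrow> 0 \<le> t \<Longrightarrow> eventually (\<lambda>s. P s \<omega> = P t \<omega>) (at_right t)"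
    and poisson_process_increment: "0 \<le> s \<Longrightarrow> s < t \<Longrightarrow>
      prob ((\<lambda>\<omega>. P t \<omega> - P s \<omega>) -` {c} \<inter> space M) = pmf (poisson_pmf (rate * (t - s))) c"
proof -
  note P = assms[unfolded poisson_process_def]
  show meas: "P t \<in> measurable M (count_space UNIV)" if "0 \<le> t" for t using P that by blast
  show "\<omega> \<in> space M \<Longrightarrow> P 0 \<omega> = 0" using P by blast
  show "\<omega> \<in> space M \<Longrightarrow> 0 \<le> s \<Longrightarrow> s \<le> t \<Longrightarrow> P s \<omega> \<le> P t \<omega>"
    using P by (auto dest!: bspec simp: mono_on_def)
  show "eventually (\<lambda>s. P s \<omega> = P t \<omega>) (at_right t)" if "\<omega> \<in> space M" "0 \<le> t"
  proof -
    have "continuous (at_right t) (\<lambda>s. P s \<omega>)" using P that by blast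
    then show ?thesis
      by (simp add: continuous_within tendsto_discrete)
  qed
  show "prob ((\<lambda>\<omega>. P t \<omega> - P s \<omega>) -` {c} \<inter> space M) = pmf (poisson_pmf (rate * (t - s))) c"
    if "0 \<le> s" "s < t"
  proof -
    have d: "distr M (count_space UNIV) (\<lambda>\<omega>. P t \<omega> - P s \<omega>) = measure_pmf (poisson_pmf (rate * (t - s)))"
      using P that by blast
    have "(\<lambda>\<omega>. P t \<omega> - P s \<omega>) \<in> measurable M (count_space UNIV)"
      using that by (intro measurable_count_space_binop[where F = "(-)", OF meas meas]) auto
    then have "prob ((\<lambda>\<omega>. P t \<omega> - P s \<omega>) -` {c} \<inter> space M)
        = measure (distr M (count_space UNIV) (\<lambda>\<omega>. P t \<omega> - P s \<omega>)) {c}"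
      by (simp add: measure_distr)
    then show ?thesis
      unfolding d by (simp add: measure_pmf_single)
  qed
qed

lemma poisson_process_grid_increments:
  assumes P: "poisson_process rate P" and h: "0 < h"
  shows "prob {\<omega> \<in> space M. \<forall>k<N. P (real (Suc k) * h) \<omega> - P (real k * h) \<omega> = c k}
    = (\<Prod>k<N. pmf (poisson_pmf (rate * h)) (c k))"
proof (cases "N = 0")
  case True
  then show ?thesis by (simp add: prob_space)
next
  case False
  let ?X = "\<lambda>k \<omega>. P (real (Suc k) * h) \<omega> - P (real k * h) \<omega>"
  have "mono (\<lambda>k. real k * h)"
    using h by (auto simp: mono_def)
  then have "indep_vars (\<lambda>_. count_space UNIV) ?X {..<N}"
    using P unfolding poisson_process_def by (auto dest: spec[of _ "\<lambda>k. real k * h"])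
  then have "prob (\<Inter>k\<in>{..<N}. ?X k -` {c k} \<inter> space M) = (\<Prod>k<N. prob (?X k -` {c k} \<inter> space M))"
    using False by (intro indep_varsD_finite) auto
  also have "(\<Inter>k\<in>{..<N}. ?X k -` {c k} \<inter> space M) = {\<omega> \<in> space M. \<forall>k<N. ?X k \<omega> = c k}"
    using False by auto
  also have "(\<Prod>k<N. prob (?X k -` {c k} \<inter> space M)) = (\<Prod>k<N. pmf (poisson_pmf (rate * h)) (c k))"
  proof (rule prod.cong)
    fix k
    have "prob (?X k -` {c k} \<inter> space M) = pmf (poisson_pmf (rate * (real (Suc k) * h - real k * h))) (c k)"
      using h by (intro poisson_process_increment[OF P]) auto
    then show "prob (?X k -` {c k} \<inter> space M) = pmf (poisson_pmf (rate * h)) (c k)"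
      by (simp add: algebra_simps)
  qed simp
  finally show ?thesis .
qed

lemma indep_processes_paths:
  assumes indep: "indep_processes P P'"
    and A: "{f \<in> space (Pi\<^sub>M {0..} (\<lambda>_. count_space UNIV)). A f} \<in> sets (Pi\<^sub>M {0..} (\<lambda>_. count_space UNIV))"
    and B: "{f \<in> space (Pi\<^sub>M {0..} (\<lambda>_. count_space UNIV)). B f} \<in> sets (Pi\<^sub>M {0..} (\<lambda>_. count_space UNIV))"
  shows "prob {\<omega> \<in> space M. A (\<lambda>t\<in>{0..}. P t \<omega>) \<and> B (\<lambda>t\<in>{0..}. P' t \<omega>)}
    = prob {\<omega> \<in> space M. A (\<lambda>t\<in>{0..}. P t \<omega>)} * prob {\<omega> \<in> space M. B (\<lambda>t\<in>{0..}. P' t \<omega>)}"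
proof -
  let ?N = "Pi\<^sub>M {0..} (\<lambda>_. count_space UNIV) :: (real \<Rightarrow> nat) measure"
  have in_space: "(\<lambda>t\<in>{0..}. Q t \<omega>) \<in> space ?N" for Q :: "real \<Rightarrow> 'a \<Rightarrow> nat" and \<omega>
    by (simp add: space_PiM)
  show ?thesis
    using indep_varD[OF indep[unfolded indep_processes_def] A B] in_space
    by (simp add: vimage_def Int_def conj_commute cong: conj_cong)
qed

end

locale poisson_difference = prob_space M + q_density q z
  for M :: "'a measure" and q z :: real +
  fixes Pp Pm :: "real \<Rightarrow> 'a \<Rightarrow> nat"
  assumes Pp: "poisson_process 1 Pp" and Pm: "poisson_process z Pm"
    and indep: "indep_processes Pp Pm"
begin

definition increments :: "real \<Rightarrow> nat \<Rightarrow> 'a \<Rightarrow> nat \<times> nat" where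
  "increments h k \<omega> = (Pp (real (Suc k) * h) \<omega> - Pp (real k * h) \<omega>, Pm (real (Suc k) * h) \<omega> - Pm (real k * h) \<omega>)"

lemma component_measurable: "0 \<le> t \<Longrightarrow> (\<lambda>f. f t) \<in> measurable (Pi\<^sub>M {0..} (\<lambda>_. count_space UNIV)) (count_space UNIV)"
  for t :: real
  by (rule measurable_component_singleton) simp

lemma prob_increments:
  assumes h: "0 < h"
  shows "prob {\<omega> \<in> space M. \<forall>k<N. increments h k \<omega> = c k}
    = (\<Prod>k<N. pmf (pair_pmf (poisson_pmf h) (poisson_pmf (z * h))) (c k))"
proof -
  let ?N = "Pi\<^sub>M {0..} (\<lambda>_. count_space UNIV) :: (real \<Rightarrow> nat) measure"
  have sets: "{f \<in> space ?N. \<forall>k<N. f (real (Suc k) * h) - f (real k * h) = d k} \<in> sets ?N" for d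
  proof -
    have meas: "(\<lambda>f. f (real (Suc k) * h) - f (real k * h)) \<in> measurable ?N (count_space UNIV)" for k
      using h by (intro measurable_count_space_binop[where F = "(-)", OF component_measurable component_measurable]) auto
    have "{f \<in> space ?N. \<forall>k\<in>{..<N}. f (real (Suc k) * h) - f (real k * h) = d k} \<in> sets ?N"
    proof (intro sets.sets_Collect_finite_All)
      fix k
      have "(\<lambda>f. f (real (Suc k) * h) - f (real k * h)) -` {d k} \<inter> space ?N \<in> sets ?N"
        using meas[of k] by (rule measurable_sets) simp
      then show "{f \<in> space ?N. f (real (Suc k) * h) - f (real k * h) = d k} \<in> sets ?N"
        by (simp add: vimage_def Int_def conj_commute)
    qed simp
    then show ?thesis by (simp only: Ball_def lessThan_iff)
  qed
  have nonneg: "0 \<le> real k * h" for k using h by simp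
  have "prob {\<omega> \<in> space M. \<forall>k<N. increments h k \<omega> = c k}
     = prob {\<omega> \<in> space M. (\<forall>k<N. Pp (real (Suc k) * h) \<omega> - Pp (real k * h) \<omega> = fst (c k)) \<and>
          (\<forall>k<N. Pm (real (Suc k) * h) \<omega> - Pm (real k * h) \<omega> = snd (c k))}"
    by (rule arg_cong[where f = prob]) (auto simp: increments_def prod_eq_iff)
  also have "\<dots> = prob {\<omega> \<in> space M. \<forall>k<N. Pp (real (Suc k) * h) \<omega> - Pp (real k * h) \<omega> = fst (c k)} *
      prob {\<omega> \<in> space M. \<forall>k<N. Pm (real (Suc k) * h) \<omega> - Pm (real k * h) \<omega> = snd (c k)}"
    using indep_processes_paths[OF indep sets sets, of "\<lambda>k. fst (c k)" "\<lambda>k. snd (c k)"] nonneg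
    by (simp only: restrict_apply atLeast_iff if_True)
  also have "\<dots> = (\<Prod>k<N. pmf (poisson_pmf h) (fst (c k))) * (\<Prod>k<N. pmf (poisson_pmf (z * h)) (snd (c k)))"
    using poisson_process_grid_increments[OF Pp h] poisson_process_grid_increments[OF Pm h] by simp
  also have "\<dots> = (\<Prod>k<N. pmf (pair_pmf (poisson_pmf h) (poisson_pmf (z * h))) (c k))"
    unfolding prod.distrib[symmetric] by (intro prod.cong) (auto simp flip: pmf_pair)
  finally show ?thesis .
qed

lemma increments_measurable:
  assumes "0 < h"
  shows "increments h k \<in> measurable M (count_space UNIV)"
  unfolding increments_def[abs_def]
  using assms
  by (intro measurable_count_space_binop[where F = Pair]
      measurable_count_space_binop[where F = "(-)", OF poisson_process_measurable[OF Pp] poisson_process_measurable[OF Pp]]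
      measurable_count_space_binop[where F = "(-)", OF poisson_process_measurable[OF Pm] poisson_process_measurable[OF Pm]]) auto

lemma increments_list_measurable:
  assumes "0 < h"
  shows "(\<lambda>\<omega>. map (\<lambda>k. increments h k \<omega>) ks) \<in> measurable M (count_space UNIV)"
proof (induction ks)
  case (Cons k ks)
  have "(\<lambda>\<omega>. increments h k \<omega> # map (\<lambda>k. increments h k \<omega>) ks) \<in> measurable M (count_space UNIV)"
    by (rule measurable_count_space_binop[where F = "(#)", OF increments_measurable[OF assms] Cons.IH])
  then show ?case by simp
qed simp

text \<open>Lists of pairs of natural numbers form a countable type, so it suffices to compare the
  probabilities of single lists. From here on the renewal of the walk at its first step is the
  recursive definition of \<open>replicate_pmf\<close>.\<close>

lemma distr_increments:
  assumes h: "0 < h"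
  shows "distr M (count_space UNIV) (\<lambda>\<omega>. map (\<lambda>k. increments h k \<omega>) [0..<N])
    = measure_pmf (replicate_pmf N (pair_pmf (poisson_pmf h) (poisson_pmf (z * h))))"
proof (rule measure_eqI_countable[where A = UNIV])
  let ?D = "pair_pmf (poisson_pmf h) (poisson_pmf (z * h))"
  fix xs :: "(nat \<times> nat) list"
  have "emeasure (distr M (count_space UNIV) (\<lambda>\<omega>. map (\<lambda>k. increments h k \<omega>) [0..<N])) {xs}
      = prob {\<omega> \<in> space M. map (\<lambda>k. increments h k \<omega>) [0..<N] = xs}"
    by (subst emeasure_distr[OF increments_list_measurable[OF h]])
      (auto simp: emeasure_eq_measure vimage_def Int_def conj_commute)
  also have "prob {\<omega> \<in> space M. map (\<lambda>k. increments h k \<omega>) [0..<N] = xs} = pmf (replicate_pmf N ?D) xs"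
  proof (cases "length xs = N")
    case True
    have "{\<omega> \<in> space M. map (\<lambda>k. increments h k \<omega>) [0..<N] = xs} = {\<omega> \<in> space M. \<forall>k<N. increments h k \<omega> = xs ! k}"
      using True by (auto simp: list_eq_iff_nth_eq)
    then show ?thesis
      using prob_increments[OF h, of N "\<lambda>k. xs ! k"] pmf_replicate_pmf[of xs ?D] True by simp
  next
    case False
    then have "{\<omega> \<in> space M. map (\<lambda>k. increments h k \<omega>) [0..<N] = xs} = {}"
      by auto
    moreover have "pmf (replicate_pmf N ?D) xs = 0"
      using False by (auto simp: pmf_eq_0_set_pmf set_replicate_pmf)
    ultimately show ?thesis by (simp only: measure_empty)
  qed
  finally show "emeasure (distr M (count_space UNIV) (\<lambda>\<omega>. map (\<lambda>k. increments h k \<omega>) [0..<N])) {xs}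
      = emeasure (measure_pmf (replicate_pmf N ?D)) {xs}"
    by (simp add: emeasure_pmf_single)
qed auto

abbreviation path :: "'a \<Rightarrow> real \<Rightarrow> real" where
  "path \<omega> s \<equiv> exp_functional_integrand q Pp Pm \<omega> s"

lemma walk_sum_increments:
  assumes h: "0 < h" and \<omega>: "\<omega> \<in> space M"
  shows "walk_sum q (map (\<lambda>k. increments h k \<omega>) [r..<r + N]) * path \<omega> (real r * h)
    = (\<Sum>j<N. path \<omega> (real (Suc (r + j)) * h))"
proof (induction N arbitrary: r)
  case (Suc N)
  have le: "Pp (real r * h) \<omega> \<le> Pp (real (Suc r) * h) \<omega>" "Pm (real r * h) \<omega> \<le> Pm (real (Suc r) * h) \<omega>"
    using h by (auto intro!: poisson_process_mono[OF Pp] poisson_process_mono[OF Pm] \<omega>)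
  have "q powi (int (fst (increments h r \<omega>)) - int (snd (increments h r \<omega>))) * path \<omega> (real r * h)
      = path \<omega> (real (Suc r) * h)"
    using q_pos le
    by (simp add: exp_functional_integrand_def poisson_diff_def increments_def power_int_add[symmetric] of_nat_diff)
  moreover have "[r..<r + Suc N] = r # [Suc r..<Suc r + N]"
    by (simp add: upt_rec)
  ultimately have "walk_sum q (map (\<lambda>k. increments h k \<omega>) [r..<r + Suc N]) * path \<omega> (real r * h)
      = path \<omega> (real (Suc r) * h) +
        walk_sum q (map (\<lambda>k. increments h k \<omega>) [Suc r..<Suc r + N]) * path \<omega> (real (Suc r) * h)"
    by (simp add: algebra_simps del: upt.simps of_nat_Suc)
  also have "\<dots> = (\<Sum>j<Suc N. path \<omega> (real (Suc (r + j)) * h))"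
    unfolding Suc.IH[of "Suc r"] by (subst sum.lessThan_Suc_shift) simp
  finally show ?case .
qed simp

lemma path_0: "\<omega> \<in> space M \<Longrightarrow> path \<omega> 0 = 1"
  by (simp add: exp_functional_integrand_def poisson_diff_def poisson_process_0[OF Pp] poisson_process_0[OF Pm])

lemma path_nonneg: "0 \<le> path \<omega> s"
  using q_pos by (simp add: exp_functional_integrand_def)

lemma path_measurable [measurable]:
  assumes "0 \<le> t"
  shows "(\<lambda>\<omega>. path \<omega> t) \<in> borel_measurable M"
proof -
  have "(\<lambda>\<omega>. (Pp t \<omega>, Pm t \<omega>)) \<in> measurable M (count_space UNIV)"
    using assms by (intro measurable_count_space_binop[where F = Pair, OF poisson_process_measurable[OF Pp] poisson_process_measurable[OF Pm]])
  from measurable_compose[OF this, of "\<lambda>(a, b). q powi (int a - int b)" borel] show ?thesis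
    by (simp add: exp_functional_integrand_def poisson_diff_def)
qed

lemma walk_char_eq_expectation:
  assumes h: "0 < h"
  shows "walk_char q h (pair_pmf (poisson_pmf h) (poisson_pmf (z * h))) N t
    = (\<integral>\<omega>. iexp (t * (h * (\<Sum>j<N. path \<omega> (real (Suc j) * h)))) \<partial>M)"
proof -
  have "walk_char q h (pair_pmf (poisson_pmf h) (poisson_pmf (z * h))) N t
      = (\<integral>\<omega>. iexp (t * (h * walk_sum q (map (\<lambda>k. increments h k \<omega>) [0..<N]))) \<partial>M)"
    unfolding walk_char_def distr_increments[OF h, symmetric]
    by (rule integral_distr[OF increments_list_measurable[OF h]]) simp
  also have "\<dots> = (\<integral>\<omega>. iexp (t * (h * (\<Sum>j<N. path \<omega> (real (Suc j) * h)))) \<partial>M)"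
    by (intro Bochner_Integration.integral_cong)
      (use walk_sum_increments[OF h, of _ 0 N] path_0 in \<open>simp_all del: of_nat_Suc\<close>)
  finally show ?thesis .
qed

lemma path_right_continuous:
  assumes "\<omega> \<in> space M" "0 \<le> s"
  shows "(path \<omega> \<longlongrightarrow> path \<omega> s) (at_right s)"
proof (rule tendsto_eventually)
  show "\<forall>\<^sub>F u in at_right s. path \<omega> u = path \<omega> s"
    using poisson_process_right[OF Pp assms] poisson_process_right[OF Pm assms]
    by eventually_elim (simp add: exp_functional_integrand_def poisson_diff_def)
qed

text \<open>A bound for the path on \<open>[k, k + 2]\<close>: there \<open>P\<^sup>+\<close> is at least its value at \<open>k\<close> and \<open>P\<^sup>-\<close> at most
  its value at \<open>k + 2\<close>. The length \<open>2\<close> leaves room for the next grid point of a point in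
  \<open>[k, k + 1]\<close>.\<close>

definition block_bound :: "'a \<Rightarrow> nat \<Rightarrow> real" where
  "block_bound \<omega> k = q powi (int (Pp (real k) \<omega>) - int (Pm (real k + 2) \<omega>))"

lemma path_le_block_bound:
  assumes \<omega>: "\<omega> \<in> space M" and "0 \<le> s" "s \<le> u" "u \<le> s + 1"
  shows "path \<omega> u \<le> block_bound \<omega> (nat \<lfloor>s\<rfloor>)"
proof -
  have k: "real (nat \<lfloor>s\<rfloor>) \<le> u" "u \<le> real (nat \<lfloor>s\<rfloor>) + 2"
    using assms by (simp_all add: of_nat_nat) linarith+
  have "Pp (real (nat \<lfloor>s\<rfloor>)) \<omega> \<le> Pp u \<omega>" "Pm u \<omega> \<le> Pm (real (nat \<lfloor>s\<rfloor>) + 2) \<omega>"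
    using assms k by (auto intro!: poisson_process_mono[OF Pp] poisson_process_mono[OF Pm] \<omega>)
  then show ?thesis
    unfolding exp_functional_integrand_def poisson_diff_def block_bound_def
    using q_pos q_less_one by (intro power_int_decreasing) auto
qed

lemma distr_pair:
  assumes s: "0 < s" and t: "0 < t"
  shows "distr M (count_space UNIV) (\<lambda>\<omega>. (Pp s \<omega>, Pm t \<omega>)) = measure_pmf (pair_pmf (poisson_pmf s) (poisson_pmf (z * t)))"
proof (rule measure_eqI_countable[where A = UNIV])
  let ?N = "Pi\<^sub>M {0..} (\<lambda>_. count_space UNIV) :: (real \<Rightarrow> nat) measure"
  fix x :: "nat \<times> nat"
  obtain a b where x: "x = (a, b)" by (cases x)
  have sets: "{f \<in> space ?N. f u = d} \<in> sets ?N" if "0 < u" for u d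
  proof -
    have "(\<lambda>f. f u) -` {d} \<inter> space ?N \<in> sets ?N"
      using that by (intro measurable_sets[OF component_measurable]) auto
    then show ?thesis by (simp add: vimage_def Int_def conj_commute)
  qed
  have single: "prob {\<omega> \<in> space M. P u \<omega> = d} = pmf (poisson_pmf (rate * u)) d"
    if "poisson_process rate P" "0 < u" for rate P u d
  proof -
    have "{\<omega> \<in> space M. P u \<omega> = d} = (\<lambda>\<omega>. P u \<omega> - P 0 \<omega>) -` {d} \<inter> space M"
      using poisson_process_0[OF that(1)] by auto
    then show ?thesis
      using poisson_process_increment[OF that(1), of 0 u d] that by simp
  qed
  have meas: "(\<lambda>\<omega>. (Pp s \<omega>, Pm t \<omega>)) \<in> measurable M (count_space UNIV)"
    using s t by (intro measurable_count_space_binop[where F = Pair, OF poisson_process_measurable[OF Pp] poisson_process_measurable[OF Pm]]) auto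
  have "emeasure (distr M (count_space UNIV) (\<lambda>\<omega>. (Pp s \<omega>, Pm t \<omega>))) {x}
      = prob {\<omega> \<in> space M. Pp s \<omega> = a \<and> Pm t \<omega> = b}"
    by (subst emeasure_distr[OF meas]) (auto simp: x emeasure_eq_measure vimage_def Int_def conj_commute conj_ac)
  also have "prob {\<omega> \<in> space M. Pp s \<omega> = a \<and> Pm t \<omega> = b}
      = prob {\<omega> \<in> space M. Pp s \<omega> = a} * prob {\<omega> \<in> space M. Pm t \<omega> = b}"
    using indep_processes_paths[OF indep sets[OF s] sets[OF t], of a b] s t by simp
  also have "\<dots> = pmf (pair_pmf (poisson_pmf s) (poisson_pmf (z * t))) x"
    using single[OF Pp s] single[OF Pm t] by (simp add: x pmf_pair)
  finally show "emeasure (distr M (count_space UNIV) (\<lambda>\<omega>. (Pp s \<omega>, Pm t \<omega>))) {x}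
      = emeasure (measure_pmf (pair_pmf (poisson_pmf s) (poisson_pmf (z * t)))) {x}"
    by (simp add: emeasure_pmf_single)
qed auto

lemma nn_integral_block_bound_powr:
  "(\<integral>\<^sup>+\<omega>. ennreal (block_bound \<omega> (Suc k) powr p) \<partial>M)
     = ennreal (exp (real (Suc k) * (q powr p - 1)) * exp (z * (real (Suc k) + 2) * (q powr (- p) - 1)))"
proof -
  define s t where "s = real (Suc k)" and "t = real (Suc k) + 2"
  have st: "0 < s" "0 < t" by (simp_all add: s_def t_def)
  have meas: "(\<lambda>\<omega>. (Pp s \<omega>, Pm t \<omega>)) \<in> measurable M (count_space UNIV)"
    using st by (intro measurable_count_space_binop[where F = Pair, OF poisson_process_measurable[OF Pp] poisson_process_measurable[OF Pm]]) auto
  have pw: "(q powi (int a - int b)) powr p = (q powr p) ^ a * (q powr (- p)) ^ b" for a b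
  proof -
    have "(q powi (int a - int b)) = q powr (real a - real b)"
      using q_pos by (simp add: power_int_diff powr_diff powr_realpow)
    then show ?thesis
      using q_pos by (simp add: powr_powr powr_add[symmetric] algebra_simps flip: powr_realpow)
  qed
  have "(\<integral>\<^sup>+\<omega>. ennreal (block_bound \<omega> (Suc k) powr p) \<partial>M)
      = (\<integral>\<^sup>+x. ennreal ((q powi (int (fst x) - int (snd x))) powr p) \<partial>distr M (count_space UNIV) (\<lambda>\<omega>. (Pp s \<omega>, Pm t \<omega>)))"
    by (subst nn_integral_distr[OF meas]) (auto simp: block_bound_def s_def t_def)
  also have "\<dots> = (\<integral>\<^sup>+a. \<integral>\<^sup>+b. ennreal ((q powr p) ^ a) * ennreal ((q powr (- p)) ^ b)
      \<partial>measure_pmf (poisson_pmf (z * t)) \<partial>measure_pmf (poisson_pmf s))"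
    unfolding distr_pair[OF st] nn_integral_pair_pmf' by (simp add: pw ennreal_mult)
  also have "\<dots> = ennreal (exp (s * (q powr p - 1))) * ennreal (exp (z * t * (q powr (- p) - 1)))"
    using st z_pos by (simp add: nn_integral_cmult nn_integral_multc nn_integral_poisson_power)
  finally show ?thesis
    by (simp add: ennreal_mult s_def t_def)
qed

text \<open>The expectations of the bounds themselves are not summable when \<open>\<mu> \<le> 1\<close>. For an exponent \<open>p < \<mu>\<close>,
  however, the expectations of their \<open>p\<close>-th powers decay geometrically: with \<open>A = q\<^sup>p > z\<close> the ratio is
  \<open>exp (- (1 - A) (1 - z / A))\<close>. So the \<open>p\<close>-th powers are almost surely summable, and for \<open>p \<le> 1\<close>
  they eventually dominate the terms themselves.\<close>

lemma AE_summable_block_bound: "AE \<omega> in M. summable (block_bound \<omega>)"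
proof -
  define \<mu> where "\<mu> = ln z / ln q"
  have \<mu>: "0 < \<mu>" using q_pos q_less_one z_pos z_less_one by (simp add: \<mu>_def divide_neg_neg)
  define p where "p = min 1 (\<mu> / 2)"
  have p: "0 < p" "p \<le> 1" "p < \<mu>" using \<mu> by (auto simp: p_def)
  define A where "A = q powr p"
  have A: "0 < A" "A < 1"
    using q_pos q_less_one p by (auto simp: A_def powr_def mult_pos_neg)
  have "ln z < p * ln q"
    using p(3) q_pos q_less_one by (simp add: \<mu>_def field_simps)
  then have "z < A"
    using z_pos q_pos by (metis A_def exp_less_cancel_iff exp_ln less_numeral_extra(3) powr_def)
  define \<rho> where "\<rho> = exp ((A - 1) + z * (1 / A - 1))"
  have "(A - 1) + z * (1 / A - 1) = (1 - A) * (z / A - 1)"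
    using A by (simp add: field_simps)
  also have "\<dots> < 0"
    using A \<open>z < A\<close> by (intro mult_pos_neg) auto
  finally have \<rho>: "0 < \<rho>" "\<rho> < 1" by (simp_all add: \<rho>_def)
  have val: "(\<integral>\<^sup>+\<omega>. ennreal (block_bound \<omega> (Suc k) powr p) \<partial>M) = ennreal (exp (2 * z * (1 / A - 1)) * \<rho> ^ Suc k)" for k
  proof -
    have "exp (r * (A - 1)) * exp (z * (r + 2) * (1 / A - 1))
        = exp (2 * z * (1 / A - 1)) * exp (r * ((A - 1) + z * (1 / A - 1)))" for r
      by (simp add: algebra_simps flip: exp_add)
    then show ?thesis
      unfolding nn_integral_block_bound_powr powr_minus_divide A_def[symmetric] \<rho>_def
      by (simp only: exp_of_nat_mult[symmetric])
  qed
  have [measurable]: "(\<lambda>\<omega>. block_bound \<omega> k) \<in> borel_measurable M" for k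
  proof -
    have "(\<lambda>\<omega>. (Pp (real k) \<omega>, Pm (real k + 2) \<omega>)) \<in> measurable M (count_space UNIV)"
      by (intro measurable_count_space_binop[where F = Pair, OF poisson_process_measurable[OF Pp] poisson_process_measurable[OF Pm]]) auto
    from measurable_compose[OF this, of "\<lambda>(a, b). q powi (int a - int b)" borel] show ?thesis
      by (simp add: block_bound_def)
  qed
  have "(\<integral>\<^sup>+\<omega>. (\<Sum>k. ennreal (block_bound \<omega> (Suc k) powr p)) \<partial>M)
      = (\<Sum>k. ennreal (exp (2 * z * (1 / A - 1)) * \<rho> ^ Suc k))"
    unfolding val[symmetric] by (rule nn_integral_suminf) measurable
  also have "\<dots> = ennreal (\<Sum>k. exp (2 * z * (1 / A - 1)) * \<rho> ^ Suc k)"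
    using \<rho> by (intro suminf_ennreal2 summable_mult) (auto intro!: summable_mult summable_geometric)
  finally have "(\<integral>\<^sup>+\<omega>. (\<Sum>k. ennreal (block_bound \<omega> (Suc k) powr p)) \<partial>M) \<noteq> \<infinity>" by simp
  then have "AE \<omega> in M. (\<Sum>k. ennreal (block_bound \<omega> (Suc k) powr p)) \<noteq> \<infinity>"
    by (intro nn_integral_PInf_AE) auto
  then show ?thesis
  proof eventually_elim
    case (elim \<omega>)
    have pos: "0 < block_bound \<omega> k" for k
      using q_pos by (simp add: block_bound_def)
    have sm: "summable (\<lambda>k. block_bound \<omega> (Suc k) powr p)"
      using elim by (intro summable_suminf_not_top) auto
    then have "(\<lambda>k. block_bound \<omega> (Suc k) powr p) \<longlonglongrightarrow> 0"
      by (rule summable_LIMSEQ_zero)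
    then have "\<forall>\<^sub>F k in sequentially. block_bound \<omega> (Suc k) powr p < 1"
      by (rule order_tendstoD) simp
    then have "\<forall>\<^sub>F k in sequentially. norm (block_bound \<omega> (Suc k)) \<le> block_bound \<omega> (Suc k) powr p"
    proof eventually_elim
      case (elim k)
      have "block_bound \<omega> (Suc k) < 1"
      proof (rule ccontr)
        assume "\<not> ?thesis"
        then have "1 \<le> block_bound \<omega> (Suc k) powr p" using p by (intro ge_one_powr_ge_zero) auto
        with elim show False by simp
      qed
      then have "block_bound \<omega> (Suc k) powr 1 \<le> block_bound \<omega> (Suc k) powr p"
        using p pos[of "Suc k"] by (intro powr_mono') auto
      then show ?case using pos[of "Suc k"] by simp
    qed
    then have "summable (\<lambda>k. block_bound \<omega> (Suc k))"
      using sm by (rule summable_comparison_test_ev)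
    then show ?case by (rule summable_Suc_iff[THEN iffD1])
  qed
qed

end

section \<open>The law of the exponential functional\<close>

context poisson_difference
begin

abbreviation functional :: "'a \<Rightarrow> real" where
  "functional \<equiv> exp_functional q Pp Pm"

text \<open>The path is only assumed to be measurable at fixed times. As a limit along the grid it is jointly
  measurable in time and chance, so that the integral over time is a random variable.\<close>

lemma functional_measurable [measurable]: "functional \<in> borel_measurable M"
proof -
  have "(\<lambda>(\<omega>, s :: real). indicator {0..} s * path \<omega> s) \<in> borel_measurable (M \<Otimes>\<^sub>M lborel)"
  proof (rule borel_measurable_LIMSEQ_metric)
    fix n
    let ?k = "\<lambda>p :: 'a \<times> real. nat \<lfloor>snd p / (1 / real (Suc n))\<rfloor>"
    have [measurable]: "?k \<in> measurable (M \<Otimes>\<^sub>M lborel) (count_space UNIV)"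
      by measurable
    have "(\<lambda>p. path (fst p) (real (Suc (?k p)) / real (Suc n))) \<in> borel_measurable (M \<Otimes>\<^sub>M lborel)"
    proof (rule measurable_compose_countable[where f = "\<lambda>k p. path (fst p) (real (Suc k) / real (Suc n))"])
      show "(\<lambda>p. path (fst p) (real (Suc k) / real (Suc n))) \<in> borel_measurable (M \<Otimes>\<^sub>M lborel)" for k
        by (rule measurable_compose[OF measurable_fst path_measurable]) simp
    qed measurable
    then show "(\<lambda>p. indicator {0..} (snd p) * path (fst p) (real (Suc (?k p)) / real (Suc n)))
        \<in> borel_measurable (M \<Otimes>\<^sub>M lborel)"
      by measurable
  next
    fix p :: "'a \<times> real" assume "p \<in> space (M \<Otimes>\<^sub>M lborel)"
    then obtain \<omega> s where p: "p = (\<omega>, s)" "\<omega> \<in> space M"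
      by (auto simp: space_pair_measure)
    show "(\<lambda>n. indicator {0..} (snd p) * path (fst p) (real (Suc (nat \<lfloor>snd p / (1 / real (Suc n))\<rfloor>)) / real (Suc n)))
        \<longlonglongrightarrow> (case p of (\<omega>, s) \<Rightarrow> indicator {0..} s * path \<omega> s)"
    proof (cases "0 \<le> s")
      case True
      show ?thesis
        using right_limit_along_grid[OF True path_right_continuous[OF p(2) True]] True by (simp add: p)
    qed (simp add: p)
  qed
  then have "(\<lambda>\<omega>. \<integral>s. indicator {0..} s * path \<omega> s \<partial>lborel) \<in> borel_measurable M"
    by (rule lborel.borel_measurable_lebesgue_integral)
  then show ?thesis
    by (simp add: exp_functional_def[abs_def] set_lebesgue_integral_def)
qed

definition grid_sum :: "nat \<Rightarrow> 'a \<Rightarrow> real" where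
  "grid_sum n \<omega> = 1 / real (Suc n) * (\<Sum>k. path \<omega> (real (Suc k) / real (Suc n)))"

lemma grid_sum_measurable [measurable]: "grid_sum n \<in> borel_measurable M"
proof -
  have [measurable]: "(\<lambda>\<omega>. path \<omega> (real (Suc k) / real (Suc n))) \<in> borel_measurable M" for k
    by (rule path_measurable) simp
  show ?thesis
    unfolding grid_sum_def[abs_def] by measurable
qed

lemma AE_path:
  "AE \<omega> in M. set_integrable lborel {0..} (path \<omega>) \<and>
     (\<forall>n. summable (\<lambda>k. path \<omega> (real (Suc k) / real (Suc n)))) \<and>
     (\<lambda>n. grid_sum n \<omega>) \<longlonglongrightarrow> functional \<omega>"
  using AE_summable_block_bound
proof (rule AE_mp, intro AE_I2 impI)
  fix \<omega> assume \<omega>: "\<omega> \<in> space M" and sm: "summable (block_bound \<omega>)"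
  note riemann = right_continuous_riemann_sums[of "path \<omega>", OF path_nonneg path_le_block_bound[OF \<omega>] path_right_continuous[OF \<omega>] sm]
  show "set_integrable lborel {0..} (path \<omega>) \<and>
     (\<forall>n. summable (\<lambda>k. path \<omega> (real (Suc k) / real (Suc n)))) \<and>
     (\<lambda>n. grid_sum n \<omega>) \<longlonglongrightarrow> functional \<omega>"
    using riemann by (simp add: grid_sum_def exp_functional_def)
qed

lemma iexp_expectation_LIMSEQ:
  fixes X :: "nat \<Rightarrow> 'a \<Rightarrow> real"
  assumes [measurable]: "\<And>n. X n \<in> borel_measurable M" "Y \<in> borel_measurable M"
    and lim: "AE \<omega> in M. (\<lambda>n. X n \<omega>) \<longlonglongrightarrow> Y \<omega>"
  shows "(\<lambda>n. \<integral>\<omega>. iexp (t * X n \<omega>) \<partial>M) \<longlonglongrightarrow> (\<integral>\<omega>. iexp (t * Y \<omega>) \<partial>M)"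
proof (rule integral_dominated_convergence[where w = "\<lambda>_. 1"])
  show "AE \<omega> in M. (\<lambda>n. iexp (t * X n \<omega>)) \<longlonglongrightarrow> iexp (t * Y \<omega>)"
    using lim by eventually_elim (intro tendsto_intros)
  show "AE \<omega> in M. norm (iexp (t * X n \<omega>)) \<le> 1" for n
    by (simp only: norm_exp_i_times order_refl eventually_True)
qed (simp_all, measurable)

definition grid_char :: "nat \<Rightarrow> real \<Rightarrow> complex" where
  "grid_char n t = (\<integral>\<omega>. iexp (t * grid_sum n \<omega>) \<partial>M)"

lemma norm_grid_char_le_1: "norm (grid_char n t) \<le> 1"
proof -
  have "norm (grid_char n t) \<le> (\<integral>\<omega>. norm (iexp (t * grid_sum n \<omega>)) \<partial>M)"
    unfolding grid_char_def by (rule integral_norm_bound)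
  also have "\<dots> = 1"
    by (simp only: norm_exp_i_times) (simp add: prob_space)
  finally show ?thesis .
qed

lemma walk_char_LIMSEQ:
  "(\<lambda>N. walk_char q (1 / Suc n) (pair_pmf (poisson_pmf (1 / Suc n)) (poisson_pmf (z / Suc n))) N t)
     \<longlonglongrightarrow> grid_char n t"
proof -
  have [measurable]: "(\<lambda>\<omega>. path \<omega> (real (Suc k) / real (Suc n))) \<in> borel_measurable M" for k
    by (rule path_measurable) simp
  have "walk_char q (1 / Suc n) (pair_pmf (poisson_pmf (1 / Suc n)) (poisson_pmf (z / Suc n))) N t
      = (\<integral>\<omega>. iexp (t * (1 / real (Suc n) * (\<Sum>j<N. path \<omega> (real (Suc j) / real (Suc n))))) \<partial>M)" for N
    using walk_char_eq_expectation[of "1 / Suc n" N t]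
    by (simp only: times_divide_eq_right mult_1_right) simp
  moreover have "(\<lambda>N. \<integral>\<omega>. iexp (t * (1 / real (Suc n) * (\<Sum>j<N. path \<omega> (real (Suc j) / real (Suc n))))) \<partial>M)
      \<longlonglongrightarrow> grid_char n t"
    unfolding grid_char_def
  proof (rule iexp_expectation_LIMSEQ)
    show "AE \<omega> in M. (\<lambda>N. 1 / real (Suc n) * (\<Sum>j<N. path \<omega> (real (Suc j) / real (Suc n)))) \<longlonglongrightarrow> grid_sum n \<omega>"
      using AE_path
    proof eventually_elim
      case (elim \<omega>)
      then show ?case
        unfolding grid_sum_def by (intro tendsto_mult tendsto_const summable_LIMSEQ) auto
    qed
  qed measurable
  ultimately show ?thesis by simp
qed

text \<open>The renewal equation for \<open>N\<close> steps relates the walks with \<open>N\<close> and \<open>N + 1\<close> steps; in the limit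
  both become the same infinite walk.\<close>

lemma grid_char_fixpoint:
  "grid_char n t = (\<integral>x. iexp (t * (1 / Suc n * q powi (int (fst x) - int (snd x)))) *
      grid_char n (q powi (int (fst x) - int (snd x)) * t)
      \<partial>measure_pmf (pair_pmf (poisson_pmf (1 / Suc n)) (poisson_pmf (z / Suc n))))"
proof (rule LIMSEQ_unique[OF LIMSEQ_Suc[OF walk_char_LIMSEQ]])
  let ?D = "pair_pmf (poisson_pmf (1 / Suc n)) (poisson_pmf (z / Suc n))"
  show "(\<lambda>N. walk_char q (1 / Suc n) ?D (Suc N) t)
      \<longlonglongrightarrow> (\<integral>x. iexp (t * (1 / Suc n * q powi (int (fst x) - int (snd x)))) *
        grid_char n (q powi (int (fst x) - int (snd x)) * t) \<partial>measure_pmf ?D)"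
    unfolding walk_char_Suc
  proof (rule integral_dominated_convergence[where w = "\<lambda>_. 1"])
    show "AE x in measure_pmf ?D. (\<lambda>N. iexp (t * (1 / Suc n * q powi (int (fst x) - int (snd x)))) *
          walk_char q (1 / Suc n) ?D N (q powi (int (fst x) - int (snd x)) * t))
        \<longlonglongrightarrow> iexp (t * (1 / Suc n * q powi (int (fst x) - int (snd x)))) *
          grid_char n (q powi (int (fst x) - int (snd x)) * t)"
      by (intro AE_I2 tendsto_mult tendsto_const walk_char_LIMSEQ)
    have "norm (walk_char q h D N u) \<le> 1" for h D N u
    proof -
      have "norm (walk_char q h D N u) \<le> 1 * measure (measure_pmf (replicate_pmf N D)) UNIV"
        unfolding walk_char_def by (rule norm_integral_pmf_le) (simp only: norm_exp_i_times, simp)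
      then show ?thesis by simp
    qed
    then show "AE x in measure_pmf ?D. norm (iexp (t * (1 / Suc n * q powi (int (fst x) - int (snd x)))) *
          walk_char q (1 / Suc n) ?D N (q powi (int (fst x) - int (snd x)) * t)) \<le> 1" for N
      by (simp only: norm_mult norm_exp_i_times mult_1_left eventually_True)
  qed auto
qed

theorem distr_functional: "distr M borel functional = law"
proof (rule law_unique)
  show "real_distribution (distr M borel functional)"
    by (rule real_distribution_distr) measurable
  have char_eq: "char (distr M borel functional) t = (\<integral>\<omega>. iexp (t * functional \<omega>) \<partial>M)" for t
    unfolding char_def by (rule integral_distr) measurable
  show "(1 + of_real z - \<i> * of_real t) * char (distr M borel functional) t
      = char (distr M borel functional) (q * t) + of_real z * char (distr M borel functional) (t / q)" for t
  proof (rule q_difference_limit[OF z_pos])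
    show "(\<lambda>n. grid_char n t) \<longlonglongrightarrow> char (distr M borel functional) t" for t
      unfolding char_eq grid_char_def
      by (rule iexp_expectation_LIMSEQ) (use AE_path in \<open>auto elim: eventually_mono\<close>)
  qed (rule norm_grid_char_le_1 grid_char_fixpoint)+
qed

lemma distributed_functional:
  "distributed M lborel functional (\<lambda>x. ennreal (indicator {0..} x * density_fun q z x))"
proof -
  have "distr M lborel functional = distr M borel functional"
    by (rule distr_cong) auto
  then show ?thesis
    unfolding distributed_def using distr_functional by (simp add: law_def)
qed

lemma
  shows mellin_transform_functional: "mellin_transform M functional s = mellin s"
    and integrable_functional_powr:
      "z < q powr Re s \<Longrightarrow> integrable M (\<lambda>\<omega>. complex_of_real (functional \<omega>) powr s)"
proof -
  show "mellin_transform M functional s = mellin s"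
    unfolding mellin_transform_def mellin_def distr_functional[symmetric]
    by (rule integral_distr[symmetric]) measurable
  assume "z < q powr Re s"
  then have "integrable (distr M borel functional) (\<lambda>x. complex_of_real x powr s)"
    unfolding distr_functional by (rule integrable_law_cpowr)
  then show "integrable M (\<lambda>\<omega>. complex_of_real (functional \<omega>) powr s)"
    by (rule integrable_distr[rotated]) measurable
qed

end

theorem theorem2p1:
  fixes M :: "'a measure" and Pp Pm :: "real \<Rightarrow> 'a \<Rightarrow> nat" and q \<mu> z :: real
  assumes "prob_space M"
    and "0 < q" and "q < 1" and "\<mu> > 0" and "z = q powr \<mu>"
    and "prob_space.poisson_process M 1 Pp"
    and "prob_space.poisson_process M z Pm"
    and "prob_space.indep_processes M Pp Pm"
  shows
    \<comment> \<open>the integral defining the random variable converges almost surely\<close>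
    "(AE \<omega> in M. set_integrable lborel {0..} (exp_functional_integrand q Pp Pm \<omega>)) \<and>
     mellin_transform M (exp_functional q Pp Pm) analytic_on {s. Re s < \<mu>} \<and>
     (\<forall>s. Re s < \<mu> \<longrightarrow>
        integrable M (\<lambda>\<omega>. complex_of_real (exp_functional q Pp Pm \<omega>) powr s) \<and>
        mellin_transform M (exp_functional q Pp Pm) s = mellin_qpoch_form q z s \<and>
        mellin_qpoch_form q z s = mellin_qgamma_form q \<mu> s) \<and>
     (\<forall>x\<ge>0. (\<forall>m. summable (\<lambda>n. density_term q z x m n)) \<and>
             summable (\<lambda>m. \<Sum>n. density_term q z x m n) \<and>
             density_fun q z x \<ge> 0) \<and>
     distributed M lborel (exp_functional q Pp Pm)
       (\<lambda>x. ennreal (indicator {0..} x * density_fun q z x))"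
proof -
  interpret prob_space M by fact
  have z: "0 < z" "z < 1"
    using assms(2-5) by (auto simp: powr_def mult_pos_neg)
  interpret poisson_difference M q z Pp Pm
    using assms z by unfold_locales auto
  have mellin_eq: "mellin_transform M functional = mellin"
    by (rule ext) (rule mellin_transform_functional)
  have "open {s. Re s < \<mu>}"
    by (intro open_Collect_less continuous_intros)
  then have analytic: "mellin_transform M functional analytic_on {s. Re s < \<mu>}"
    unfolding mellin_eq using holomorphic_mellin[OF assms(5)] by (simp add: analytic_on_open)
  have AE_int: "AE \<omega> in M. set_integrable lborel {0..} (path \<omega>)"
    using AE_path by eventually_elim simp
  have moments: "integrable M (\<lambda>\<omega>. complex_of_real (functional \<omega>) powr s)"
      "mellin_transform M functional s = mellin_qpoch_form q z s"
      "mellin_qpoch_form q z s = mellin_qgamma_form q \<mu> s" if "Re s < \<mu>" for s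
  proof -
    show "integrable M (\<lambda>\<omega>. complex_of_real (functional \<omega>) powr s)"
      using that less_powr_iff[OF assms(5)] by (intro integrable_functional_powr) simp
    show "mellin_transform M functional s = mellin_qpoch_form q z s"
      unfolding mellin_eq by (rule mellin_eq_qpoch_form[OF assms(5) that])
    show "mellin_qpoch_form q z s = mellin_qgamma_form q \<mu> s"
      by (rule qpoch_form_eq_qgamma_form[OF assms(5) that])
  qed
  have density: "summable (\<lambda>n. density_term q z x m n)"
      "summable (\<lambda>m. \<Sum>n. density_term q z x m n)" "0 \<le> density_fun q z x" if "0 \<le> x" for x m
  proof -
    show "summable (\<lambda>n. density_term q z x m n)"
      by (rule summable_density_term[OF that])
    show "summable (\<lambda>m. \<Sum>n. density_term q z x m n)"
      using summable_weight_profile[OF that] by (simp add: suminf_density_term[OF that] weight_def)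
    show "0 \<le> density_fun q z x"
      by (rule density_fun_nonneg[OF that])
  qed
  show ?thesis
    by (intro conjI allI impI AE_int analytic moments density distributed_functional)
qed

end
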